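(* Let $\Bbbk$ be a field and let $X$ be a finite, connected CW-complex of dimension $n$ with the EPY property over $\Bbbk$; if $\operatorname{char}\Bbbk=2$, assume that $H_1(X,\mathbb{Z})$ has no $2$-torsion. Let $A=H^{\bullet}(X,\Bbbk)$. Then the resonance varieties of $X$ propagate: for any $a\in A^1$, if $H^p(A,a\cdot)\neq 0$, then $H^q(A,a\cdot)\neq 0$ for all $p\leq q\leq n$. Equivalently, \[ \{0\}=\mathcal{R}^0(X,\Bbbk)\subseteq \mathcal{R}^1(X,\Bbbk)\subseteq\cdots\subseteq\mathcal{R}^{n}(X,\Bbbk). \]
   Context: Let $E=\bigwedge V$ be the exterior algebra on a finite-dimensional $\Bbbk$-vector space $V$, graded with $V$ in (cohomological) degree $1$. For a graded $E$-module $M$, write $M^i$ for its component of cohomological degree $i$, let $M(r)^i=M^{i-r}$, and let $M^*$ be the graded dual, $(M^* )^i=\operatorname{Hom}_\Bbbk(M^{-i},\Bbbk)$. A graded $E$-module $M$ is Koszul if it is finitely generated and has a linear free resolution starting in degree $0$, i.e. $\operatorname{Tor}^E_p(M,\Bbbk)^q=0$ for $q\neq p$. A cyclic graded $E$-module $A$ has the EPY property if $A^*(n)$ is a Koszul module for some integer $n$ (which is then the socle degree, i.e. top nonzero degree, of $A$). Equivalently, with $S=\operatorname{Sym}V^*$ and $\omega\in V\otimes V^*$ the canonical element, the cochain complex $(A\otimes_\Bbbk S,\ \omega\cdot)$ has $H^p=0$ for $p\neq n$. A finite-type CW-complex $X$ of dimension $n$ has the EPY property over $\Bbbk$ if $A=H^\bullet(X,\Bbbk)$,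 as a module over $E=\bigwedge H^1(X,\Bbbk)$, is cyclic and $A^*(n)$ is a Koszul module. For $a\in A^1=H^1(X,\Bbbk)$ one has $a^2=0$, and $(A,a\cdot)$ is the cochain complex with terms $A^i$ and differential left-multiplication by $a$. The (depth one) resonance varieties are $\mathcal{R}^p(X,\Bbbk)=\{a\in H^1(X,\Bbbk) : H^p(A,a\cdot)\neq 0\}$. *)

theory Defs
  imports "HOL-Homology.Homology" "HOL-Algebra.Module" "HOL-Algebra.QuotRing"
begin

section \<open>Finite CW complexes\<close>

definition disc :: "nat \<Rightarrow> (nat \<Rightarrow> real) topology" where
  "disc m = subtopology (Euclidean_space m) {x. (\<Sum>i<m. (x i)\<^sup>2) \<le> 1}"

definition open_disc :: "nat \<Rightarrow> (nat \<Rightarrow> real) set" where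
  "open_disc m = {x \<in> topspace (disc m). (\<Sum>i<m. (x i)\<^sup>2) < 1}"

definition disc_boundary :: "nat \<Rightarrow> (nat \<Rightarrow> real) set" where
  "disc_boundary m = {x \<in> topspace (disc m). (\<Sum>i<m. (x i)\<^sup>2) = 1}"

text \<open>
  A CW structure on a Hausdorff space \<open>Y\<close>: \<open>\<E>\<close> is the set of open cells, \<open>d e\<close> the dimension
  and \<open>\<Phi> e\<close> the characteristic map of the cell \<open>e\<close>. The last two clauses are
  closure finiteness and the weak topology.
\<close>

definition cw_structure ::
  "'a topology \<Rightarrow> 'a set set \<Rightarrow> ('a set \<Rightarrow> nat) \<Rightarrow> ('a set \<Rightarrow> (nat \<Rightarrow> real) \<Rightarrow> 'a) \<Rightarrow> bool" where
  "cw_structure Y \<E> d \<Phi> \<longleftrightarrow>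
     Hausdorff_space Y \<and> \<Union>\<E> = topspace Y \<and> pairwise disjnt \<E> \<and>
     (\<forall>e\<in>\<E>. continuous_map (disc (d e)) Y (\<Phi> e) \<and>
            homeomorphic_map (subtopology (disc (d e)) (open_disc (d e))) (subtopology Y e) (\<Phi> e)) \<and>
     (\<forall>e\<in>\<E>. \<exists>F. finite F \<and> F \<subseteq> \<E> \<and> (\<forall>f\<in>F. d f < d e) \<and> \<Phi> e ` disc_boundary (d e) \<subseteq> \<Union>F) \<and>
     (\<forall>C. C \<subseteq> topspace Y \<longrightarrow>
        (\<forall>e\<in>\<E>. closedin (disc (d e)) {x \<in> topspace (disc (d e)). \<Phi> e x \<in> C}) \<longrightarrow> closedin Y C)"

definition finite_CW_complex :: "'a topology \<Rightarrow> nat \<Rightarrow> bool" where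
  "finite_CW_complex Y n \<longleftrightarrow>
     (\<exists>\<E> d \<Phi>. cw_structure Y \<E> d \<Phi> \<and> finite \<E> \<and> (\<forall>e\<in>\<E>. d e \<le> n) \<and> (\<exists>e\<in>\<E>. d e = n))"


section \<open>Vector spaces, quotients, duals\<close>

definition scalars :: "'k::field ring" where
  "scalars = \<lparr>carrier = UNIV, mult = (*), one = 1, zero = 0, add = (+)\<rparr>"

text \<open>
  A vector space over \<open>'k\<close> is a record \<open>M\<close> with \<open>module scalars M\<close>. The fields \<open>mult\<close> and \<open>one\<close>,
  which \<open>module\<close> records inherit from \<open>ring\<close>, carry no meaning.
\<close>

definition linear_maps :: "('k::field, 'm) module \<Rightarrow> ('k, 'n) module \<Rightarrow> ('m \<Rightarrow> 'n) set" where
  "linear_maps M N = {f \<in> carrier M \<rightarrow> carrier N.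
     (\<forall>x\<in>carrier M. \<forall>y\<in>carrier M. f (x \<oplus>\<^bsub>M\<^esub> y) = f x \<oplus>\<^bsub>N\<^esub> f y) \<and>
     (\<forall>c. \<forall>x\<in>carrier M. f (c \<odot>\<^bsub>M\<^esub> x) = c \<odot>\<^bsub>N\<^esub> f x)}"

definition quotient_space :: "('k::field, 'm) module \<Rightarrow> 'm set \<Rightarrow> ('k, 'm set) module" where
  "quotient_space M N =
     \<lparr>carrier = a_rcosets\<^bsub>M\<^esub> N, mult = undefined, one = undefined, zero = N, add = set_add M,
      smult = (\<lambda>c C. \<Union>x\<in>C. N +>\<^bsub>M\<^esub> (c \<odot>\<^bsub>M\<^esub> x))\<rparr>"

text \<open>Functionals are normalised to be \<open>0\<close> outside the carrier.\<close>

definition dual_space :: "('k::field, 'm) module \<Rightarrow> ('k, 'm \<Rightarrow> 'k) module" where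
  "dual_space M =
     \<lparr>carrier = {f. (\<forall>x. x \<notin> carrier M \<longrightarrow> f x = 0) \<and>
                    (\<forall>x\<in>carrier M. \<forall>y\<in>carrier M. f (x \<oplus>\<^bsub>M\<^esub> y) = f x + f y) \<and>
                    (\<forall>c. \<forall>x\<in>carrier M. f (c \<odot>\<^bsub>M\<^esub> x) = c * f x)},
      mult = undefined, one = undefined, zero = (\<lambda>x. 0), add = (\<lambda>f g x. f x + g x),
      smult = (\<lambda>c f x. c * f x)\<rparr>"


section \<open>Singular cohomology with field coefficients and the cup product\<close>

type_synonym 'a simplex = "(nat \<Rightarrow> real) \<Rightarrow> 'a"
type_synonym ('a, 'k) cochain = "'a simplex \<Rightarrow> 'k"

text \<open>Degrees are integers; there are no simplices, hence no nonzero cochains, in negative degrees.\<close>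

definition simplices :: "'a topology \<Rightarrow> int \<Rightarrow> 'a simplex set" where
  "simplices Y p = (if p < 0 then {} else singular_simplex_set (nat p) Y)"

definition cochains :: "'a topology \<Rightarrow> int \<Rightarrow> ('a, 'k::field) cochain set" where
  "cochains Y p = {\<phi>. \<forall>\<sigma>. \<sigma> \<notin> simplices Y p \<longrightarrow> \<phi> \<sigma> = 0}"

definition coboundary :: "'a topology \<Rightarrow> int \<Rightarrow> ('a, 'k::field) cochain \<Rightarrow> ('a, 'k) cochain" where
  "coboundary Y p \<phi> = (\<lambda>\<sigma>. if \<sigma> \<in> simplices Y (p + 1)
     then \<Sum>i\<le>nat (p + 1). (-1) ^ i * \<phi> (singular_face (nat (p + 1)) i \<sigma>) else 0)"

definition cocycle_space :: "'a topology \<Rightarrow> int \<Rightarrow> ('k::field, ('a, 'k) cochain) module" where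
  "cocycle_space Y p =
     \<lparr>carrier = {\<phi> \<in> cochains Y p. coboundary Y p \<phi> = (\<lambda>\<sigma>. 0)},
      mult = undefined, one = undefined, zero = (\<lambda>\<sigma>. 0), add = (\<lambda>\<phi> \<psi> \<sigma>. \<phi> \<sigma> + \<psi> \<sigma>),
      smult = (\<lambda>c \<phi> \<sigma>. c * \<phi> \<sigma>)\<rparr>"

definition coboundaries :: "'a topology \<Rightarrow> int \<Rightarrow> ('a, 'k::field) cochain set" where
  "coboundaries Y p = coboundary Y (p - 1) ` cochains Y (p - 1)"

definition cohomology :: "'a topology \<Rightarrow> int \<Rightarrow> ('k::field, ('a, 'k) cochain set) module" where
  "cohomology Y p = quotient_space (cocycle_space Y p) (coboundaries Y p)"

definition front_face :: "int \<Rightarrow> 'a simplex \<Rightarrow> 'a simplex" where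
  "front_face p \<sigma> = restrict \<sigma> (standard_simplex (nat p))"

definition back_face :: "int \<Rightarrow> int \<Rightarrow> 'a simplex \<Rightarrow> 'a simplex" where
  "back_face p q \<sigma> = restrict (\<lambda>x. \<sigma> (\<lambda>i. if i < nat p then 0 else x (i - nat p))) (standard_simplex (nat q))"

definition cochain_cup ::
  "'a topology \<Rightarrow> int \<Rightarrow> int \<Rightarrow> ('a, 'k::field) cochain \<Rightarrow> ('a, 'k) cochain \<Rightarrow> ('a, 'k) cochain" where
  "cochain_cup Y p q \<phi> \<psi> = (\<lambda>\<sigma>. if \<sigma> \<in> simplices Y (p + q)
     then \<phi> (front_face p \<sigma>) * \<psi> (back_face p q \<sigma>) else 0)"

definition cup ::
  "'a topology \<Rightarrow> int \<Rightarrow> int \<Rightarrow> ('a, 'k::field) cochain set \<Rightarrow> ('a, 'k) cochain set \<Rightarrow> ('a, 'k) cochain set" where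
  "cup Y p q C D =
     (\<Union>\<phi>\<in>C. \<Union>\<psi>\<in>D. coboundaries Y (p + q) +>\<^bsub>cocycle_space Y (p + q)\<^esub> cochain_cup Y p q \<phi> \<psi>)"


section \<open>The exterior algebra\<close>

text \<open>
  The free unital associative algebra on the underlying set of \<open>V\<close>: finitely supported functions on
  words, with concatenation product. The exterior algebra is its quotient by the two-sided ideal
  that makes the inclusion of \<open>V\<close> linear and the squares of its elements zero.
\<close>

definition word :: "'v list \<Rightarrow> 'v list \<Rightarrow> 'k::field" where
  "word w = (\<lambda>u. if u = w then 1 else 0)"

definition free_algebra :: "('k::field, 'v) module \<Rightarrow> ('v list \<Rightarrow> 'k) ring" where
  "free_algebra V =
     \<lparr>carrier = {f. finite {w. f w \<noteq> 0} \<and> (\<forall>w. f w \<noteq> 0 \<longrightarrow> set w \<subseteq> carrier V)},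
      mult = (\<lambda>f g w. \<Sum>i\<le>length w. f (take i w) * g (drop i w)),
      one = word [], zero = (\<lambda>w. 0), add = (\<lambda>f g w. f w + g w)\<rparr>"

definition ext_ideal :: "('k::field, 'v) module \<Rightarrow> ('v list \<Rightarrow> 'k) set" where
  "ext_ideal V = genideal (free_algebra V)
     ({(\<lambda>u. word [x \<oplus>\<^bsub>V\<^esub> y] u - word [x] u - word [y] u) | x y. x \<in> carrier V \<and> y \<in> carrier V} \<union>
      {(\<lambda>u. word [c \<odot>\<^bsub>V\<^esub> x] u - c * word [x] u) | c x. x \<in> carrier V} \<union>
      {word [x, x] | x. x \<in> carrier V})"

definition ext_algebra :: "('k::field, 'v) module \<Rightarrow> ('v list \<Rightarrow> 'k) set ring" where
  "ext_algebra V = free_algebra V Quot ext_ideal V"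

definition ext_class :: "('k::field, 'v) module \<Rightarrow> ('v list \<Rightarrow> 'k) \<Rightarrow> ('v list \<Rightarrow> 'k) set" where
  "ext_class V f = ext_ideal V +>\<^bsub>free_algebra V\<^esub> f"

text \<open>The component of degree \<open>j\<close>; it is zero for negative \<open>j\<close>.\<close>

definition ext_power :: "('k::field, 'v) module \<Rightarrow> int \<Rightarrow> ('k, ('v list \<Rightarrow> 'k) set) module" where
  "ext_power V j =
     \<lparr>carrier = ext_class V ` {f \<in> carrier (free_algebra V). \<forall>w. f w \<noteq> 0 \<longrightarrow> int (length w) = j},
      mult = undefined, one = undefined, zero = \<zero>\<^bsub>ext_algebra V\<^esub>, add = add (ext_algebra V),
      smult = (\<lambda>c e. ext_class V (\<lambda>u. c * word [] u) \<otimes>\<^bsub>ext_algebra V\<^esub> e)\<rparr>"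


section \<open>Graded modules over the exterior algebra\<close>

text \<open>
  A graded module is given by its components. The map \<open>act M j i\<close> is the multiplication
  \<open>\<Lambda>\<^sup>j V \<times> M\<^sup>i \<rightarrow> M\<^sup>(\<^sup>i\<^sup>+\<^sup>j\<^sup>)\<close>.
\<close>

record ('k, 'e, 'm) graded_module =
  component :: "int \<Rightarrow> ('k, 'm) module"
  act :: "int \<Rightarrow> int \<Rightarrow> 'e \<Rightarrow> 'm \<Rightarrow> 'm"

definition graded_ext_module ::
  "('k::field, 'v) module \<Rightarrow> ('k, ('v list \<Rightarrow> 'k) set, 'm) graded_module \<Rightarrow> bool" where
  "graded_ext_module V M \<longleftrightarrow>
     (\<forall>i. module scalars (component M i)) \<and>
     (\<forall>i j. \<forall>e\<in>carrier (ext_power V j). act M j i e \<in> linear_maps (component M i) (component M (i + j))) \<and>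
     (\<forall>i j. \<forall>e\<in>carrier (ext_power V j). \<forall>f\<in>carrier (ext_power V j). \<forall>x\<in>carrier (component M i).
        act M j i (e \<oplus>\<^bsub>ext_algebra V\<^esub> f) x = act M j i e x \<oplus>\<^bsub>component M (i + j)\<^esub> act M j i f x) \<and>
     (\<forall>i j c. \<forall>e\<in>carrier (ext_power V j). \<forall>x\<in>carrier (component M i).
        act M j i (c \<odot>\<^bsub>ext_power V j\<^esub> e) x = c \<odot>\<^bsub>component M (i + j)\<^esub> act M j i e x) \<and>
     (\<forall>i. \<forall>x\<in>carrier (component M i). act M 0 i \<one>\<^bsub>ext_algebra V\<^esub> x = x) \<and>
     (\<forall>i j l. \<forall>e\<in>carrier (ext_power V j). \<forall>f\<in>carrier (ext_power V l). \<forall>x\<in>carrier (component M i).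
        act M (j + l) i (e \<otimes>\<^bsub>ext_algebra V\<^esub> f) x = act M j (i + l) e (act M l i f x))"

definition graded_hom ::
  "('k::field, 'v) module \<Rightarrow> ('k, ('v list \<Rightarrow> 'k) set, 'm) graded_module \<Rightarrow>
   ('k, ('v list \<Rightarrow> 'k) set, 'n) graded_module \<Rightarrow> (int \<Rightarrow> 'm \<Rightarrow> 'n) set" where
  "graded_hom V M N = {h.
     (\<forall>i. h i \<in> linear_maps (component M i) (component N i)) \<and>
     (\<forall>i j. \<forall>e\<in>carrier (ext_power V j). \<forall>x\<in>carrier (component M i).
        h (i + j) (act M j i e x) = act N j i e (h i x))}"

definition graded_submodule ::
  "('k::field, 'v) module \<Rightarrow> ('k, ('v list \<Rightarrow> 'k) set, 'm) graded_module \<Rightarrow> (int \<Rightarrow> 'm set) \<Rightarrow> bool" where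
  "graded_submodule V M N \<longleftrightarrow>
     (\<forall>i. submodule (N i) scalars (component M i)) \<and>
     (\<forall>i j. \<forall>e\<in>carrier (ext_power V j). \<forall>x\<in>N i. act M j i e x \<in> N (i + j))"

definition generates ::
  "('k::field, 'v) module \<Rightarrow> ('k, ('v list \<Rightarrow> 'k) set, 'm) graded_module \<Rightarrow> (int \<times> 'm) set \<Rightarrow> bool" where
  "generates V M G \<longleftrightarrow>
     (\<forall>(i, x)\<in>G. x \<in> carrier (component M i)) \<and>
     (\<forall>N. graded_submodule V M N \<longrightarrow> (\<forall>(i, x)\<in>G. x \<in> N i) \<longrightarrow> (\<forall>i. N i = carrier (component M i)))"

definition finitely_generated ::
  "('k::field, 'v) module \<Rightarrow> ('k, ('v list \<Rightarrow> 'k) set, 'm) graded_module \<Rightarrow> bool" where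
  "finitely_generated V M \<longleftrightarrow> (\<exists>G. finite G \<and> generates V M G)"

definition cyclic ::
  "('k::field, 'v) module \<Rightarrow> ('k, ('v list \<Rightarrow> 'k) set, 'm) graded_module \<Rightarrow> bool" where
  "cyclic V M \<longleftrightarrow> (\<exists>g. generates V M {g})"

text \<open>\<open>M(r)\<^sup>i = M\<^sup>(\<^sup>i\<^sup>-\<^sup>r\<^sup>)\<close>\<close>

definition shift :: "int \<Rightarrow> ('k, 'e, 'm) graded_module \<Rightarrow> ('k, 'e, 'm) graded_module" where
  "shift r M = \<lparr>component = (\<lambda>i. component M (i - r)), act = (\<lambda>j i. act M j (i - r))\<rparr>"

text \<open>
  The dual of a left module is a left module with the Koszul sign:
  \<open>(e f)(x) = (-1)\<^sup>(\<^sup>i\<^sup>j\<^sup>) f(e x)\<close> for \<open>e\<close> of degree \<open>j\<close> and \<open>f\<close> of degree \<open>i\<close>.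
\<close>

definition graded_dual ::
  "('k::field, 'e, 'm) graded_module \<Rightarrow> ('k, 'e, 'm \<Rightarrow> 'k) graded_module" where
  "graded_dual M =
     \<lparr>component = (\<lambda>i. dual_space (component M (- i))),
      act = (\<lambda>j i e f x. if x \<in> carrier (component M (- (i + j)))
               then (-1) powi (i * j) * f (act M j (- (i + j)) e x) else 0)\<rparr>"

text \<open>The free module of rank \<open>b\<close> whose basis lies in degree \<open>p\<close>.\<close>

definition free_module ::
  "('k::field, 'v) module \<Rightarrow> nat \<Rightarrow> int \<Rightarrow> ('k, ('v list \<Rightarrow> 'k) set, nat \<Rightarrow> ('v list \<Rightarrow> 'k) set) graded_module" where
  "free_module V b p =
     \<lparr>component = (\<lambda>i.
        \<lparr>carrier = {..<b} \<rightarrow>\<^sub>E carrier (ext_power V (i - p)), mult = undefined, one = undefined,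
         zero = (\<lambda>s\<in>{..<b}. \<zero>\<^bsub>ext_algebra V\<^esub>), add = (\<lambda>x y. \<lambda>s\<in>{..<b}. x s \<oplus>\<^bsub>ext_algebra V\<^esub> y s),
         smult = (\<lambda>c x. \<lambda>s\<in>{..<b}. c \<odot>\<^bsub>ext_power V (i - p)\<^esub> x s)\<rparr>),
      act = (\<lambda>j i e x. \<lambda>s\<in>{..<b}. e \<otimes>\<^bsub>ext_algebra V\<^esub> x s)\<rparr>"

text \<open>
  A linear free resolution starting in degree \<open>0\<close>: an exact complex
  \<open>\<cdots> \<rightarrow> F\<^sub>2 \<rightarrow> F\<^sub>1 \<rightarrow> F\<^sub>0 \<rightarrow> M \<rightarrow> 0\<close> of graded modules with \<open>F\<^sub>p\<close> free on generators of degree \<open>p\<close>.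
  Such a resolution is minimal, so the ranks are finite whenever \<open>M\<close> is finitely generated.
\<close>

definition has_linear_free_resolution ::
  "('k::field, 'v) module \<Rightarrow> ('k, ('v list \<Rightarrow> 'k) set, 'm) graded_module \<Rightarrow> bool" where
  "has_linear_free_resolution V M \<longleftrightarrow>
     (\<exists>b \<epsilon> d. let F = (\<lambda>p. free_module V (b p) (int p)) in
        \<epsilon> \<in> graded_hom V (F 0) M \<and>
        (\<forall>p. d p \<in> graded_hom V (F (Suc p)) (F p)) \<and>
        (\<forall>i. \<epsilon> i ` carrier (component (F 0) i) = carrier (component M i)) \<and>
        (\<forall>i. d 0 i ` carrier (component (F 1) i) =
             {x \<in> carrier (component (F 0) i). \<epsilon> i x = \<zero>\<^bsub>component M i\<^esub>}) \<and>
        (\<forall>p i. d (Suc p) i ` carrier (component (F (Suc (Suc p))) i) =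
             {x \<in> carrier (component (F (Suc p)) i). d p i x = \<zero>\<^bsub>component (F p) i\<^esub>}))"

definition koszul_module ::
  "('k::field, 'v) module \<Rightarrow> ('k, ('v list \<Rightarrow> 'k) set, 'm) graded_module \<Rightarrow> bool" where
  "koszul_module V M \<longleftrightarrow>
     graded_ext_module V M \<and> finitely_generated V M \<and> has_linear_free_resolution V M"


section \<open>The EPY property and resonance\<close>

text \<open>
  The module structure \<open>\<mu>\<close> is the one induced by the cup product. As \<open>H\<^sup>1\<close> generates the exterior
  algebra, there is at most one, and it exists exactly when \<open>v \<union> (v \<union> x) = 0\<close> for all \<open>v\<close> in \<open>H\<^sup>1\<close>
  and all \<open>x\<close>.
\<close>

definition EPY_property :: "'k::field itself \<Rightarrow> 'a topology \<Rightarrow> nat \<Rightarrow> bool" where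
  "EPY_property _ Y n \<longleftrightarrow>
     (let V = (cohomology Y 1 :: ('k, ('a, 'k) cochain set) module) in
      \<exists>\<mu>. let A = \<lparr>component = cohomology Y, act = \<mu>\<rparr> in
        graded_ext_module V A \<and>
        (\<forall>i. \<forall>v\<in>carrier V. \<forall>x\<in>carrier (component A i).
           \<mu> 1 i (ext_class V (word [v])) x = cup Y 1 i v x) \<and>
        cyclic V A \<and>
        koszul_module V (shift (int n) (graded_dual A)))"

text \<open>The cohomology in degree \<open>p\<close> of the complex \<open>H\<^sup>0 \<rightarrow> H\<^sup>1 \<rightarrow> H\<^sup>2 \<rightarrow> \<cdots>\<close> with differential \<open>a \<union> _\<close>.\<close>

definition aomoto_cohomology ::
  "'a topology \<Rightarrow> ('a, 'k::field) cochain set \<Rightarrow> int \<Rightarrow> ('k, ('a, 'k) cochain set set) module" where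
  "aomoto_cohomology Y a p = quotient_space
     ((cohomology Y p)\<lparr>carrier :=
        {x \<in> carrier (cohomology Y p). cup Y 1 p a x = \<zero>\<^bsub>cohomology Y (p + 1)\<^esub>}\<rparr>)
     (cup Y 1 (p - 1) a ` carrier (cohomology Y (p - 1)))"

definition aomoto_nonzero :: "'a topology \<Rightarrow> ('a, 'k::field) cochain set \<Rightarrow> int \<Rightarrow> bool" where
  "aomoto_nonzero Y a p \<longleftrightarrow>
     carrier (aomoto_cohomology Y a p) \<noteq> {\<zero>\<^bsub>aomoto_cohomology Y a p\<^esub>}"

definition resonance_variety :: "'k::field itself \<Rightarrow> 'a topology \<Rightarrow> nat \<Rightarrow> ('a, 'k) cochain set set" where
  "resonance_variety _ Y p = {a \<in> carrier (cohomology Y 1). aomoto_nonzero Y a (int p)}"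

end

theory Submission
  imports Defs "HOL-Library.Poly_Mapping" "HOL-Library.Multiset" "HOL-Library.Function_Algebras"
    "Jordan_Normal_Form.Determinant"
begin

text \<open>
  The dual \<open>M = A\<^sup>*(n)\<close> has a linear free resolution over \<open>\<Lambda> V\<close>. Let \<open>e\<^sub>1, \<dots>, e\<^sub>m\<close> be a basis of \<open>V\<close>; it is
  finite because almost all contractions commute with the first differential of the resolution, whereas
  \<open>M\<close> is bounded. On families \<open>x\<close> of elements of \<open>M\<close> indexed by multisets \<open>\<alpha>\<close> in \<open>{1, \<dots>, m}\<close> consider
  \<open>(\<delta> x)\<^sub>\<alpha> = \<Sum>\<^sub>l e\<^sub>l x\<^sub>\<alpha>\<^sub>+\<^sub>l\<close>. For free modules this is a Koszul complex, exact in positive degrees, and a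
  chase along the linear resolution carries exactness over to \<open>M\<close>.

  Let \<open>a = \<Sum>\<^sub>l a\<^sub>l e\<^sub>l\<close> and \<open>a \<xi> = 0\<close>. The family \<open>a\<^sup>\<alpha> \<xi>\<close> is a cycle, hence \<open>a\<^sup>\<alpha> \<xi> = (\<delta> \<eta>)\<^sub>\<alpha>\<close>. If
  multiplication by \<open>a\<close> is exact one degree below \<open>\<xi>\<close>, then \<open>\<delta>\<close> has a contracting homotopy near the point
  \<open>a\<close>: the homotopy at \<open>a\<close> gives matrices of polynomials in the shifts which are invertible at \<open>a\<close>, and
  their adjugates turn \<open>\<eta>\<close> into an element \<open>z\<close> with \<open>\<xi> = a z\<close>. So exactness of \<open>(M, a)\<close> propagates upwards
  and exactness of \<open>(A, a)\<close> downwards. Finally \<open>A\<^sup>0\<close> is spanned by the unit since \<open>A\<close> is cyclic, and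
  \<open>a \<union> 1 = a\<close>.
\<close>

section \<open>Polynomials acting on families\<close>

text \<open>A family is a linear map from the polynomial ring to M, given by its values on
  monomials; a variable acts by a shift of the index. The family a^\<alpha> w is a common
  eigenvector of all shifts, and a polynomial acts on it through its value at a. This replaces
  localisation at the point a: a determinant f with f(a) = 1 is never inverted. It is applied to the
  equation and then has no effect on the eigenfamily a^\<alpha> \<xi>, so it disappears in the end.
  Linearity of the resolution carries exactness of \<delta> from free modules to M for this reason:
  a step of the chase climbs one place in the resolution and shortens the multisets by one, but
  leaves the exterior degree unchanged. That degree stays positive, where the Koszul complex is
  exact. The passage between A and its dual rests on separating points from subspaces by
  functionals. Since characteristic 2 is included, e e = 0 is carried along beside the
  anticommutation relations.\<close>

lemma poly_mapping_add_induct [case_names zero single add]: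
  fixes f :: "'i \<Rightarrow>\<^sub>0 'c::comm_monoid_add"
  assumes "P 0" and "\<And>a b. P (Poly_Mapping.single a b)"
    and "\<And>f g. P f \<Longrightarrow> P g \<Longrightarrow> P (f + g)"
  shows "P f"
proof (induction f rule: update_induct)
  case const
  show ?case by (rule assms(1))
next
  case (update f a b)
  have "Poly_Mapping.update a b f = f + Poly_Mapping.single a b"
    using update.hyps(1)
    by (intro poly_mapping_eqI) (auto simp: lookup_update lookup_add lookup_single in_keys_iff when_def)
  then show ?case using assms(2,3) update.IH by simp
qed

locale vector_family = vector_space scale
  for scale :: "'a::field \<Rightarrow> 'b::ab_group_add \<Rightarrow> 'b" (infixr \<open>*\<^sub>k\<close> 75)
begin

text \<open>A finitely supported function on \<open>nat multiset\<close> is a polynomial, a multiset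
  being the exponent of a monomial. The monomial \<beta> acts by shifting the index by \<beta>,
  which makes families a module over the polynomial ring (see \<open>poly_act_mult\<close>).\<close>

definition poly_act :: "(nat multiset \<Rightarrow>\<^sub>0 'a) \<Rightarrow> (nat multiset \<Rightarrow> 'b) \<Rightarrow> nat multiset \<Rightarrow> 'b" where
  "poly_act f x \<alpha> = (\<Sum>\<beta>\<in>Poly_Mapping.keys f. Poly_Mapping.lookup f \<beta> *\<^sub>k x (\<alpha> + \<beta>))"

lemma poly_act_superset:
  assumes "finite S" "Poly_Mapping.keys f \<subseteq> S"
  shows "poly_act f x \<alpha> = (\<Sum>\<beta>\<in>S. Poly_Mapping.lookup f \<beta> *\<^sub>k x (\<alpha> + \<beta>))"
  unfolding poly_act_def
  using assms by (intro sum.mono_neutral_left) (auto simp: in_keys_iff)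

lemma poly_act_single: "poly_act (Poly_Mapping.single \<beta> c) x \<alpha> = c *\<^sub>k x (\<alpha> + \<beta>)"
  using poly_act_superset[of "{\<beta>}" "Poly_Mapping.single \<beta> c" x \<alpha>] by simp

lemma poly_act_zero_left: "poly_act 0 x \<alpha> = 0"
  by (simp add: poly_act_def)

lemma poly_act_one: "poly_act 1 x \<alpha> = x \<alpha>"
  using poly_act_single[of 0 1 x \<alpha>] by simp

lemma poly_act_add_left: "poly_act (f + g) x \<alpha> = poly_act f x \<alpha> + poly_act g x \<alpha>"
proof -
  let ?S = "Poly_Mapping.keys f \<union> Poly_Mapping.keys g"
  have "Poly_Mapping.keys (f + g) \<subseteq> ?S" by (rule Poly_Mapping.keys_add)
  then show ?thesis
    by (simp add: poly_act_superset[of ?S] lookup_add scale_left_distrib sum.distrib)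
qed

lemma poly_act_sum_left: "poly_act (\<Sum>i\<in>S. f i) x \<alpha> = (\<Sum>i\<in>S. poly_act (f i) x \<alpha>)"
  by (induction S rule: infinite_finite_induct) (simp_all add: poly_act_zero_left poly_act_add_left)

lemma poly_act_add: "poly_act f (\<lambda>\<alpha>. x \<alpha> + y \<alpha>) \<alpha> = poly_act f x \<alpha> + poly_act f y \<alpha>"
  by (simp add: poly_act_def scale_right_distrib sum.distrib)

lemma poly_act_zero: "poly_act f (\<lambda>\<alpha>. 0) \<alpha> = 0"
  by (simp add: poly_act_def)

lemma poly_act_sum: "poly_act f (\<lambda>\<alpha>. \<Sum>i\<in>S. x i \<alpha>) \<alpha> = (\<Sum>i\<in>S. poly_act f (x i) \<alpha>)"
  by (induction S rule: infinite_finite_induct) (simp_all add: poly_act_zero poly_act_add)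

text \<open>Additivity in each factor reduces this to monomials, where two shifts compose to a
  single one.\<close>

lemma poly_act_mult: "poly_act (f * g) x \<alpha> = poly_act f (poly_act g x) \<alpha>"
proof (induction f arbitrary: \<alpha> rule: poly_mapping_add_induct)
  case (single a b)
  show ?case
  proof (induction g arbitrary: \<alpha> rule: poly_mapping_add_induct)
    case (add f g)
    then show ?case
      by (simp add: distrib_left poly_act_add_left poly_act_single scale_right_distrib)
  qed (simp_all add: poly_act_zero_left poly_act_single mult_single add.assoc)
qed (simp_all add: poly_act_zero_left poly_act_add_left distrib_right)

lemma poly_act_in: "subspace W \<Longrightarrow> (\<And>\<alpha>. x \<alpha> \<in> W) \<Longrightarrow> poly_act f x \<alpha> \<in> W"
  unfolding poly_act_def by (intro subspace_sum subspace_scale)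

end

section \<open>Evaluation at a point as an eigenvalue of the shifts\<close>

definition monomial_value :: "(nat \<Rightarrow> 'a::comm_semiring_1) \<Rightarrow> nat multiset \<Rightarrow> 'a" where
  "monomial_value a \<alpha> = (\<Prod>l\<in>#\<alpha>. a l)"

lemma monomial_value_empty [simp]: "monomial_value a {#} = 1"
  and monomial_value_add: "monomial_value a (\<alpha> + \<beta>) = monomial_value a \<alpha> * monomial_value a \<beta>"
  and monomial_value_add_mset: "monomial_value a (add_mset l \<alpha>) = a l * monomial_value a \<alpha>"
  by (simp_all add: monomial_value_def)

interpretation field_vs: vector_family "(*) :: 'a::field \<Rightarrow> 'a \<Rightarrow> 'a"
  by unfold_locales (simp_all add: algebra_simps)

text \<open>The value at \<open>a\<close> is read off from the action on the family of monomials in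
  \<open>a\<close>. In this form its multiplicativity comes from
  \<open>poly_act_mult\<close>.\<close>

definition poly_eval :: "(nat \<Rightarrow> 'a::field) \<Rightarrow> (nat multiset \<Rightarrow>\<^sub>0 'a) \<Rightarrow> 'a" where
  "poly_eval a f = field_vs.poly_act f (monomial_value a) {#}"

text \<open>A shift by \<beta> multiplies this family by the scalar a^\<beta>, so it is a
  simultaneous eigenvector and each polynomial acts by its value at \<open>a\<close>.\<close>

lemma poly_act_monomial_value:
  "field_vs.poly_act f (monomial_value a) \<alpha> = poly_eval a f * monomial_value a \<alpha>"
  by (simp add: poly_eval_def field_vs.poly_act_def monomial_value_add sum_distrib_right sum_distrib_left mult_ac)

lemma poly_eval_mult: "poly_eval a (f * g) = poly_eval a f * poly_eval a g"
proof -
  have "field_vs.poly_act f (field_vs.poly_act g (monomial_value a)) {#} =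
      (\<Sum>\<beta>\<in>Poly_Mapping.keys f. poly_eval a g * (Poly_Mapping.lookup f \<beta> * monomial_value a ({#} + \<beta>)))"
    unfolding field_vs.poly_act_def[of f] poly_act_monomial_value by (intro sum.cong) (simp_all add: mult_ac)
  also have "\<dots> = poly_eval a g * poly_eval a f"
    unfolding poly_eval_def[of a f] field_vs.poly_act_def[of f] by (simp only: sum_distrib_left)
  finally show ?thesis
    by (simp add: poly_eval_def field_vs.poly_act_mult)
qed

lemma poly_eval_single: "poly_eval a (Poly_Mapping.single \<beta> c) = c * monomial_value a \<beta>"
  by (simp add: poly_eval_def field_vs.poly_act_single)

lemma poly_eval_add: "poly_eval a (f + g) = poly_eval a f + poly_eval a g"
  by (simp add: poly_eval_def field_vs.poly_act_add_left)

lemma poly_eval_sum: "poly_eval a (\<Sum>i\<in>S. f i) = (\<Sum>i\<in>S. poly_eval a (f i))"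
  by (simp add: poly_eval_def field_vs.poly_act_sum_left)

text \<open>Ring homomorphisms commute with determinants; \<open>shift_operator_adjugate\<close>
  evaluates its determinant at \<open>a\<close> in this way.\<close>

lemma poly_eval_comm_ring_hom: "comm_ring_hom (poly_eval a)"
  by unfold_locales
     (simp_all add: poly_eval_mult poly_eval_add,
      simp_all add: poly_eval_def field_vs.poly_act_one field_vs.poly_act_zero_left)

context vector_family
begin

lemma poly_act_scaled_monomial_value:
  "poly_act f (\<lambda>\<alpha>. monomial_value a \<alpha> *\<^sub>k w) \<alpha> = (poly_eval a f * monomial_value a \<alpha>) *\<^sub>k w"
  unfolding poly_act_monomial_value[symmetric]
  by (simp add: poly_act_def field_vs.poly_act_def scale_sum_left)

text \<open>Passes from families in \<open>W\<close> to scalar families. Linearity of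
  \<open>c\<close> is demanded only on \<open>W\<close>, because \<open>representation\<close> is
  additive only on the span of the basis.\<close>

lemma poly_act_coordinate:
  assumes "\<And>x y. x \<in> W \<Longrightarrow> y \<in> W \<Longrightarrow> c (x + y) = c x + c y" "\<And>k x. x \<in> W \<Longrightarrow> c (k *\<^sub>k x) = k * c x"
    and "subspace W" "\<And>\<alpha>. x \<alpha> \<in> W"
  shows "c (poly_act f x \<alpha>) = field_vs.poly_act f (\<lambda>\<alpha>. c (x \<alpha>)) \<alpha>"
proof -
  have c0: "c 0 = 0" using assms(2)[of 0 0] subspace_0[OF assms(3)] by simp
  have "finite S \<Longrightarrow> c (\<Sum>\<beta>\<in>S. Poly_Mapping.lookup f \<beta> *\<^sub>k x (\<alpha> + \<beta>)) =
      (\<Sum>\<beta>\<in>S. Poly_Mapping.lookup f \<beta> * c (x (\<alpha> + \<beta>)))" for S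
    by (induction S rule: finite_induct)
       (simp_all add: c0 assms subspace_scale subspace_sum)
  then show ?thesis by (simp add: poly_act_def field_vs.poly_act_def)
qed

text \<open>An operator \<open>C + \<Sum>\<^sub>l B\<^sub>l S\<^sub>l\<close> on families with values in \<open>W\<close>, where \<open>S\<^sub>l\<close> shifts the index, is a
  square matrix of polynomials in a basis of \<open>W\<close>; the adjugate matrix inverts it up to its determinant.\<close>

lemma shift_operator_adjugate:
  fixes m :: nat
  assumes W: "subspace W" "finite T" "W \<subseteq> span T"
    and C_lin: "Vector_Spaces.linear scale scale C" "\<forall>w\<in>W. C w \<in> W"
    and B_lin: "\<And>l. Vector_Spaces.linear scale scale (B l)" "\<And>l. \<forall>w\<in>W. B l w \<in> W"
    and at_a: "\<forall>w\<in>W. C w + (\<Sum>l<m. a l *\<^sub>k B l w) = w"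
    and U: "\<And>x \<alpha>. U x \<alpha> = C (x \<alpha>) + (\<Sum>l<m. B l (x (add_mset l \<alpha>)))"
  shows "\<exists>f Adj. poly_eval a f = 1 \<and> (\<forall>x. (\<forall>\<alpha>. x \<alpha> \<in> W) \<longrightarrow>
    (\<forall>\<alpha>. Adj x \<alpha> \<in> W) \<and> Adj (U x) = poly_act f x \<and> U (Adj x) = poly_act f x \<and>
    (\<forall>y. (\<forall>\<alpha>. y \<alpha> \<in> W) \<longrightarrow> Adj (\<lambda>\<alpha>. x \<alpha> + y \<alpha>) = (\<lambda>\<alpha>. Adj x \<alpha> + Adj y \<alpha>)) \<and>
    (\<forall>g. Adj (poly_act g x) = poly_act g (Adj x)))"
proof -
  note C = C_lin(1) C_lin(2)[rule_format] and B = B_lin(1) B_lin(2)[rule_format] and id = at_a[rule_format]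
  obtain Bs where Bs: "Bs \<subseteq> W" "independent Bs" "W \<subseteq> span Bs"
    using maximal_independent_subset[of W] by metis
  have "finite Bs" using independent_span_bound[OF W(2) Bs(2)] Bs(1) W(3) by blast
  then obtain b where b: "bij_betw b {0..<card Bs} Bs" using ex_bij_betw_nat_finite by blast
  define r where "r = card Bs"
  define c where "c j w = representation Bs w (b j)" for j w
  have bW: "b j \<in> W" if "j < r" for j
    using b that Bs(1) by (auto simp: bij_betw_def r_def)
  have spanW: "w \<in> W \<Longrightarrow> w \<in> span Bs" for w using Bs(3) by blast
  have c_add: "c j (x + y) = c j x + c j y" if "x \<in> W" "y \<in> W" for j x y
    using representation_add[OF Bs(2)] spanW that by (simp add: c_def)
  have c_scale: "c j (k *\<^sub>k x) = k * c j x" if "x \<in> W" for j k x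
    using representation_scale[OF Bs(2)] spanW that by (simp add: c_def)
  have c_zero: "c j 0 = 0" for j by (simp add: c_def representation_zero)
  have c_sum: "c j (\<Sum>i\<in>S. x i) = (\<Sum>i\<in>S. c j (x i))" if "\<And>i. i \<in> S \<Longrightarrow> x i \<in> W" for j S and x :: "nat \<Rightarrow> 'b"
    using that by (induction S rule: infinite_finite_induct) (simp_all add: c_zero c_add W subspace_sum)
  have c_comb_W: "c j (\<Sum>k<r. q k *\<^sub>k v k) = (\<Sum>k<r. q k * c j (v k))"
    if v: "\<And>k. k < r \<Longrightarrow> v k \<in> W" for j q and v :: "nat \<Rightarrow> 'b"
  proof -
    have "c j (\<Sum>k<r. q k *\<^sub>k v k) = (\<Sum>k<r. c j (q k *\<^sub>k v k))"
      by (rule c_sum) (rule subspace_scale[OF W(1)], simp add: v)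
    also have "\<dots> = (\<Sum>k<r. q k * c j (v k))"
      by (rule sum.cong[OF refl], rule c_scale, simp add: v)
    finally show ?thesis .
  qed
  have expand: "w = (\<Sum>j<r. c j w *\<^sub>k b j)" if "w \<in> W" for w
  proof -
    have "(\<Sum>j<r. c j w *\<^sub>k b j) = (\<Sum>v\<in>Bs. representation Bs w v *\<^sub>k v)"
      unfolding c_def r_def lessThan_atLeast0
      by (rule sum.reindex_bij_betw[OF b, of "\<lambda>v. representation Bs w v *\<^sub>k v"])
    also have "\<dots> = w"
      by (rule sum_representation_eq[OF Bs(2) spanW[OF that] \<open>finite Bs\<close>]) simp
    finally show ?thesis by simp
  qed
  have c_basis: "c j (b k) = (if j = k then 1 else 0)" if "j < r" "k < r" for j k
  proof -
    have "b k \<in> Bs" using b that by (auto simp: bij_betw_def r_def)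
    moreover have "b j = b k \<longleftrightarrow> j = k"
      using b that by (auto simp: bij_betw_def r_def inj_on_def)
    ultimately show ?thesis by (auto simp: c_def representation_basis[OF Bs(2)])
  qed
  have comb: "(\<Sum>j<r. q j *\<^sub>k b j) \<in> W" for q
    by (intro subspace_sum W subspace_scale) (simp add: bW)
  have c_comb: "c i (\<Sum>j<r. q j *\<^sub>k b j) = q i" if "i < r" for i q
  proof -
    have "c i (\<Sum>j<r. q j *\<^sub>k b j) = (\<Sum>j<r. q j * c i (b j))"
      by (rule c_comb_W) (rule bW)
    also have "\<dots> = (\<Sum>j<r. if i = j then q j else 0)"
      using that by (intro sum.cong) (auto simp: c_basis)
    finally show ?thesis using that by simp
  qed
  have c_eqI: "x = y" if "x \<in> W" "y \<in> W" "\<And>i. i < r \<Longrightarrow> c i x = c i y" for x y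
  proof -
    have "x = (\<Sum>j<r. c j x *\<^sub>k b j)" by (rule expand[OF that(1)])
    also have "\<dots> = (\<Sum>j<r. c j y *\<^sub>k b j)" using that(3) by (intro sum.cong) simp_all
    also have "\<dots> = y" by (rule expand[OF that(2), symmetric])
    finally show ?thesis .
  qed
  \<comment> \<open>The matrix of \<open>C\<close> in the basis \<open>b\<close> gives the constant
    terms, that of \<open>B l\<close> the coefficients of the variable l.\<close>
  define M where "M = mat r r (\<lambda>(j, k). Poly_Mapping.single {#} (c j (C (b k))) +
      (\<Sum>l<m. Poly_Mapping.single {#l#} (c j (B l (b k)))))"
  define app where "app N X j \<alpha> = (\<Sum>k<r. field_vs.poly_act (N $$ (j, k)) (X k) \<alpha>)"
    for N :: "(nat multiset \<Rightarrow>\<^sub>0 'a) mat" and X j \<alpha>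
  have app_cong: "app N X j \<alpha> = app N Y j \<alpha>" if "\<And>k. k < r \<Longrightarrow> X k = Y k" for N X Y j \<alpha>
    using that by (simp add: app_def)
  have app_mult: "app (N * N') X j \<alpha> = app N (app N' X) j \<alpha>"
    if "N \<in> carrier_mat r r" "N' \<in> carrier_mat r r" "j < r" for N N' X j \<alpha>
  proof -
    have "(N * N') $$ (j, k) = (\<Sum>i<r. N $$ (j, i) * N' $$ (i, k))" if "k < r" for k
      using that \<open>N \<in> _\<close> \<open>N' \<in> _\<close> \<open>j < r\<close> by (simp add: scalar_prod_def lessThan_atLeast0)
    then have "app (N * N') X j \<alpha> =
        (\<Sum>k<r. \<Sum>i<r. field_vs.poly_act (N $$ (j, i)) (field_vs.poly_act (N' $$ (i, k)) (X k)) \<alpha>)"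
      by (simp add: app_def field_vs.poly_act_sum_left field_vs.poly_act_mult)
    also have "\<dots> = app N (app N' X) j \<alpha>"
      by (subst sum.swap) (simp add: app_def[abs_def] field_vs.poly_act_sum)
    finally show ?thesis .
  qed
  have app_smult_one: "app (f \<cdot>\<^sub>m 1\<^sub>m r) X j \<alpha> = field_vs.poly_act f (X j) \<alpha>" if "j < r" for f X j \<alpha>
  proof -
    have "app (f \<cdot>\<^sub>m 1\<^sub>m r) X j \<alpha> = (\<Sum>k<r. if j = k then field_vs.poly_act f (X j) \<alpha> else 0)"
      unfolding app_def using that by (intro sum.cong) (auto simp: field_vs.poly_act_zero_left)
    then show ?thesis using that by simp
  qed
  define coord where "coord x k = (\<lambda>\<alpha>. c k (x \<alpha>))" for x :: "nat multiset \<Rightarrow> 'b" and k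
  have UW: "U x \<alpha> \<in> W" if "\<And>\<alpha>. x \<alpha> \<in> W" for x \<alpha>
    unfolding U by (intro subspace_add W C B subspace_sum that)
  interpret C: Vector_Spaces.linear scale scale C by (rule C)
  interpret B: Vector_Spaces.linear scale scale "B l" for l by (rule B)
  have coord_U: "coord (U x) j \<alpha> = app M (coord x) j \<alpha>" if x: "\<And>\<alpha>. x \<alpha> \<in> W" and j: "j < r" for x j \<alpha>
  proof -
    have 1: "c j (C w) = (\<Sum>k<r. c j (C (b k)) * c k w)" if "w \<in> W" for w
    proof -
      have "c j (C w) = c j (\<Sum>k<r. c k w *\<^sub>k C (b k))"
        by (subst expand[OF that]) (simp add: C.sum C.scale)
      also have "\<dots> = (\<Sum>k<r. c j (C (b k)) * c k w)"
        by (subst c_comb_W) (simp_all add: C bW mult.commute)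
      finally show ?thesis .
    qed
    have 2: "c j (B l w) = (\<Sum>k<r. c j (B l (b k)) * c k w)" if "w \<in> W" for w l
    proof -
      have "c j (B l w) = c j (\<Sum>k<r. c k w *\<^sub>k B l (b k))"
        by (subst expand[OF that]) (simp add: B.sum B.scale)
      also have "\<dots> = (\<Sum>k<r. c j (B l (b k)) * c k w)"
        by (subst c_comb_W) (simp_all add: B bW mult.commute)
      finally show ?thesis .
    qed
    have "coord (U x) j \<alpha> = c j (C (x \<alpha>)) + (\<Sum>l<m. c j (B l (x (add_mset l \<alpha>))))"
      unfolding coord_def U by (simp add: c_add c_sum C B W x subspace_sum)
    also have "\<dots> = (\<Sum>k<r. c j (C (b k)) * c k (x \<alpha>) + (\<Sum>l<m. c j (B l (b k)) * c k (x (add_mset l \<alpha>))))"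
      by (simp add: 1[OF x] 2[OF x] sum.distrib) (rule sum.swap)
    also have "\<dots> = app M (coord x) j \<alpha>"
      unfolding app_def
      by (intro sum.cong refl)
         (simp add: M_def j field_vs.poly_act_add_left field_vs.poly_act_sum_left
           field_vs.poly_act_single coord_def)
    finally show ?thesis .
  qed
  define f where "f = det M"
  define Adj where "Adj x \<alpha> = (\<Sum>j<r. app (adj_mat M) (coord x) j \<alpha> *\<^sub>k b j)" for x \<alpha>
  have M: "M \<in> carrier_mat r r" by (simp add: M_def)
  note adj = adj_mat[OF M]
  have AdjW: "Adj x \<alpha> \<in> W" for x \<alpha> unfolding Adj_def by (rule comb)
  have coord_Adj: "coord (Adj x) j = app (adj_mat M) (coord x) j" if "j < r" for x j
    using that by (auto simp: coord_def Adj_def c_comb)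
  have coord_act: "coord (poly_act g x) j = field_vs.poly_act g (coord x j)"
    if "\<And>\<alpha>. x \<alpha> \<in> W" for g x j
    unfolding coord_def using poly_act_coordinate[of W "c j"] c_add c_scale W that by blast
  \<comment> \<open>The entries of \<open>N\<close> commute with \<open>g\<close> in the polynomial
    ring.\<close>
  have app_act: "app N (\<lambda>k. field_vs.poly_act g (X k)) j \<alpha> = field_vs.poly_act g (app N X j) \<alpha>" for N g X j \<alpha>
    unfolding app_def[abs_def] field_vs.poly_act_sum
    by (simp add: field_vs.poly_act_mult[symmetric] mult.commute)
  \<comment> \<open>By \<open>at_a\<close>, substituting \<open>a\<close> turns \<open>M\<close>
    into the identity matrix, whose determinant is 1.\<close>
  have ev: "poly_eval a f = 1"
  proof -
    interpret ev: comm_ring_hom "poly_eval a" by (rule poly_eval_comm_ring_hom)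
    have "map_mat (poly_eval a) M = 1\<^sub>m r"
    proof (rule eq_matI)
      fix j k assume jk: "j < dim_row (1\<^sub>m r :: 'a mat)" "k < dim_col (1\<^sub>m r :: 'a mat)"
      have "map_mat (poly_eval a) M $$ (j, k) = c j (C (b k)) + (\<Sum>l<m. a l * c j (B l (b k)))"
        using jk by (simp add: M_def poly_eval_add poly_eval_sum poly_eval_single monomial_value_add_mset mult.commute)
      also have "\<dots> = c j (C (b k) + (\<Sum>l<m. a l *\<^sub>k B l (b k)))"
        using jk by (simp add: c_add c_sum subspace_sum subspace_scale W C B bW c_scale)
      also have "\<dots> = (if j = k then 1 else 0)"
        using jk by (simp add: id bW c_basis)
      finally show "map_mat (poly_eval a) M $$ (j, k) = 1\<^sub>m r $$ (j, k)" using jk by simp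
    qed (simp_all add: M_def)
    then show ?thesis
      unfolding f_def by (metis ev.hom_det det_one)
  qed
  have AU: "Adj (U x) \<alpha> = poly_act f x \<alpha>" if x: "\<And>\<alpha>. x \<alpha> \<in> W" for x \<alpha>
  proof (rule c_eqI)
    fix i assume i: "i < r"
    have "c i (Adj (U x) \<alpha>) = app (adj_mat M) (coord (U x)) i \<alpha>"
      using coord_Adj[OF i, of "U x"] by (simp add: coord_def fun_eq_iff)
    also have "\<dots> = app (adj_mat M) (app M (coord x)) i \<alpha>"
      by (intro app_cong ext) (simp add: coord_U[OF x])
    also have "\<dots> = field_vs.poly_act f (coord x i) \<alpha>"
      using app_mult[OF adj(1) M i, where X = "coord x" and \<alpha> = \<alpha>] app_smult_one[OF i] by (simp add: adj f_def)
    also have "\<dots> = c i (poly_act f x \<alpha>)"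
      using coord_act[OF x, where g = f and j = i] by (simp add: coord_def fun_eq_iff)
    finally show "c i (Adj (U x) \<alpha>) = c i (poly_act f x \<alpha>)" .
  qed (simp_all add: AdjW poly_act_in[OF W(1)] x)
  have UA: "U (Adj x) \<alpha> = poly_act f x \<alpha>" if x: "\<And>\<alpha>. x \<alpha> \<in> W" for x \<alpha>
  proof (rule c_eqI)
    fix i assume i: "i < r"
    have "c i (U (Adj x) \<alpha>) = app M (coord (Adj x)) i \<alpha>"
      using coord_U[where x = "Adj x" and j = i and \<alpha> = \<alpha>] AdjW i by (simp add: coord_def)
    also have "\<dots> = app M (app (adj_mat M) (coord x)) i \<alpha>"
      by (intro app_cong) (simp add: coord_Adj)
    also have "\<dots> = field_vs.poly_act f (coord x i) \<alpha>"
      using app_mult[OF M adj(1) i, where X = "coord x" and \<alpha> = \<alpha>] app_smult_one[OF i] by (simp add: adj f_def)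
    also have "\<dots> = c i (poly_act f x \<alpha>)"
      using coord_act[OF x, where g = f and j = i] by (simp add: coord_def fun_eq_iff)
    finally show "c i (U (Adj x) \<alpha>) = c i (poly_act f x \<alpha>)" .
  qed (simp_all add: AdjW UW poly_act_in[OF W(1)] x)
  have Aadd: "Adj (\<lambda>\<alpha>. x \<alpha> + y \<alpha>) \<alpha> = Adj x \<alpha> + Adj y \<alpha>" if "\<And>\<alpha>. x \<alpha> \<in> W" "\<And>\<alpha>. y \<alpha> \<in> W" for x y \<alpha>
  proof -
    have "coord (\<lambda>\<alpha>. x \<alpha> + y \<alpha>) k = (\<lambda>\<alpha>. coord x k \<alpha> + coord y k \<alpha>)" for k
      using that by (simp add: coord_def c_add)
    then show ?thesis
      by (simp add: Adj_def app_def field_vs.poly_act_add sum.distrib scale_left_distrib)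
  qed
  have Aact: "Adj (poly_act g x) \<alpha> = poly_act g (Adj x) \<alpha>" if x: "\<And>\<alpha>. x \<alpha> \<in> W" for x g \<alpha>
  proof (rule c_eqI)
    fix i assume i: "i < r"
    have "c i (Adj (poly_act g x) \<alpha>) = app (adj_mat M) (coord (poly_act g x)) i \<alpha>"
      using coord_Adj[OF i, of "poly_act g x"] by (simp add: coord_def fun_eq_iff)
    also have "\<dots> = app (adj_mat M) (\<lambda>k. field_vs.poly_act g (coord x k)) i \<alpha>"
      by (intro app_cong) (simp add: coord_act[OF x])
    also have "\<dots> = field_vs.poly_act g (coord (Adj x) i) \<alpha>"
      by (simp add: app_act coord_Adj[OF i])
    also have "\<dots> = c i (poly_act g (Adj x) \<alpha>)"
      using coord_act[where x = "Adj x" and g = g and j = i] AdjW by (simp add: coord_def fun_eq_iff)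
    finally show "c i (Adj (poly_act g x) \<alpha>) = c i (poly_act g (Adj x) \<alpha>)" .
  qed (simp_all add: AdjW poly_act_in[OF W(1)] x)
  show ?thesis
    by (intro exI[of _ f] exI[of _ Adj]) (simp add: fun_eq_iff ev AdjW AU UA Aadd Aact)
qed

end

section \<open>Exactness at a point\<close>

text \<open>The off-diagonal terms cancel in pairs. The diagonal has a condition of its own, since
  in characteristic 2 it does not follow from antisymmetry.\<close>

lemma sum_antisymmetric:
  fixes g :: "nat \<Rightarrow> nat \<Rightarrow> 'f::ab_group_add"
  assumes "\<And>l k. l < m \<Longrightarrow> k < m \<Longrightarrow> g l k + g k l = 0" "\<And>l. l < m \<Longrightarrow> g l l = 0"
  shows "(\<Sum>l<m. \<Sum>k<m. g l k) = 0"
  using assms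
proof (induction m)
  case (Suc m)
  have "(\<Sum>l<Suc m. \<Sum>k<Suc m. g l k) = (\<Sum>l<m. \<Sum>k<m. g l k) + ((\<Sum>l<m. g l m + g m l) + g m m)"
    by (simp add: sum.distrib)
  then show ?case using Suc by simp
qed simp

text \<open>The differential \<delta> for the first \<open>r\<close> operators only; the bound is a
  parameter because \<open>koszul_exact_gen\<close> is proved by induction on it.\<close>

definition shift_sum :: "(nat \<Rightarrow> 'b \<Rightarrow> 'c::ab_group_add) \<Rightarrow> nat \<Rightarrow> (nat multiset \<Rightarrow> 'b) \<Rightarrow> nat multiset \<Rightarrow> 'c" where
  "shift_sum e r x \<alpha> = (\<Sum>l<r. e l (x (add_mset l \<alpha>)))"

context vector_family
begin

lemma linearI:
  "(\<And>x y. f (x + y) = f x + f y) \<Longrightarrow> (\<And>c x. f (c *\<^sub>k x) = c *\<^sub>k f x) \<Longrightarrow> Vector_Spaces.linear scale scale f"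
  by unfold_locales simp_all

lemma linearD:
  assumes "Vector_Spaces.linear scale scale f"
  shows "f (x + y) = f x + f y" "f (c *\<^sub>k x) = c *\<^sub>k f x" "f (x - y) = f x - f y" "f 0 = 0"
    "f (\<Sum>i\<in>S. g i) = (\<Sum>i\<in>S. f (g i))"
proof -
  interpret Vector_Spaces.linear scale scale f by fact
  show "f (x + y) = f x + f y" "f (c *\<^sub>k x) = c *\<^sub>k f x" "f (x - y) = f x - f y" "f 0 = 0"
    "f (\<Sum>i\<in>S. g i) = (\<Sum>i\<in>S. f (g i))"
    by (simp_all add: add scale diff zero sum)
qed

lemma poly_act_linear:
  "Vector_Spaces.linear scale scale L \<Longrightarrow> L (poly_act f x \<alpha>) = poly_act f (\<lambda>\<alpha>. L (x \<alpha>)) \<alpha>"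
  by (simp add: poly_act_def linearD)

text \<open>The operators do not depend on the index, so they commute with shifts.\<close>

lemma shift_sum_poly_act:
  assumes "\<And>l. Vector_Spaces.linear scale scale (e l)"
  shows "shift_sum e m (poly_act f x) \<alpha> = poly_act f (shift_sum e m x) \<alpha>"
  unfolding shift_sum_def poly_act_sum
  by (simp add: poly_act_def[abs_def] linearD[OF assms])

text \<open>A choice of \<open>s, s\<^sub>1\<close> with \<open>A\<^sub>0 s + s\<^sub>1 A\<^sub>1 = 1\<close> on \<open>W\<^sub>1\<close> gives the operators \<open>U\<^sub>1 = A\<^sub>0 s + s\<^sub>1 \<delta>\<close> and
  \<open>U\<^sub>2 = \<delta> s + s\<^sub>1 A\<^sub>1\<close>. Both become the identity at \<open>a\<close>, and \<open>U\<^sub>1 \<delta> s = (A\<^sub>0 s) U\<^sub>2\<close>.\<close>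

lemma exactness_at_point_propagates:
  fixes e0 e1 :: "nat \<Rightarrow> 'b \<Rightarrow> 'b" and a :: "nat \<Rightarrow> 'a" and m :: nat
  assumes lin0: "\<And>l. Vector_Spaces.linear scale scale (e0 l)"
    and lin1: "\<And>l. Vector_Spaces.linear scale scale (e1 l)"
    and W0: "subspace W0" and W1: "subspace W1" "finite T" "W1 \<subseteq> span T"
    and maps: "\<And>l w. w \<in> W0 \<Longrightarrow> e0 l w \<in> W1"
    and anti: "\<And>l k w. l < m \<Longrightarrow> k < m \<Longrightarrow> w \<in> W0 \<Longrightarrow> e1 l (e0 k w) + e1 k (e0 l w) = 0"
      "\<And>l w. l < m \<Longrightarrow> w \<in> W0 \<Longrightarrow> e1 l (e0 l w) = 0"
    and exact: "\<And>w. w \<in> W1 \<Longrightarrow> (\<Sum>l<m. a l *\<^sub>k e1 l w) = 0 \<Longrightarrow> \<exists>y\<in>W0. w = (\<Sum>l<m. a l *\<^sub>k e0 l y)"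
    and eta: "\<And>\<alpha>. \<eta> \<alpha> \<in> W1" "\<And>\<alpha>. shift_sum e1 m \<eta> \<alpha> = monomial_value a \<alpha> *\<^sub>k \<xi>"
  shows "\<exists>z\<in>W1. \<xi> = (\<Sum>l<m. a l *\<^sub>k e1 l z)"
proof -
  interpret pair: vector_space_pair scale scale by unfold_locales
  define A0 where "A0 w = (\<Sum>l<m. a l *\<^sub>k e0 l w)" for w
  define A1 where "A1 w = (\<Sum>l<m. a l *\<^sub>k e1 l w)" for w
  have linA0: "Vector_Spaces.linear scale scale A0"
    by (rule linearI) (simp_all add: A0_def linearD[OF lin0] scale_right_distrib sum.distrib
        scale_sum_right scale_left_commute mult.commute)
  have linA1: "Vector_Spaces.linear scale scale A1"
    by (rule linearI) (simp_all add: A1_def linearD[OF lin1] scale_right_distrib sum.distrib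
        scale_sum_right scale_left_commute mult.commute)
  \<comment> \<open>A linear section of \<open>A0\<close> over its image, with values in
    \<open>W0\<close>; \<open>s1\<close> is the analogue for \<open>A1\<close>.\<close>
  obtain s where s: "range s \<subseteq> W0" "Vector_Spaces.linear scale scale s" "\<And>v. v \<in> A0 ` W0 \<Longrightarrow> A0 (s v) = v"
    using pair.linear_exists_right_inverse_on[OF linA0 W0] by blast
  obtain s1 where s1: "range s1 \<subseteq> W1" "Vector_Spaces.linear scale scale s1" "\<And>v. v \<in> A1 ` W1 \<Longrightarrow> A1 (s1 v) = v"
    using pair.linear_exists_right_inverse_on[OF linA1 W1(1)] by blast
  have s1W: "s1 w \<in> W1" and sW: "s w \<in> W0" for w using s s1 by blast+
  note lins = linearD[OF lin0] linearD[OF lin1] linearD[OF linA0] linearD[OF linA1]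
    linearD[OF s(2)] linearD[OF s1(2)]
  \<comment> \<open>\<open>C\<close> projects \<open>W1\<close> onto the kernel of
    \<open>A1\<close>. By exactness it equals \<open>A0\<close> after \<open>S\<close> on
    \<open>W1\<close>, so \<open>S\<close> and \<open>s1\<close> form a contracting homotopy
    there.\<close>
  define C where "C w = w - s1 (A1 w)" for w
  define S where "S w = s (C w)" for w
  have linC: "Vector_Spaces.linear scale scale C"
    by (rule linearI) (simp_all add: C_def lins scale_right_diff_distrib)
  have linS: "Vector_Spaces.linear scale scale S"
    by (rule linearI) (simp_all add: S_def linearD[OF linC] lins)
  have CW: "C w \<in> W1" if "w \<in> W1" for w
    using that s1W W1(1) by (simp add: C_def subspace_diff)
  have SW: "S w \<in> W0" for w by (simp add: S_def sW)
  have A1C: "A1 (C w) = 0" if "w \<in> W1" for w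
    using that s1(3)[of "A1 w"] by (simp add: C_def lins)
  have A0S: "A0 (S w) = C w" if "w \<in> W1" for w
    using exact[of "C w"] A1C[OF that] CW[OF that] s(3)[of "C w"]
    by (auto simp: S_def A0_def A1_def)
  let ?\<kappa> = "\<lambda>w \<alpha>. monomial_value a \<alpha> *\<^sub>k w"
  define U1 where "U1 x \<alpha> = C (x \<alpha>) + s1 (shift_sum e1 m x \<alpha>)" for x \<alpha>
  define U2 where "U2 x \<alpha> = s1 (A1 (x \<alpha>)) + shift_sum e0 m (\<lambda>\<alpha>. S (x \<alpha>)) \<alpha>" for x \<alpha>
  have U1': "U1 x \<alpha> = C (x \<alpha>) + (\<Sum>l<m. s1 (e1 l (x (add_mset l \<alpha>))))" for x \<alpha>
    by (simp add: U1_def shift_sum_def lins)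
  have U2': "U2 x \<alpha> = s1 (A1 (x \<alpha>)) + (\<Sum>l<m. e0 l (S (x (add_mset l \<alpha>))))" for x \<alpha>
    by (simp add: U2_def shift_sum_def)
  have id1: "\<forall>w\<in>W1. C w + (\<Sum>l<m. a l *\<^sub>k s1 (e1 l w)) = w"
    by (simp add: C_def A1_def lins)
  have id2: "\<forall>w\<in>W1. s1 (A1 w) + (\<Sum>l<m. a l *\<^sub>k e0 l (S w)) = w"
    using A0S by (simp add: A0_def C_def algebra_simps)
  have linB: "Vector_Spaces.linear scale scale (\<lambda>w. s1 (e1 l w))" "Vector_Spaces.linear scale scale (\<lambda>w. e0 l (S w))"
    "Vector_Spaces.linear scale scale (\<lambda>w. s1 (A1 w))" for l
    by (rule linearI; simp add: lins linearD[OF linS])+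
  have maps1: "\<forall>w\<in>W1. C w \<in> W1" "\<forall>w\<in>W1. s1 (e1 l w) \<in> W1" "\<forall>w\<in>W1. s1 (A1 w) \<in> W1"
    "\<forall>w\<in>W1. e0 l (S w) \<in> W1" for l
    using CW s1W maps SW by blast+
  obtain f1 Adj1 where f1: "poly_eval a f1 = 1" and "\<forall>x. (\<forall>\<alpha>. x \<alpha> \<in> W1) \<longrightarrow>
    (\<forall>\<alpha>. Adj1 x \<alpha> \<in> W1) \<and> Adj1 (U1 x) = poly_act f1 x \<and> U1 (Adj1 x) = poly_act f1 x \<and>
    (\<forall>y. (\<forall>\<alpha>. y \<alpha> \<in> W1) \<longrightarrow> Adj1 (\<lambda>\<alpha>. x \<alpha> + y \<alpha>) = (\<lambda>\<alpha>. Adj1 x \<alpha> + Adj1 y \<alpha>)) \<and>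
    (\<forall>g. Adj1 (poly_act g x) = poly_act g (Adj1 x))"
    using shift_operator_adjugate[OF W1 linC maps1(1) linB(1) maps1(2) id1 U1'] by (elim exE conjE) (rule that)
  then have Adj1: "(\<And>\<alpha>. x \<alpha> \<in> W1) \<Longrightarrow> Adj1 x \<alpha> \<in> W1"
      "(\<And>\<alpha>. x \<alpha> \<in> W1) \<Longrightarrow> Adj1 (U1 x) \<alpha> = poly_act f1 x \<alpha>"
      "(\<And>\<alpha>. x \<alpha> \<in> W1) \<Longrightarrow> U1 (Adj1 x) \<alpha> = poly_act f1 x \<alpha>"
      "(\<And>\<alpha>. x \<alpha> \<in> W1) \<Longrightarrow> (\<And>\<alpha>. y \<alpha> \<in> W1) \<Longrightarrow> Adj1 (\<lambda>\<alpha>. x \<alpha> + y \<alpha>) \<alpha> = Adj1 x \<alpha> + Adj1 y \<alpha>"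
      "(\<And>\<alpha>. x \<alpha> \<in> W1) \<Longrightarrow> Adj1 (poly_act g x) \<alpha> = poly_act g (Adj1 x) \<alpha>" for x y g \<alpha>
    by simp_all
  obtain f2 Adj2 where f2: "poly_eval a f2 = 1" and "\<forall>x. (\<forall>\<alpha>. x \<alpha> \<in> W1) \<longrightarrow>
    (\<forall>\<alpha>. Adj2 x \<alpha> \<in> W1) \<and> Adj2 (U2 x) = poly_act f2 x \<and> U2 (Adj2 x) = poly_act f2 x \<and>
    (\<forall>y. (\<forall>\<alpha>. y \<alpha> \<in> W1) \<longrightarrow> Adj2 (\<lambda>\<alpha>. x \<alpha> + y \<alpha>) = (\<lambda>\<alpha>. Adj2 x \<alpha> + Adj2 y \<alpha>)) \<and>
    (\<forall>g. Adj2 (poly_act g x) = poly_act g (Adj2 x))"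
    using shift_operator_adjugate[OF W1 linB(3) maps1(3) linB(2) maps1(4) id2 U2'] by (elim exE conjE) (rule that)
  then have Adj2: "(\<And>\<alpha>. x \<alpha> \<in> W1) \<Longrightarrow> Adj2 x \<alpha> \<in> W1"
      "(\<And>\<alpha>. x \<alpha> \<in> W1) \<Longrightarrow> Adj2 (U2 x) \<alpha> = poly_act f2 x \<alpha>"
      "(\<And>\<alpha>. x \<alpha> \<in> W1) \<Longrightarrow> U2 (Adj2 x) \<alpha> = poly_act f2 x \<alpha>"
      "(\<And>\<alpha>. x \<alpha> \<in> W1) \<Longrightarrow> (\<And>\<alpha>. y \<alpha> \<in> W1) \<Longrightarrow> Adj2 (\<lambda>\<alpha>. x \<alpha> + y \<alpha>) \<alpha> = Adj2 x \<alpha> + Adj2 y \<alpha>"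
      "(\<And>\<alpha>. x \<alpha> \<in> W1) \<Longrightarrow> Adj2 (poly_act g x) \<alpha> = poly_act g (Adj2 x) \<alpha>" for x y g \<alpha>
    by simp_all
  \<comment> \<open>The adjugate identity makes \<open>U2 x2\<close> equal to \<open>f2\<close>
    applied to \<eta>. Thus, up to \<open>f2\<close>, \<eta> is the boundary \<open>y\<close> plus a
    term in the image of \<open>s1\<close>.\<close>
  define x2 where "x2 = Adj2 \<eta>"
  have x2W: "x2 \<alpha> \<in> W1" for \<alpha> unfolding x2_def by (rule Adj2(1)) (rule eta(1))
  define y where "y = shift_sum e0 m (\<lambda>\<alpha>. S (x2 \<alpha>))"
  have yW: "y \<alpha> \<in> W1" for \<alpha>
    unfolding y_def shift_sum_def by (intro subspace_sum W1 maps SW)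
  have dy: "shift_sum e1 m y \<alpha> = 0" for \<alpha>
  proof -
    have "shift_sum e1 m y \<alpha> = (\<Sum>l<m. \<Sum>k<m. e1 l (e0 k (S (x2 (add_mset k (add_mset l \<alpha>))))))"
      by (simp add: shift_sum_def y_def lins)
    also have "\<dots> = 0"
    proof (rule sum_antisymmetric)
      fix l k assume "l < m" "k < m"
      then show "e1 l (e0 k (S (x2 (add_mset k (add_mset l \<alpha>))))) +
          e1 k (e0 l (S (x2 (add_mset l (add_mset k \<alpha>))))) = 0"
        using anti(1)[OF _ _ SW] by (simp add: add_mset_commute)
    qed (simp add: anti(2) SW)
    finally show ?thesis .
  qed
  have CC: "C (s1 (A1 w)) = 0" if "w \<in> W1" for w
    using that s1(3)[of "A1 w"] by (simp add: C_def)
  \<comment> \<open>\<delta> kills \<open>y\<close>, and \<open>C\<close> kills the term of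
    \<open>U2 x2\<close> that comes from \<open>s1\<close>; what remains depends on \<eta> only
    through \<open>C\<close>.\<close>
  have U1y: "U1 y = poly_act f2 (\<lambda>\<alpha>. C (\<eta> \<alpha>))"
  proof
    fix \<alpha>
    have "U1 y \<alpha> = C (y \<alpha>)" by (simp add: U1_def dy lins)
    also have "\<dots> = C (U2 x2 \<alpha>)"
      by (simp add: U2_def y_def linearD[OF linC] CC[OF x2W])
    also have "\<dots> = C (poly_act f2 \<eta> \<alpha>)" by (simp add: x2_def Adj2(3) eta(1))
    finally show "U1 y \<alpha> = poly_act f2 (\<lambda>\<alpha>. C (\<eta> \<alpha>)) \<alpha>" by (simp add: poly_act_linear[OF linC])
  qed
  have C\<eta>W: "C (\<eta> \<alpha>) \<in> W1" for \<alpha> by (rule CW) (rule eta(1))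
  have 1: "poly_act f2 (Adj1 (\<lambda>\<alpha>. C (\<eta> \<alpha>))) \<alpha> = poly_act f1 y \<alpha>" for \<alpha>
    using Adj1(2)[where x = y and \<alpha> = \<alpha>, OF yW] Adj1(5)[where x = "\<lambda>\<alpha>. C (\<eta> \<alpha>)" and g = f2 and \<alpha> = \<alpha>, OF C\<eta>W] by (simp add: U1y)
  \<comment> \<open>The candidate preimage. As \<delta> of \<eta> is the eigenfamily of \<xi>,
    applying \<open>U1\<close> to \<eta> gives \<open>C\<close> of \<eta> plus the eigenfamily of
    \<open>z\<close>.\<close>
  define z where "z = s1 \<xi>"
  have zW: "z \<in> W1" by (simp add: z_def s1W)
  have \<kappa>W: "?\<kappa> z \<alpha> \<in> W1" for \<alpha> by (intro subspace_scale W1 zW)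
  \<comment> \<open>\<open>U1\<close> becomes the identity at \<open>a\<close>, hence it fixes
    eigenfamilies with values in \<open>W1\<close>.\<close>
  have "U1 (?\<kappa> z) = ?\<kappa> z"
  proof
    fix \<alpha>
    have "U1 (?\<kappa> z) \<alpha> = monomial_value a \<alpha> *\<^sub>k (C z + (\<Sum>l<m. a l *\<^sub>k s1 (e1 l z)))"
      by (simp add: U1' linearD[OF linC] lins monomial_value_add_mset scale_right_distrib scale_sum_right mult.commute)
    then show "U1 (?\<kappa> z) \<alpha> = ?\<kappa> z \<alpha>" using id1 zW by simp
  qed
  then have 2: "Adj1 (?\<kappa> z) \<alpha> = ?\<kappa> z \<alpha>" for \<alpha>
    using Adj1(2)[where x = "?\<kappa> z" and \<alpha> = \<alpha>, OF \<kappa>W] by (simp add: poly_act_scaled_monomial_value f1)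
  have U1\<eta>: "U1 \<eta> = (\<lambda>\<alpha>. C (\<eta> \<alpha>) + ?\<kappa> z \<alpha>)"
    by (simp add: U1_def fun_eq_iff eta(2) lins z_def)
  have 3: "poly_act f1 \<eta> = (\<lambda>\<alpha>. Adj1 (\<lambda>\<alpha>. C (\<eta> \<alpha>)) \<alpha> + ?\<kappa> z \<alpha>)"
  proof
    fix \<alpha>
    have "poly_act f1 \<eta> \<alpha> = Adj1 (\<lambda>\<alpha>. C (\<eta> \<alpha>) + ?\<kappa> z \<alpha>) \<alpha>"
      using Adj1(2)[where x = \<eta> and \<alpha> = \<alpha>, OF eta(1)] by (simp only: U1\<eta>)
    then show "poly_act f1 \<eta> \<alpha> = Adj1 (\<lambda>\<alpha>. C (\<eta> \<alpha>)) \<alpha> + ?\<kappa> z \<alpha>"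
      by (simp only: Adj1(4)[OF C\<eta>W \<kappa>W] 2)
  qed
  have 4: "poly_act f2 (poly_act f1 \<eta>) = (\<lambda>\<alpha>. poly_act f1 y \<alpha> + ?\<kappa> z \<alpha>)"
    unfolding 3 by (simp add: fun_eq_iff poly_act_add 1 poly_act_scaled_monomial_value f2)
  \<comment> \<open>Read \<delta> of the last equation at the empty multiset: \<open>f1\<close> and
    \<open>f2\<close> act as 1 on the eigenfamily of \<xi>, the summand with \<open>y\<close> is a
    cycle, and the eigenfamily of \<open>z\<close> contributes \<open>A1 z\<close>.\<close>
  have "?\<kappa> \<xi> {#} = shift_sum e1 m (poly_act f2 (poly_act f1 \<eta>)) {#}"
    by (simp add: shift_sum_poly_act[OF lin1, abs_def] eta(2)[abs_def]
        poly_act_scaled_monomial_value[abs_def] f1 f2)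
  also have "\<dots> = shift_sum e1 m (poly_act f1 y) {#} + shift_sum e1 m (?\<kappa> z) {#}"
    unfolding 4 by (simp add: shift_sum_def lins sum.distrib)
  also have "shift_sum e1 m (poly_act f1 y) {#} = 0"
    by (simp add: shift_sum_poly_act[OF lin1] dy[abs_def] poly_act_zero)
  also have "0 + shift_sum e1 m (?\<kappa> z) {#} = A1 z"
    by (simp add: shift_sum_def lins monomial_value_add_mset A1_def)
  finally have "\<xi> = A1 z" by simp
  then show ?thesis using zW by (auto simp: A1_def)
qed

end

section \<open>The Koszul complex of an exterior algebra\<close>

text \<open>Models the graded components of a free module over an exterior algebra:
  \<open>e l\<close> is multiplication by the l-th basis vector, \<open>\<iota> l\<close>
  contraction with the l-th dual vector. The laws are relative to the components \<open>G j\<close>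
  because the ambient type is larger.\<close>

locale contraction_system =
  fixes G :: "nat \<Rightarrow> 'f::ab_group_add set" and e \<iota> :: "nat \<Rightarrow> 'f \<Rightarrow> 'f" and m :: nat
  assumes G_zero: "0 \<in> G j"
    and G_diff: "x \<in> G j \<Longrightarrow> y \<in> G j \<Longrightarrow> x - y \<in> G j"
    and e_in: "l < m \<Longrightarrow> x \<in> G j \<Longrightarrow> e l x \<in> G (Suc j)"
    and e_add: "l < m \<Longrightarrow> x \<in> G j \<Longrightarrow> y \<in> G j \<Longrightarrow> e l (x + y) = e l x + e l y"
    and e_anti: "l < m \<Longrightarrow> k < m \<Longrightarrow> x \<in> G j \<Longrightarrow> e l (e k x) + e k (e l x) = 0"
    and e_sq: "l < m \<Longrightarrow> x \<in> G j \<Longrightarrow> e l (e l x) = 0"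
    and \<iota>_add: "l < m \<Longrightarrow> x \<in> G j \<Longrightarrow> y \<in> G j \<Longrightarrow> \<iota> l (x + y) = \<iota> l x + \<iota> l y"
    and \<iota>_bottom: "l < m \<Longrightarrow> x \<in> G 0 \<Longrightarrow> \<iota> l x = 0"
    and \<iota>_e: "l < m \<Longrightarrow> k < m \<Longrightarrow> x \<in> G j \<Longrightarrow> \<iota> l (e k x) = (if l = k then x else 0) - e k (\<iota> l x)"
    and generated: "x \<in> G (Suc j) \<Longrightarrow> \<exists>y. (\<forall>l<m. y l \<in> G j) \<and> x = (\<Sum>l<m. e l (y l))"
begin

lemma G_neg: "x \<in> G j \<Longrightarrow> - x \<in> G j"
  using G_diff[OF G_zero] by simp

lemma G_add: "x \<in> G j \<Longrightarrow> y \<in> G j \<Longrightarrow> x + y \<in> G j"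
  using G_diff[of x j "- y"] G_neg by simp

lemma G_sum: "(\<And>i. i \<in> S \<Longrightarrow> f i \<in> G j) \<Longrightarrow> sum f S \<in> G j"
  by (induction S rule: infinite_finite_induct) (simp_all add: G_zero G_add)

lemma e_zero: "l < m \<Longrightarrow> e l 0 = 0"
  using e_add[of l 0 0 0] G_zero by simp

lemma \<iota>_zero: "l < m \<Longrightarrow> \<iota> l 0 = 0"
  using \<iota>_bottom G_zero by simp

lemma e_diff: "l < m \<Longrightarrow> x \<in> G j \<Longrightarrow> y \<in> G j \<Longrightarrow> e l (x - y) = e l x - e l y"
  using e_add[of l "x - y" j y] G_diff by (simp add: algebra_simps)

lemma e_sum: "l < m \<Longrightarrow> (\<And>i. i \<in> S \<Longrightarrow> f i \<in> G j) \<Longrightarrow> e l (sum f S) = (\<Sum>i\<in>S. e l (f i))"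
  by (induction S rule: infinite_finite_induct) (simp_all add: e_zero e_add[where j = j] G_sum)

text \<open>\<open>gen r\<close> is the part generated in degree 0 under the first \<open>r\<close> of the operators \<open>e l\<close>.\<close>

fun gen :: "nat \<Rightarrow> nat \<Rightarrow> 'f set" where
  "gen 0 j = (if j = 0 then G 0 else {0})"
| "gen (Suc r) 0 = gen r 0"
| "gen (Suc r) (Suc j) = {x + e r y | x y. x \<in> gen r (Suc j) \<and> y \<in> gen r j}"

lemma gen_subset: "r \<le> m \<Longrightarrow> gen r j \<subseteq> G j"
proof (induction r j rule: gen.induct)
  case (3 r j)
  then show ?case by (auto intro!: G_add e_in)
qed (auto simp: G_zero)

lemma gen_zero: "r \<le> m \<Longrightarrow> 0 \<in> gen r j"
proof (induction r j rule: gen.induct)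
  case (3 r j)
  then show ?case using e_zero[of r] by force
qed (auto simp: G_zero)

lemma gen_diff: "r \<le> m \<Longrightarrow> x \<in> gen r j \<Longrightarrow> y \<in> gen r j \<Longrightarrow> x - y \<in> gen r j"
proof (induction r j arbitrary: x y rule: gen.induct)
  case (3 r j)
  obtain u v u' v' where *: "x = u + e r v" "y = u' + e r v'"
    "u \<in> gen r (Suc j)" "v \<in> gen r j" "u' \<in> gen r (Suc j)" "v' \<in> gen r j"
    using 3 by auto
  have "v \<in> G j" "v' \<in> G j" using * gen_subset[of r j] 3 by auto
  then have "x - y = (u - u') + e r (v - v')"
    using * 3 by (simp add: e_diff)
  moreover have "u - u' \<in> gen r (Suc j)" "v - v' \<in> gen r j"
    using 3 * by simp_all
  ultimately show ?case by auto
qed (auto simp: G_diff)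

lemma gen_add: "r \<le> m \<Longrightarrow> x \<in> gen r j \<Longrightarrow> y \<in> gen r j \<Longrightarrow> x + y \<in> gen r j"
  using gen_diff[of r x j "0 - y"] gen_diff[of r 0 j y] gen_zero by simp

lemma gen_sum: "r \<le> m \<Longrightarrow> (\<And>i. i \<in> S \<Longrightarrow> f i \<in> gen r j) \<Longrightarrow> sum f S \<in> gen r j"
  by (induction S rule: infinite_finite_induct) (simp_all add: gen_zero gen_add)

lemma gen_Suc: "Suc r \<le> m \<Longrightarrow> x \<in> gen r j \<Longrightarrow> x \<in> gen (Suc r) j"
  using e_zero[of r] gen_zero[of r] by (cases j) force+

text \<open>The operator is moved past the last generator by anticommutation, and the sign goes into
  the coefficient of that generator. If it is itself the last generator, its square
  vanishes.\<close>

lemma e_gen: "r \<le> m \<Longrightarrow> l < r \<Longrightarrow> x \<in> gen r j \<Longrightarrow> e l x \<in> gen r (Suc j)"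
proof (induction r arbitrary: j x)
  case (Suc r)
  show ?case
  proof (cases j)
    case 0
    show ?thesis
    proof (cases "l = r")
      case True
      then show ?thesis using Suc.prems 0 gen_zero[of r "Suc 0"] by force
    next
      case False
      then have "e l x \<in> gen r (Suc j)" using Suc 0 by simp
      then show ?thesis by (rule gen_Suc[OF Suc.prems(1)])
    qed
  next
    case (Suc i)
    obtain u v where uv: "x = u + e r v" "u \<in> gen r j" "v \<in> gen r i"
      using Suc.prems Suc by auto
    have G: "u \<in> G j" "v \<in> G i" "e r v \<in> G j"
      using uv gen_subset[of r] Suc.prems e_in[of r v i] Suc by auto
    show ?thesis
    proof (cases "l = r")
      case True
      have "e l x = 0 + e r u"
        using True uv G Suc.prems e_sq[of r v i] by (simp add: e_add[where j = j])
      then show ?thesis using uv gen_zero[of r "Suc j"] Suc.prems by force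
    next
      case False
      have "e l x = e l u + e l (e r v)"
        using uv G Suc.prems by (simp add: e_add[where j = j])
      also have "e l (e r v) = - e r (e l v)"
        using e_anti[of l r v i] G Suc.prems by (simp add: eq_neg_iff_add_eq_0)
      also have "\<dots> = e r (- e l v)"
        using e_diff[of r 0 j "e l v"] e_zero[of r] e_in[of l v i] G G_zero Suc Suc.prems by simp
      finally have *: "e l x = e l u + e r (- e l v)" .
      have "e l u \<in> gen r (Suc j)" "e l v \<in> gen r j"
        using Suc.IH[of u j] Suc.IH[of v i] uv False Suc.prems Suc by auto
      moreover have "- e l v \<in> gen r j"
        using gen_diff[of r 0 j "e l v"] gen_zero calculation Suc.prems by simp
      ultimately show ?thesis using * by auto
    qed
  qed
qed simp

text \<open>\<open>\<iota> k\<close> anticommutes with each earlier \<open>e l\<close> and kills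
  degree 0, so it annihilates all that the earlier operators generate. This lets it detect a
  coefficient of \<open>e k\<close>.\<close>

lemma \<iota>_gen: "r \<le> k \<Longrightarrow> k < m \<Longrightarrow> x \<in> gen r j \<Longrightarrow> \<iota> k x = 0"
proof (induction r j arbitrary: x rule: gen.induct)
  case (3 r j)
  obtain u v where uv: "x = u + e r v" "u \<in> gen r (Suc j)" "v \<in> gen r j"
    using 3 by auto
  have G: "u \<in> G (Suc j)" "v \<in> G j" "e r v \<in> G (Suc j)"
    using uv gen_subset[of r] 3 e_in[of r v j] by auto
  have "\<iota> k x = \<iota> k u + \<iota> k (e r v)" using uv G 3 by (simp add: \<iota>_add[where j = "Suc j"])
  also have "\<dots> = 0" using 3 uv G \<iota>_e[of k r v j] by (simp add: e_zero)
  finally show ?case .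
qed (auto simp: \<iota>_bottom \<iota>_zero split: if_splits)

lemma gen_top: "x \<in> G j \<Longrightarrow> x \<in> gen m j"
proof (induction j arbitrary: x)
  case 0
  have "gen r 0 = G 0" for r by (induction r) simp_all
  then show ?case using 0 by simp
next
  case (Suc j)
  then obtain y where "\<forall>l<m. y l \<in> G j" "x = (\<Sum>l<m. e l (y l))" using generated by blast
  then show ?case using Suc.IH by (auto intro!: gen_sum e_gen)
qed

text \<open>Applying \<open>\<iota> r\<close> to the sum leaves \<open>y\<close>. The splitting in
  the recursion of \<open>gen\<close> is therefore direct, and cycle conditions can be compared
  summand by summand.\<close>

lemma gen_decomposition_unique:
  assumes "r < m" "x \<in> gen r (Suc j)" "y \<in> gen r j" "x + e r y = 0"
  shows "x = 0" "y = 0"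
proof -
  have G: "x \<in> G (Suc j)" "y \<in> G j" "e r y \<in> G (Suc j)"
    using assms gen_subset[of r] e_in[of r y j] by auto
  have "\<iota> r (x + e r y) = \<iota> r x + \<iota> r (e r y)" by (rule \<iota>_add[OF assms(1) G(1,3)])
  also have "\<dots> = y"
    using assms(1) \<iota>_gen[OF order_refl assms(1)] assms(2,3) \<iota>_e[OF assms(1) assms(1) G(2)] by (simp add: e_zero)
  finally have "\<iota> r (x + e r y) = y" .
  then show "y = 0" using assms \<iota>_zero by simp
  then show "x = 0" using assms e_zero by simp
qed

lemma shift_sum_in: "r \<le> m \<Longrightarrow> (\<And>\<alpha>. x \<alpha> \<in> G j) \<Longrightarrow> shift_sum e r x \<alpha> \<in> G (Suc j)"
  unfolding shift_sum_def by (intro G_sum e_in) auto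

lemma shift_sum_gen: "r \<le> m \<Longrightarrow> (\<And>\<alpha>. x \<alpha> \<in> gen r j) \<Longrightarrow> shift_sum e r x \<alpha> \<in> gen r (Suc j)"
  unfolding shift_sum_def by (intro gen_sum e_gen) auto

lemma shift_sum_diff:
  assumes "r \<le> m" "\<And>\<alpha>. x \<alpha> \<in> G j" "\<And>\<alpha>. y \<alpha> \<in> G j"
  shows "shift_sum e r (\<lambda>\<alpha>. x \<alpha> - y \<alpha>) \<alpha> = shift_sum e r x \<alpha> - shift_sum e r y \<alpha>"
  using assms by (simp add: shift_sum_def e_diff[where j = j] sum_subtractf)

lemma shift_sum_add:
  assumes "r \<le> m" "\<And>\<alpha>. x \<alpha> \<in> G j" "\<And>\<alpha>. y \<alpha> \<in> G j"
  shows "shift_sum e r (\<lambda>\<alpha>. x \<alpha> + y \<alpha>) \<alpha> = shift_sum e r x \<alpha> + shift_sum e r y \<alpha>"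
  using assms by (simp add: shift_sum_def e_add[where j = j] sum.distrib)

text \<open>The operators anticommute whereas multisets ignore order, so the terms cancel in
  pairs.\<close>

lemma shift_sum_shift_sum:
  assumes x: "\<And>\<alpha>. x \<alpha> \<in> G j"
  shows "shift_sum e m (shift_sum e m x) \<alpha> = 0"
proof -
  have "shift_sum e m (shift_sum e m x) \<alpha> = (\<Sum>l<m. \<Sum>k<m. e l (e k (x (add_mset k (add_mset l \<alpha>)))))"
    unfolding shift_sum_def by (intro sum.cong refl e_sum[where j = "Suc j"] e_in x) auto
  also have "\<dots> = 0"
    by (rule sum_antisymmetric) (simp_all add: e_anti[OF _ _ x] e_sq[OF _ x] add_mset_commute)
  finally show ?thesis .
qed

text \<open>Write \<open>x = u + e\<^sub>r v\<close>. A primitive \<open>y'\<close> of \<open>u\<close> need not have the shift \<open>v\<close> in direction \<open>r\<close>;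
  the defect is a cycle, and extending it by \<open>0\<close> to the multisets without \<open>r\<close> gives the correction.\<close>

lemma koszul_exact_gen:
  assumes "r \<le> m" "\<And>\<alpha>. x \<alpha> \<in> gen r (Suc j)" "\<And>\<alpha>. shift_sum e r x \<alpha> = 0"
  shows "\<exists>y. (\<forall>\<alpha>. y \<alpha> \<in> gen r j) \<and> (\<forall>\<alpha>. x \<alpha> = shift_sum e r y \<alpha>)"
  using assms
proof (induction r arbitrary: x)
  case 0
  then show ?case by (intro exI[of _ "\<lambda>_. 0"]) (auto simp: shift_sum_def G_zero)
next
  case (Suc r)
  have r: "r < m" "r \<le> m" using Suc.prems by auto
  have "\<exists>u v. x \<alpha> = u + e r v \<and> u \<in> gen r (Suc j) \<and> v \<in> gen r j" for \<alpha>
    using Suc.prems(2)[of \<alpha>] by auto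
  then obtain u v where uv: "\<And>\<alpha>. x \<alpha> = u \<alpha> + e r (v \<alpha>)" "\<And>\<alpha>. u \<alpha> \<in> gen r (Suc j)" "\<And>\<alpha>. v \<alpha> \<in> gen r j"
    by metis
  have G: "u \<alpha> \<in> G (Suc j)" "v \<alpha> \<in> G j" "e r (v \<alpha>) \<in> G (Suc j)" for \<alpha>
    using subsetD[OF gen_subset[OF r(2)] uv(2)] subsetD[OF gen_subset[OF r(2)] uv(3)]
    by (auto intro: e_in[OF r(1)])
  \<comment> \<open>The cycle condition sorted by the occurrence of \<open>e r\<close>; bringing
    \<open>e r\<close> to the front changes the sign of \<delta> v.\<close>
  have key: "shift_sum e r u \<alpha> + e r (u (add_mset r \<alpha>) - shift_sum e r v \<alpha>) = 0" for \<alpha>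
  proof -
    have "e l (e r (v (add_mset l \<alpha>))) = - e r (e l (v (add_mset l \<alpha>)))" if "l < r" for l
      using e_anti[of l r "v (add_mset l \<alpha>)" j] G that r by (simp add: eq_neg_iff_add_eq_0)
    then have "(\<Sum>l<r. e l (e r (v (add_mset l \<alpha>)))) = - (\<Sum>l<r. e r (e l (v (add_mset l \<alpha>))))"
      by (simp add: sum_negf)
    also have "(\<Sum>l<r. e r (e l (v (add_mset l \<alpha>)))) = e r (shift_sum e r v \<alpha>)"
      unfolding shift_sum_def using r G by (subst e_sum[where j = "Suc j"]) (auto intro!: e_in)
    finally have 1: "shift_sum e r (\<lambda>\<alpha>. e r (v \<alpha>)) \<alpha> = - e r (shift_sum e r v \<alpha>)"
      by (simp add: shift_sum_def)
    have 2: "e r (x (add_mset r \<alpha>)) = e r (u (add_mset r \<alpha>))"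
      using G r e_sq[of r "v (add_mset r \<alpha>)" j] by (simp add: uv e_add[where j = "Suc j"])
    have "0 = shift_sum e r x \<alpha> + e r (x (add_mset r \<alpha>))"
      using Suc.prems(3)[of \<alpha>] by (simp add: shift_sum_def)
    also have "\<dots> = shift_sum e r u \<alpha> - e r (shift_sum e r v \<alpha>) + e r (u (add_mset r \<alpha>))"
      using shift_sum_add[of r u "Suc j" "\<lambda>\<alpha>. e r (v \<alpha>)" \<alpha>] G r by (simp add: uv(1)[abs_def] 1 2[unfolded uv(1)])
    also have "\<dots> = shift_sum e r u \<alpha> + e r (u (add_mset r \<alpha>) - shift_sum e r v \<alpha>)"
      using G r shift_sum_in[of r v j] by (simp add: e_diff[where j = "Suc j"])
    finally show ?thesis by simp
  qed
  have "shift_sum e r u \<alpha> \<in> gen r (Suc (Suc j))" "u (add_mset r \<alpha>) - shift_sum e r v \<alpha> \<in> gen r (Suc j)" for \<alpha>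
    using uv r by (auto intro!: shift_sum_gen gen_diff)
  \<comment> \<open>Both parts vanish: u is a cycle for the first r operators, and its shift in
    direction r is the boundary of v.\<close>
  from gen_decomposition_unique[OF r(1) this key]
  have du: "shift_sum e r u \<alpha> = 0" and uv': "u (add_mset r \<alpha>) = shift_sum e r v \<alpha>" for \<alpha> by auto
  obtain y' where y': "\<And>\<alpha>. y' \<alpha> \<in> gen r j" "\<And>\<alpha>. u \<alpha> = shift_sum e r y' \<alpha>"
    using Suc.IH[of u] r uv du by auto
  define \<kappa> where "\<kappa> \<alpha> = v \<alpha> - y' (add_mset r \<alpha>)" for \<alpha>
  have \<kappa>: "\<kappa> \<alpha> \<in> gen r j" for \<alpha> using uv y' r by (auto simp: \<kappa>_def intro: gen_diff)
  have y'G: "y' \<alpha> \<in> G j" and \<kappa>G: "\<kappa> \<alpha> \<in> G j" for \<alpha> using y'(1) \<kappa> gen_subset[OF r(2)] by auto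
  have d\<kappa>: "shift_sum e r \<kappa> \<alpha> = 0" for \<alpha>
  proof -
    have "shift_sum e r \<kappa> \<alpha> = shift_sum e r v \<alpha> - shift_sum e r (\<lambda>\<alpha>. y' (add_mset r \<alpha>)) \<alpha>"
      unfolding \<kappa>_def[abs_def] using r G y'G by (intro shift_sum_diff) auto
    also have "shift_sum e r (\<lambda>\<alpha>. y' (add_mset r \<alpha>)) \<alpha> = u (add_mset r \<alpha>)"
      by (simp add: y' shift_sum_def add_mset_commute)
    finally show ?thesis by (simp add: uv')
  qed
  define \<kappa>' where "\<kappa>' \<alpha> = (if r \<in># \<alpha> then \<kappa> (\<alpha> - {#r#}) else 0)" for \<alpha>
  have \<kappa>': "\<kappa>' \<alpha> \<in> gen r j" for \<alpha> using \<kappa> gen_zero r by (auto simp: \<kappa>'_def)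
  then have \<kappa>'G: "\<kappa>' \<alpha> \<in> G j" for \<alpha> using gen_subset[OF r(2)] by auto
  \<comment> \<open>Adding some l < r to a multiset does not change whether r occurs in it, so the
    extension by 0 is still a cycle.\<close>
  have d\<kappa>': "shift_sum e r \<kappa>' \<alpha> = 0" for \<alpha>
  proof (cases "r \<in># \<alpha>")
    case True
    have "shift_sum e r \<kappa>' \<alpha> = shift_sum e r \<kappa> (\<alpha> - {#r#})"
      unfolding shift_sum_def by (intro sum.cong) (use True in \<open>auto simp: \<kappa>'_def\<close>)
    then show ?thesis using d\<kappa> by simp
  next
    case False
    then show ?thesis using r by (auto simp: shift_sum_def \<kappa>'_def e_zero intro!: sum.neutral)
  qed
  define y where "y \<alpha> = y' \<alpha> + \<kappa>' \<alpha>" for \<alpha>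
  have y: "y \<alpha> \<in> gen r j" for \<alpha> using y' \<kappa>' r by (auto simp: y_def intro: gen_add)
  have "shift_sum e r y \<alpha> = u \<alpha>" for \<alpha>
    unfolding y_def[abs_def] using r shift_sum_add[of r y' j \<kappa>' \<alpha>] y'G \<kappa>'G by (simp add: d\<kappa>' y')
  moreover have "y (add_mset r \<alpha>) = v \<alpha>" for \<alpha>
    by (simp add: y_def \<kappa>'_def \<kappa>_def)
  ultimately have "shift_sum e (Suc r) y \<alpha> = x \<alpha>" for \<alpha>
    using uv by (simp add: shift_sum_def)
  moreover have "y \<alpha> \<in> gen (Suc r) j" for \<alpha> using y gen_Suc Suc.prems by blast
  ultimately show ?case by metis
qed

text \<open>\<delta> relates entries of size N only to those of size N - 1, so one size can be
  treated alone after the others are set to 0. For N = 0 the cycle condition is void.\<close>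

lemma koszul_exact:
  assumes "\<And>\<alpha>. x \<alpha> \<in> G (Suc j)" "\<And>\<alpha>. Suc (size \<alpha>) = N \<Longrightarrow> shift_sum e m x \<alpha> = 0"
  obtains y where "\<And>\<alpha>. y \<alpha> \<in> G j" "\<And>\<alpha>. size \<alpha> = N \<Longrightarrow> x \<alpha> = shift_sum e m y \<alpha>"
proof -
  define x' where "x' \<alpha> = (if size \<alpha> = N then x \<alpha> else 0)" for \<alpha>
  have "x' \<alpha> \<in> gen m (Suc j)" for \<alpha>
    using assms(1) G_zero by (intro gen_top) (simp add: x'_def)
  moreover have "shift_sum e m x' \<alpha> = 0" for \<alpha>
    using assms(2)[of \<alpha>] by (cases "Suc (size \<alpha>) = N") (auto simp: shift_sum_def x'_def e_zero)
  ultimately obtain y where "\<And>\<alpha>. y \<alpha> \<in> gen m j" "\<And>\<alpha>. x' \<alpha> = shift_sum e m y \<alpha>"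
    using koszul_exact_gen[of m x' j] by auto
  note y = this
  show ?thesis
  proof (rule that)
    show "y \<alpha> \<in> G j" for \<alpha> using y(1) gen_subset[of m j] by auto
    show "x \<alpha> = shift_sum e m y \<alpha>" if "size \<alpha> = N" for \<alpha>
      using y(2)[of \<alpha>] that by (simp add: x'_def)
  qed
qed

end

section \<open>Linear resolutions of graded pieces\<close>

text \<open>\<open>G p j\<close> stands for degree p + j of the p-th module, with the generators at
  j = 0. Linearity shows in the indices: \<open>D p j\<close> lowers p by one and raises j by
  one.\<close>

locale linear_resolution =
  fixes G :: "nat \<Rightarrow> nat \<Rightarrow> 'f::ab_group_add set" and e \<iota> :: "nat \<Rightarrow> 'f \<Rightarrow> 'f" and m :: nat
    and D :: "nat \<Rightarrow> nat \<Rightarrow> 'f \<Rightarrow> 'f"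
  assumes contraction: "contraction_system (G p) e \<iota> m"
    and D_in: "x \<in> G (Suc p) j \<Longrightarrow> D p j x \<in> G p (Suc j)"
    and D_add: "x \<in> G (Suc p) j \<Longrightarrow> y \<in> G (Suc p) j \<Longrightarrow> D p j (x + y) = D p j x + D p j y"
    and D_e: "l < m \<Longrightarrow> x \<in> G (Suc p) j \<Longrightarrow> D p (Suc j) (e l x) = e l (D p j x)"
    and D_D: "x \<in> G (Suc (Suc p)) j \<Longrightarrow> D p (Suc j) (D (Suc p) j x) = 0"
    and D_exact: "x \<in> G (Suc p) (Suc j) \<Longrightarrow> D p (Suc j) x = 0 \<Longrightarrow> x \<in> D (Suc p) j ` G (Suc (Suc p)) j"
begin

sublocale G: contraction_system "G p" e \<iota> m for p by (rule contraction)

lemma D_zero: "D p j 0 = 0"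
  using D_add[OF G.G_zero G.G_zero, of p j] by simp

lemma D_sum: "(\<And>i. i \<in> S \<Longrightarrow> f i \<in> G (Suc p) j) \<Longrightarrow> D p j (sum f S) = (\<Sum>i\<in>S. D p j (f i))"
  by (induction S rule: infinite_finite_induct) (simp_all add: D_zero D_add G.G_sum)

lemma D_shift_sum:
  assumes x: "\<And>\<alpha>. x \<alpha> \<in> G (Suc p) j"
  shows "D p (Suc j) (shift_sum e m x \<alpha>) = shift_sum e m (\<lambda>\<alpha>. D p j (x \<alpha>)) \<alpha>"
proof -
  have "D p (Suc j) (shift_sum e m x \<alpha>) = (\<Sum>l<m. D p (Suc j) (e l (x (add_mset l \<alpha>))))"
    unfolding shift_sum_def by (rule D_sum) (auto intro: G.e_in x)
  then show ?thesis by (simp add: shift_sum_def D_e x)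
qed

text \<open>The induction passes from N to N - 1 and from p to p + 1 but keeps the exterior degree j
  + 1. Here linearity of the resolution enters: Koszul exactness, valid in positive exterior degree,
  is available in every round. At N = 0 nothing has to be lifted.\<close>

lemma homogeneous_decomposition:
  assumes "\<And>\<alpha>. \<xi> \<alpha> \<in> G p (Suc j)"
    and "\<And>\<alpha>. Suc (size \<alpha>) = N \<Longrightarrow> shift_sum e m \<xi> \<alpha> \<in> D p (Suc j) ` G (Suc p) (Suc j)"
  shows "\<exists>\<eta> \<zeta>. (\<forall>\<alpha>. \<eta> \<alpha> \<in> G p j) \<and> (\<forall>\<alpha>. \<zeta> \<alpha> \<in> G (Suc p) j) \<and>
    (\<forall>\<alpha>. size \<alpha> = N \<longrightarrow> \<xi> \<alpha> = shift_sum e m \<eta> \<alpha> + D p j (\<zeta> \<alpha>))"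
  using assms
proof (induction N arbitrary: p \<xi>)
  case 0
  obtain y where "\<And>\<alpha>. y \<alpha> \<in> G p j" "\<And>\<alpha>. size \<alpha> = 0 \<Longrightarrow> \<xi> \<alpha> = shift_sum e m y \<alpha>"
    using G.koszul_exact[of \<xi> p j 0, OF 0(1)] by blast
  then show ?case
    by (intro exI[of _ y] exI[of _ "\<lambda>_. 0"]) (simp add: D_zero G.G_zero)
next
  case (Suc N)
  \<comment> \<open>Lift the boundary of \<xi> along \<open>D\<close>, one place up in the
    resolution; on other sizes any element will do.\<close>
  have "\<exists>z. z \<in> G (Suc p) (Suc j) \<and> (size \<alpha> = N \<longrightarrow> shift_sum e m \<xi> \<alpha> = D p (Suc j) z)" for \<alpha>
  proof (cases "size \<alpha> = N")
    case True
    then show ?thesis using Suc.prems(2)[of \<alpha>] by auto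
  qed (use G.G_zero in blast)
  then obtain \<zeta>' where \<zeta>': "\<And>\<alpha>. \<zeta>' \<alpha> \<in> G (Suc p) (Suc j)"
    "\<And>\<alpha>. size \<alpha> = N \<Longrightarrow> shift_sum e m \<xi> \<alpha> = D p (Suc j) (\<zeta>' \<alpha>)"
    by metis
  \<comment> \<open>\<open>D\<close> kills the boundary of the lift because \<delta> squares to 0.
    By exactness it is an image under \<open>D\<close>, as the induction hypothesis
    requires.\<close>
  have "shift_sum e m \<zeta>' \<alpha> \<in> D (Suc p) (Suc j) ` G (Suc (Suc p)) (Suc j)" if "Suc (size \<alpha>) = N" for \<alpha>
  proof (rule D_exact)
    show "shift_sum e m \<zeta>' \<alpha> \<in> G (Suc p) (Suc (Suc j))" by (rule G.shift_sum_in) (auto simp: \<zeta>')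
    have "D p (Suc (Suc j)) (shift_sum e m \<zeta>' \<alpha>) = shift_sum e m (\<lambda>\<alpha>. D p (Suc j) (\<zeta>' \<alpha>)) \<alpha>"
      by (rule D_shift_sum) (rule \<zeta>')
    also have "\<dots> = shift_sum e m (shift_sum e m \<xi>) \<alpha>"
      using that by (simp add: shift_sum_def[of e m _ \<alpha>] \<zeta>'(2))
    also have "\<dots> = 0" by (rule G.shift_sum_shift_sum) (rule Suc.prems(1))
    finally show "D p (Suc (Suc j)) (shift_sum e m \<zeta>' \<alpha>) = 0" .
  qed
  from Suc.IH[of \<zeta>' "Suc p", OF \<zeta>'(1) this] obtain \<eta>' \<zeta>''
    where *: "\<And>\<alpha>. \<eta>' \<alpha> \<in> G (Suc p) j" "\<And>\<alpha>. \<zeta>'' \<alpha> \<in> G (Suc (Suc p)) j"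
      "\<And>\<alpha>. size \<alpha> = N \<Longrightarrow> \<zeta>' \<alpha> = shift_sum e m \<eta>' \<alpha> + D (Suc p) j (\<zeta>'' \<alpha>)"
    by metis
  \<comment> \<open>Subtracting \<open>D\<close> of \<eta>' leaves a true cycle on this size: the
    remaining term is \<open>D\<close> applied twice.\<close>
  have "shift_sum e m (\<lambda>\<alpha>. \<xi> \<alpha> - D p j (\<eta>' \<alpha>)) \<alpha> = 0" if "Suc (size \<alpha>) = Suc N" for \<alpha>
  proof -
    have "shift_sum e m \<xi> \<alpha> = D p (Suc j) (shift_sum e m \<eta>' \<alpha>) + D p (Suc j) (D (Suc p) j (\<zeta>'' \<alpha>))"
      using that \<zeta>'(2)[of \<alpha>] *(3)[of \<alpha>] D_add[OF G.shift_sum_in[OF order_refl *(1)] D_in[OF *(2)]] by simp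
    also have "\<dots> = shift_sum e m (\<lambda>\<alpha>. D p j (\<eta>' \<alpha>)) \<alpha>"
      by (simp add: D_D[OF *(2)] D_shift_sum[OF *(1)])
    finally show ?thesis
      using G.shift_sum_diff[where x = \<xi> and y = "\<lambda>\<alpha>. D p j (\<eta>' \<alpha>)" and \<alpha> = \<alpha>,
          OF order_refl Suc.prems(1) D_in[OF *(1)]] by simp
  qed
  from G.koszul_exact[where x = "\<lambda>\<alpha>. \<xi> \<alpha> - D p j (\<eta>' \<alpha>)",
      OF G.G_diff[OF Suc.prems(1) D_in[OF *(1)]] this]
  obtain y where "\<And>\<alpha>. y \<alpha> \<in> G p j"
    "\<And>\<alpha>. size \<alpha> = Suc N \<Longrightarrow> \<xi> \<alpha> - D p j (\<eta>' \<alpha>) = shift_sum e m y \<alpha>" by blast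
  then show ?case
    using *(1) by (intro exI[of _ y] exI[of _ \<eta>']) (simp add: diff_eq_eq)
qed

end

text \<open>\<open>M\<close> is indexed by all integers since propagation out of degree 0 refers to
  degree -1, while the resolution describes the degrees j \<ge> 0. \<open>eM\<close> is linear on
  the whole type so that library results on linear maps apply to it.\<close>

locale resolved_module = linear_resolution G e \<iota> m D + vector_family scale
  for G :: "nat \<Rightarrow> nat \<Rightarrow> 'f::ab_group_add set" and e \<iota> m D
    and scale :: "'a::field \<Rightarrow> 'b::ab_group_add \<Rightarrow> 'b" (infixr \<open>*\<^sub>k\<close> 75) +
  fixes M :: "int \<Rightarrow> 'b set" and eM :: "int \<Rightarrow> nat \<Rightarrow> 'b \<Rightarrow> 'b" and \<epsilon> :: "nat \<Rightarrow> 'f \<Rightarrow> 'b" and T :: "'b set"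
  assumes M_subspace: "subspace (M i)"
    and eM_linear: "Vector_Spaces.linear scale scale (eM i l)"
    and eM_in: "x \<in> M i \<Longrightarrow> eM i l x \<in> M (i + 1)"
    and eM_anti: "l < m \<Longrightarrow> k < m \<Longrightarrow> x \<in> M i \<Longrightarrow> eM (i + 1) l (eM i k x) + eM (i + 1) k (eM i l x) = 0"
    and eM_sq: "l < m \<Longrightarrow> x \<in> M i \<Longrightarrow> eM (i + 1) l (eM i l x) = 0"
    and \<epsilon>_surj: "\<epsilon> j ` G 0 j = M (int j)"
    and \<epsilon>_add: "u \<in> G 0 j \<Longrightarrow> v \<in> G 0 j \<Longrightarrow> \<epsilon> j (u + v) = \<epsilon> j u + \<epsilon> j v"
    and \<epsilon>_e: "l < m \<Longrightarrow> u \<in> G 0 j \<Longrightarrow> \<epsilon> (Suc j) (e l u) = eM (int j) l (\<epsilon> j u)"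
    and \<epsilon>_D: "u \<in> G 1 j \<Longrightarrow> \<epsilon> (Suc j) (D 0 j u) = 0"
    and \<epsilon>_exact: "u \<in> G 0 (Suc j) \<Longrightarrow> \<epsilon> (Suc j) u = 0 \<Longrightarrow> u \<in> D 0 j ` G 1 j"
    and M0_finite: "finite T" "M 0 \<subseteq> span T"
begin

lemma \<epsilon>_zero: "\<epsilon> j 0 = 0"
  using \<epsilon>_add[OF G.G_zero G.G_zero, of j] by simp

lemma \<epsilon>_sum: "(\<And>i. i \<in> S \<Longrightarrow> f i \<in> G 0 j) \<Longrightarrow> \<epsilon> j (sum f S) = (\<Sum>i\<in>S. \<epsilon> j (f i))"
  by (induction S rule: infinite_finite_induct) (simp_all add: \<epsilon>_zero \<epsilon>_add G.G_sum)

lemma \<epsilon>_in: "x \<in> G 0 j \<Longrightarrow> \<epsilon> j x \<in> M (int j)"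
  using \<epsilon>_surj by blast

lemma \<epsilon>_shift_sum:
  assumes x: "\<And>\<alpha>. x \<alpha> \<in> G 0 j"
  shows "\<epsilon> (Suc j) (shift_sum e m x \<alpha>) = shift_sum (eM (int j)) m (\<lambda>\<alpha>. \<epsilon> j (x \<alpha>)) \<alpha>"
proof -
  have "\<epsilon> (Suc j) (shift_sum e m x \<alpha>) = (\<Sum>l<m. \<epsilon> (Suc j) (e l (x (add_mset l \<alpha>))))"
    unfolding shift_sum_def by (rule \<epsilon>_sum) (auto intro: G.e_in x)
  then show ?thesis by (simp add: shift_sum_def \<epsilon>_e x)
qed

text \<open>Degree j + 1 of the zeroth module is generated by the \<open>e l\<close> over degree j,
  and \<epsilon> transports this to \<open>M\<close>. Matrices and determinants become available
  through this.\<close>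

lemma M_finite_dimensional: "\<exists>T. finite T \<and> M (int j) \<subseteq> span T"
proof (induction j)
  case 0
  then show ?case using M0_finite by auto
next
  case (Suc j)
  then obtain T where T: "finite T" "M (int j) \<subseteq> span T" by blast
  have "M (int (Suc j)) \<subseteq> span (\<Union>l<m. eM (int j) l ` T)"
  proof
    fix x assume "x \<in> M (int (Suc j))"
    then obtain u where u: "u \<in> G 0 (Suc j)" "x = \<epsilon> (Suc j) u" using \<epsilon>_surj[of "Suc j"] by blast
    then obtain y where y: "\<forall>l<m. y l \<in> G 0 j" "u = (\<Sum>l<m. e l (y l))" using G.generated by blast
    then have "x = (\<Sum>l<m. eM (int j) l (\<epsilon> j (y l)))"
      using \<epsilon>_sum[of "{..<m}" "\<lambda>l. e l (y l)" "Suc j"] by (simp add: u G.e_in \<epsilon>_e)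
    moreover have "eM (int j) l (\<epsilon> j (y l)) \<in> span (\<Union>l<m. eM (int j) l ` T)" if "l < m" for l
    proof -
      interpret L: Vector_Spaces.linear scale scale "eM (int j) l" by (rule eM_linear)
      have "eM (int j) l (\<epsilon> j (y l)) \<in> span (eM (int j) l ` T)"
        unfolding L.span_image using T(2) \<epsilon>_in[of "y l" j] y(1) that by blast
      then show ?thesis
        by (rule subsetD[OF span_mono, rotated]) (use that in auto)
    qed
    ultimately show "x \<in> span (\<Union>l<m. eM (int j) l ` T)"
      by (auto intro: span_sum)
  qed
  then show ?case using T(1) by (intro exI[of _ "\<Union>l<m. eM (int j) l ` T"]) auto
qed

text \<open>The boundary of a lift of \<xi> to the zeroth free module is a relation, hence an image
  under \<open>D\<close>, and \<open>homogeneous_decomposition\<close> applies; \<epsilon> then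
  removes the \<open>D\<close>-part. This produces a primitive for each size separately.\<close>

lemma homogeneous_exact:
  assumes \<xi>: "\<And>\<alpha>. \<xi> \<alpha> \<in> M (int (Suc j))" "\<And>\<alpha>. shift_sum (eM (int (Suc j))) m \<xi> \<alpha> = 0"
  obtains \<eta> where "\<And>\<alpha>. \<eta> \<alpha> \<in> M (int j)" "\<And>\<alpha>. \<xi> \<alpha> = shift_sum (eM (int j)) m \<eta> \<alpha>"
proof -
  have "\<exists>u. u \<in> G 0 (Suc j) \<and> \<xi> \<alpha> = \<epsilon> (Suc j) u" for \<alpha>
    using \<xi>(1)[of \<alpha>] \<epsilon>_surj[of "Suc j"] by blast
  then obtain u where u: "\<And>\<alpha>. u \<alpha> \<in> G 0 (Suc j)" "\<And>\<alpha>. \<xi> \<alpha> = \<epsilon> (Suc j) (u \<alpha>)" by metis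
  have u_D: "shift_sum e m u \<alpha> \<in> D 0 (Suc j) ` G (Suc 0) (Suc j)" for \<alpha>
  proof -
    have "\<epsilon> (Suc (Suc j)) (shift_sum e m u \<alpha>) = shift_sum (eM (int (Suc j))) m \<xi> \<alpha>"
      by (simp add: \<epsilon>_shift_sum[OF u(1)] u(2)[abs_def])
    then show ?thesis
      using \<epsilon>_exact[OF G.shift_sum_in[OF order_refl u(1)]] \<xi>(2) by simp
  qed
  have "\<exists>\<eta>. (\<forall>\<alpha>. \<eta> \<alpha> \<in> G 0 j) \<and> (\<forall>\<alpha>. size \<alpha> = N \<longrightarrow> \<xi> \<alpha> = shift_sum (eM (int j)) m (\<lambda>\<alpha>. \<epsilon> j (\<eta> \<alpha>)) \<alpha>)" for N
  proof -
    obtain \<eta> \<zeta> where *: "\<And>\<alpha>. \<eta> \<alpha> \<in> G 0 j" "\<And>\<alpha>. \<zeta> \<alpha> \<in> G (Suc 0) j"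
      "\<And>\<alpha>. size \<alpha> = N \<Longrightarrow> u \<alpha> = shift_sum e m \<eta> \<alpha> + D 0 j (\<zeta> \<alpha>)"
      using homogeneous_decomposition[OF u(1) u_D, of N] by metis
    have "\<epsilon> (Suc j) (shift_sum e m \<eta> \<alpha> + D 0 j (\<zeta> \<alpha>)) = shift_sum (eM (int j)) m (\<lambda>\<alpha>. \<epsilon> j (\<eta> \<alpha>)) \<alpha>" for \<alpha>
      using \<epsilon>_add[OF G.shift_sum_in[OF order_refl *(1)] D_in[OF *(2)]] \<epsilon>_D[of "\<zeta> \<alpha>" j] *(2)
      by (simp add: \<epsilon>_shift_sum[OF *(1)])
    then show ?thesis using * u(2) by (intro exI[of _ \<eta>]) simp
  qed
  then obtain \<eta> where \<eta>: "\<And>N \<alpha>. \<eta> N \<alpha> \<in> G 0 j"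
    "\<And>N \<alpha>. size \<alpha> = N \<Longrightarrow> \<xi> \<alpha> = shift_sum (eM (int j)) m (\<lambda>\<alpha>. \<epsilon> j (\<eta> N \<alpha>)) \<alpha>" by metis
  show ?thesis
  proof (rule that)
    \<comment> \<open>Gluing: the equation at size N reads only entries of size N + 1, so an entry
      of size k is taken from the solution for k - 1. The entry at the empty multiset is never
      read.\<close>
    show "\<epsilon> j (\<eta> (size \<alpha> - 1) \<alpha>) \<in> M (int j)" for \<alpha> by (rule \<epsilon>_in) (rule \<eta>)
    show "\<xi> \<alpha> = shift_sum (eM (int j)) m (\<lambda>\<alpha>. \<epsilon> j (\<eta> (size \<alpha> - 1) \<alpha>)) \<alpha>" for \<alpha>
      using \<eta>(2)[of \<alpha>] by (simp add: shift_sum_def)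
  qed
qed

lemma exactness_propagates:
  assumes exact: "\<And>x. x \<in> M (int j) \<Longrightarrow> (\<Sum>l<m. a l *\<^sub>k eM (int j) l x) = 0 \<Longrightarrow>
      \<exists>y\<in>M (int j - 1). x = (\<Sum>l<m. a l *\<^sub>k eM (int j - 1) l y)"
    and x: "x \<in> M (int j + 1)" "(\<Sum>l<m. a l *\<^sub>k eM (int j + 1) l x) = 0"
  shows "\<exists>y\<in>M (int j). x = (\<Sum>l<m. a l *\<^sub>k eM (int j) l y)"
proof -
  define \<xi> where "\<xi> \<alpha> = monomial_value a \<alpha> *\<^sub>k x" for \<alpha>
  have \<xi>: "\<xi> \<alpha> \<in> M (int (Suc j))" for \<alpha>
    using x(1) by (simp add: \<xi>_def subspace_scale M_subspace add.commute)
  have d\<xi>: "shift_sum (eM (int (Suc j))) m \<xi> \<alpha> = 0" for \<alpha>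
  proof -
    have "shift_sum (eM (int (Suc j))) m \<xi> \<alpha> = monomial_value a \<alpha> *\<^sub>k (\<Sum>l<m. a l *\<^sub>k eM (int j + 1) l x)"
      by (simp add: shift_sum_def \<xi>_def linearD[OF eM_linear] monomial_value_add_mset
          scale_sum_right mult.commute add.commute)
    then show ?thesis using x(2) by simp
  qed
  obtain \<eta> where \<eta>: "\<And>\<alpha>. \<eta> \<alpha> \<in> M (int j)" "\<And>\<alpha>. \<xi> \<alpha> = shift_sum (eM (int j)) m \<eta> \<alpha>"
    using homogeneous_exact[OF \<xi> d\<xi>] by blast
  obtain T where T: "finite T" "M (int j) \<subseteq> span T" using M_finite_dimensional by blast
  show ?thesis
  proof (rule exactness_at_point_propagates[where ?e0.0 = "eM (int j - 1)" and ?e1.0 = "eM (int j)"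
        and ?W0.0 = "M (int j - 1)" and ?W1.0 = "M (int j)"])
    show "eM (int j) l (eM (int j - 1) k w) + eM (int j) k (eM (int j - 1) l w) = 0"
      if "l < m" "k < m" "w \<in> M (int j - 1)" for l k w
      using eM_anti[OF that] by simp
    show "eM (int j) l (eM (int j - 1) l w) = 0" if "l < m" "w \<in> M (int j - 1)" for l w
      using eM_sq[OF that] by simp
    show "eM (int j - 1) l w \<in> M (int j)" if "w \<in> M (int j - 1)" for l w
      using eM_in[OF that] by simp
    show "shift_sum (eM (int j)) m \<eta> \<alpha> = monomial_value a \<alpha> *\<^sub>k x" for \<alpha>
      by (simp add: \<eta>(2)[symmetric] \<xi>_def)
  qed (use T \<eta>(1) exact M_subspace eM_linear in auto)
qed

end

section \<open>Vector spaces and their duals\<close>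

lemma scalars_simps [simp]:
  "carrier scalars = UNIV" "\<zero>\<^bsub>scalars\<^esub> = 0" "\<one>\<^bsub>scalars\<^esub> = 1"
  "x \<oplus>\<^bsub>scalars\<^esub> y = x + y" "x \<otimes>\<^bsub>scalars\<^esub> y = x * y"
  by (simp_all add: scalars_def)

lemma cring_scalars: "cring (scalars :: 'k::field ring)"
proof (rule cringI)
  show "abelian_group (scalars :: 'k ring)"
  proof (rule abelian_groupI)
    show "\<exists>y\<in>carrier scalars. y \<oplus>\<^bsub>scalars\<^esub> x = \<zero>\<^bsub>scalars\<^esub>" for x :: 'k
      by (rule bexI[of _ "- x"]) simp_all
  qed (simp_all add: ac_simps)
  show "comm_monoid (scalars :: 'k ring)"
    by (rule comm_monoidI) (simp_all add: ac_simps)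
qed (simp_all add: algebra_simps)

lemma scalars_minus [simp]: "\<ominus>\<^bsub>scalars\<^esub> (x :: 'k::field) = - x"
proof -
  interpret cring "scalars :: 'k ring" by (rule cring_scalars)
  show ?thesis by (rule minus_equality) simp_all
qed

locale scalar_module = module scalars M for M :: "('k::field, 'm) module"
begin

lemma smult_unit [simp]: "x \<in> carrier M \<Longrightarrow> 1 \<odot>\<^bsub>M\<^esub> x = x"
  and smult_null [simp]: "x \<in> carrier M \<Longrightarrow> 0 \<odot>\<^bsub>M\<^esub> x = \<zero>\<^bsub>M\<^esub>"
  and smult_zero [simp]: "c \<odot>\<^bsub>M\<^esub> \<zero>\<^bsub>M\<^esub> = \<zero>\<^bsub>M\<^esub>"
  and smult_in [simp, intro]: "x \<in> carrier M \<Longrightarrow> c \<odot>\<^bsub>M\<^esub> x \<in> carrier M"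
  and smult_uminus: "x \<in> carrier M \<Longrightarrow> (- 1) \<odot>\<^bsub>M\<^esub> x = \<ominus>\<^bsub>M\<^esub> x"
  and smult_plus: "x \<in> carrier M \<Longrightarrow> (c + d) \<odot>\<^bsub>M\<^esub> x = c \<odot>\<^bsub>M\<^esub> x \<oplus>\<^bsub>M\<^esub> d \<odot>\<^bsub>M\<^esub> x"
  and smult_times: "x \<in> carrier M \<Longrightarrow> (c * d) \<odot>\<^bsub>M\<^esub> x = c \<odot>\<^bsub>M\<^esub> (d \<odot>\<^bsub>M\<^esub> x)"
  using smult_one[of x] smult_l_null[of x] smult_r_null[of c] smult_closed[of c x] smult_l_minus[of 1 x]
    smult_l_distr[of c d x] smult_assoc1[of c d x] by simp_all

lemma smult_add: "x \<in> carrier M \<Longrightarrow> y \<in> carrier M \<Longrightarrow> c \<odot>\<^bsub>M\<^esub> (x \<oplus>\<^bsub>M\<^esub> y) = c \<odot>\<^bsub>M\<^esub> x \<oplus>\<^bsub>M\<^esub> c \<odot>\<^bsub>M\<^esub> y"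
  using smult_r_distr by simp

end

lemma scalar_moduleI: "module scalars M \<Longrightarrow> scalar_module M"
  by (simp add: scalar_module_def)

lemma submodule_iff:
  fixes M :: "('k::field, 'm) module"
  assumes "module scalars M"
  shows "submodule N scalars M \<longleftrightarrow> N \<subseteq> carrier M \<and> \<zero>\<^bsub>M\<^esub> \<in> N \<and>
    (\<forall>x\<in>N. \<forall>y\<in>N. x \<oplus>\<^bsub>M\<^esub> y \<in> N) \<and> (\<forall>c. \<forall>x\<in>N. c \<odot>\<^bsub>M\<^esub> x \<in> N)"
proof -
  interpret scalar_module M by (rule scalar_moduleI) fact
  have neg: "\<ominus>\<^bsub>M\<^esub> x = (- 1) \<odot>\<^bsub>M\<^esub> x" if "x \<in> carrier M" for x
    using smult_uminus that by simp
  show ?thesis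
  proof
    assume N: "submodule N scalars M"
    note E = submoduleE[OF N]
    from E(2) obtain z where z: "z \<in> N" by blast
    then have "\<zero>\<^bsub>M\<^esub> \<in> N" using E(4)[of 0 z] E(1) by auto
    then show "N \<subseteq> carrier M \<and> \<zero>\<^bsub>M\<^esub> \<in> N \<and>
      (\<forall>x\<in>N. \<forall>y\<in>N. x \<oplus>\<^bsub>M\<^esub> y \<in> N) \<and> (\<forall>c. \<forall>x\<in>N. c \<odot>\<^bsub>M\<^esub> x \<in> N)"
      using E(1,4,5) by auto
  next
    assume *: "N \<subseteq> carrier M \<and> \<zero>\<^bsub>M\<^esub> \<in> N \<and>
      (\<forall>x\<in>N. \<forall>y\<in>N. x \<oplus>\<^bsub>M\<^esub> y \<in> N) \<and> (\<forall>c. \<forall>x\<in>N. c \<odot>\<^bsub>M\<^esub> x \<in> N)"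
    then have "\<ominus>\<^bsub>M\<^esub> x \<in> N" if "x \<in> N" for x using neg[of x] that by auto
    then show "submodule N scalars M" using * by (intro submoduleI) auto
  qed
qed

lemma dual_space_iff:
  "f \<in> carrier (dual_space M) \<longleftrightarrow> (\<forall>x. x \<notin> carrier M \<longrightarrow> f x = 0) \<and>
    (\<forall>x\<in>carrier M. \<forall>y\<in>carrier M. f (x \<oplus>\<^bsub>M\<^esub> y) = f x + f y) \<and>
    (\<forall>c. \<forall>x\<in>carrier M. f (c \<odot>\<^bsub>M\<^esub> x) = c * f x)"
  by (simp add: dual_space_def)

text \<open>Zorn's lemma gives a subspace maximal among those that contain \<open>U\<close> and miss
  \<open>x\<close>. It is a hyperplane complementary to the line of \<open>x\<close>, and the
  functional is the \<open>x\<close>-coordinate.\<close>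

lemma dual_space_separates:
  fixes M :: "('k::field, 'm) module"
  assumes M: "module scalars M" and U: "submodule U scalars M" and x: "x \<in> carrier M" "x \<notin> U"
  shows "\<exists>f\<in>carrier (dual_space M). (\<forall>u\<in>U. f u = 0) \<and> f x = 1"
proof -
  interpret scalar_module M by (rule scalar_moduleI) fact
  define \<A> where "\<A> = {N. submodule N scalars M \<and> U \<subseteq> N \<and> x \<notin> N}"
  have "\<exists>N\<in>\<A>. \<forall>X\<in>\<A>. N \<subseteq> X \<longrightarrow> X = N"
  proof (rule subset_Zorn_nonempty)
    show "\<A> \<noteq> {}" using U x by (auto simp: \<A>_def)
    fix C assume C: "C \<noteq> {}" "subset.chain \<A> C"
    have sub: "submodule N scalars M" "U \<subseteq> N" "x \<notin> N" if "N \<in> C" for N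
      using C(2) that by (auto simp: \<A>_def subset.chain_def)
    have "y \<oplus>\<^bsub>M\<^esub> z \<in> \<Union>C" if yz: "y \<in> \<Union>C" "z \<in> \<Union>C" for y z
    proof -
      obtain N N' where N: "y \<in> N" "z \<in> N'" "N \<in> C" "N' \<in> C" using yz by blast
      then have "N \<subseteq> N' \<or> N' \<subseteq> N" using C(2) by (auto simp: subset.chain_def)
      then obtain N'' where "N'' \<in> C" "y \<in> N''" "z \<in> N''" using N by blast
      then show ?thesis using sub(1)[of N''] by (auto simp: submodule_iff[OF M])
    qed
    then have "submodule (\<Union>C) scalars M"
      using sub(1) C(1) unfolding submodule_iff[OF M] by blast
    then show "\<Union>C \<in> \<A>" using sub C(1) unfolding \<A>_def by blast
  qed
  then obtain N where N: "submodule N scalars M" "U \<subseteq> N" "x \<notin> N"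
    and max: "\<And>X. submodule X scalars M \<Longrightarrow> x \<notin> X \<Longrightarrow> N \<subseteq> X \<Longrightarrow> X = N"
    by (auto simp: \<A>_def)
  note N' = N(1)[unfolded submodule_iff[OF M]]
  have Nc: "n \<in> carrier M" if "n \<in> N" for n using N' that by blast
  have Nadd: "n \<oplus>\<^bsub>M\<^esub> n' \<in> N" if "n \<in> N" "n' \<in> N" for n n' using N' that by blast
  have Nsm: "c \<odot>\<^bsub>M\<^esub> n \<in> N" if "n \<in> N" for c n using N' that by blast
  \<comment> \<open>For y outside \<open>N\<close>, maximality puts x into N + k y. The coefficient
    of y is nonzero because x is not in \<open>N\<close>, so the equation can be solved for
    y.\<close>
  have ex: "\<exists>c. \<exists>n\<in>N. y = n \<oplus>\<^bsub>M\<^esub> c \<odot>\<^bsub>M\<^esub> x" if y: "y \<in> carrier M" for y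
  proof (cases "y \<in> N")
    case True
    then show ?thesis using x y Nc by (intro exI[of _ 0] bexI[of _ y]) auto
  next
    case False
    define X where "X = {n \<oplus>\<^bsub>M\<^esub> c \<odot>\<^bsub>M\<^esub> y | n c. n \<in> N}"
    have "submodule X scalars M"
      unfolding submodule_iff[OF M]
    proof (intro conjI ballI allI)
      show "X \<subseteq> carrier M" using Nc y by (auto simp: X_def)
      show "\<zero>\<^bsub>M\<^esub> \<in> X" using N' y by (force simp: X_def intro!: exI[of _ "\<zero>\<^bsub>M\<^esub>"] exI[of _ 0])
    next
      fix u v assume "u \<in> X" "v \<in> X"
      then obtain n c n' c' where "n \<in> N" "n' \<in> N" "u = n \<oplus>\<^bsub>M\<^esub> c \<odot>\<^bsub>M\<^esub> y" "v = n' \<oplus>\<^bsub>M\<^esub> c' \<odot>\<^bsub>M\<^esub> y"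
        by (auto simp: X_def)
      moreover from this have "u \<oplus>\<^bsub>M\<^esub> v = (n \<oplus>\<^bsub>M\<^esub> n') \<oplus>\<^bsub>M\<^esub> (c + c') \<odot>\<^bsub>M\<^esub> y"
        using y Nc smult_plus[of y c c'] by (simp add: M.a_ac)
      ultimately show "u \<oplus>\<^bsub>M\<^esub> v \<in> X" using Nadd by (auto simp: X_def)
    next
      fix c u assume "u \<in> X"
      then obtain n c' where "n \<in> N" "u = n \<oplus>\<^bsub>M\<^esub> c' \<odot>\<^bsub>M\<^esub> y" by (auto simp: X_def)
      moreover from this have "c \<odot>\<^bsub>M\<^esub> u = c \<odot>\<^bsub>M\<^esub> n \<oplus>\<^bsub>M\<^esub> (c * c') \<odot>\<^bsub>M\<^esub> y"
        using y Nc smult_times[of y c c'] by (simp add: smult_add)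
      ultimately show "c \<odot>\<^bsub>M\<^esub> u \<in> X" using Nsm by (auto simp: X_def)
    qed
    moreover have "N \<subseteq> X"
    proof
      fix n assume "n \<in> N"
      then show "n \<in> X" using Nc y by (auto simp: X_def intro!: exI[of _ n] exI[of _ 0])
    qed
    moreover have "y \<in> X" using N' y by (auto simp: X_def intro!: exI[of _ "\<zero>\<^bsub>M\<^esub>"] exI[of _ 1] )
    ultimately have "x \<in> X" using max False by blast
    then obtain n c where n: "n \<in> N" "x = n \<oplus>\<^bsub>M\<^esub> c \<odot>\<^bsub>M\<^esub> y" by (auto simp: X_def)
    have "c \<noteq> 0"
      using n x N(3) Nc y by auto
    have one: "1 \<odot>\<^bsub>M\<^esub> z = z" if "z \<in> carrier M" for z using that by simp
    have "(- inverse c) \<odot>\<^bsub>M\<^esub> n \<oplus>\<^bsub>M\<^esub> inverse c \<odot>\<^bsub>M\<^esub> x =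
        (- inverse c) \<odot>\<^bsub>M\<^esub> n \<oplus>\<^bsub>M\<^esub> (inverse c \<odot>\<^bsub>M\<^esub> n \<oplus>\<^bsub>M\<^esub> (inverse c * c) \<odot>\<^bsub>M\<^esub> y)"
      using n Nc y smult_times[of y "inverse c" c] by (simp add: smult_add)
    also have "\<dots> = (- inverse c + inverse c) \<odot>\<^bsub>M\<^esub> n \<oplus>\<^bsub>M\<^esub> y"
      using n(1) Nc y \<open>c \<noteq> 0\<close> smult_plus[of n "- inverse c" "inverse c"]
      by (simp add: M.a_assoc one)
    also have "\<dots> = y" using n(1) Nc y smult_null[of n] by simp
    finally show ?thesis using n Nsm by metis
  qed
  have uniq: "c = c'" if n: "n \<in> N" "n' \<in> N" and eq: "n \<oplus>\<^bsub>M\<^esub> c \<odot>\<^bsub>M\<^esub> x = n' \<oplus>\<^bsub>M\<^esub> c' \<odot>\<^bsub>M\<^esub> x" for n n' c c'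
  proof (rule ccontr)
    assume ne: "c \<noteq> c'"
    have one: "1 \<odot>\<^bsub>M\<^esub> z = z" if "z \<in> carrier M" for z using that by simp
    have "(c - c') \<odot>\<^bsub>M\<^esub> x = (- 1) \<odot>\<^bsub>M\<^esub> n \<oplus>\<^bsub>M\<^esub> ((n \<oplus>\<^bsub>M\<^esub> c \<odot>\<^bsub>M\<^esub> x) \<oplus>\<^bsub>M\<^esub> (- c') \<odot>\<^bsub>M\<^esub> x)"
      using n x Nc smult_plus[of n "- 1" 1] smult_plus[of x c "- c'"] one[of n]
      by (simp add: M.a_assoc[symmetric])
    also have "\<dots> = (- 1) \<odot>\<^bsub>M\<^esub> n \<oplus>\<^bsub>M\<^esub> (n' \<oplus>\<^bsub>M\<^esub> (c' + - c') \<odot>\<^bsub>M\<^esub> x)"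
      unfolding eq using n x Nc smult_plus[of x c' "- c'"] by (simp add: M.a_assoc)
    also have "\<dots> = (- 1) \<odot>\<^bsub>M\<^esub> n \<oplus>\<^bsub>M\<^esub> n'" using n x Nc by simp
    finally have "(c - c') \<odot>\<^bsub>M\<^esub> x \<in> N" using n Nadd Nsm by simp
    then have "inverse (c - c') \<odot>\<^bsub>M\<^esub> ((c - c') \<odot>\<^bsub>M\<^esub> x) \<in> N" by (rule Nsm)
    then show False
      using N(3) x ne smult_times[of x "inverse (c - c')" "c - c'"] one[of x] by simp
  qed
  define f where "f y = (if y \<in> carrier M then THE c. \<exists>n\<in>N. y = n \<oplus>\<^bsub>M\<^esub> c \<odot>\<^bsub>M\<^esub> x else 0)" for y
  have f_eq: "f (n \<oplus>\<^bsub>M\<^esub> c \<odot>\<^bsub>M\<^esub> x) = c" if "n \<in> N" for n c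
  proof -
    have "(THE c'. \<exists>n'\<in>N. n \<oplus>\<^bsub>M\<^esub> c \<odot>\<^bsub>M\<^esub> x = n' \<oplus>\<^bsub>M\<^esub> c' \<odot>\<^bsub>M\<^esub> x) = c"
      using that uniq by (intro the_equality) blast+
    then show ?thesis using that Nc x by (simp add: f_def)
  qed
  show ?thesis
  proof (intro bexI[of _ f] conjI ballI)
    show "f \<in> carrier (dual_space M)"
      unfolding dual_space_iff
    proof (intro conjI ballI allI impI)
      fix y z assume y: "y \<in> carrier M" and z: "z \<in> carrier M"
      obtain n c n' c' where "n \<in> N" "n' \<in> N" and *: "y = n \<oplus>\<^bsub>M\<^esub> c \<odot>\<^bsub>M\<^esub> x" "z = n' \<oplus>\<^bsub>M\<^esub> c' \<odot>\<^bsub>M\<^esub> x"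
        using ex[OF y] ex[OF z] by blast
      moreover from this have "y \<oplus>\<^bsub>M\<^esub> z = (n \<oplus>\<^bsub>M\<^esub> n') \<oplus>\<^bsub>M\<^esub> (c + c') \<odot>\<^bsub>M\<^esub> x"
        using x Nc smult_plus[of x c c'] by (simp add: M.a_ac)
      ultimately show "f (y \<oplus>\<^bsub>M\<^esub> z) = f y + f z" by (simp add: f_eq Nadd)
    next
      fix d y assume y: "y \<in> carrier M"
      obtain n c where "n \<in> N" and *: "y = n \<oplus>\<^bsub>M\<^esub> c \<odot>\<^bsub>M\<^esub> x"
        using ex[OF y] by blast
      moreover from this have "d \<odot>\<^bsub>M\<^esub> y = d \<odot>\<^bsub>M\<^esub> n \<oplus>\<^bsub>M\<^esub> (d * c) \<odot>\<^bsub>M\<^esub> x"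
        using x Nc smult_times[of x d c] by (simp add: smult_add)
      ultimately show "f (d \<odot>\<^bsub>M\<^esub> y) = d * f y" by (simp add: f_eq Nsm)
    qed (simp add: f_def)
    show "f u = 0" if "u \<in> U" for u
    proof -
      have "u \<in> N" using that N(2) by blast
      then show ?thesis using f_eq[of u 0] x Nc[of u] by simp
    qed
    show "f x = 1"
      using f_eq[of "\<zero>\<^bsub>M\<^esub>" 1] N' x by simp
  qed
qed

text \<open>Take \<open>x0\<close> with f x0 = 1. The kernel condition keeps h x0 out of the image
  of ker f, and a functional separating the two, composed with h, agrees with f on ker f and at
  \<open>x0\<close>.\<close>

lemma linear_map_kernel_factor:
  fixes M :: "('k::field, 'm) module" and N :: "('k, 'n) module"
  assumes M: "module scalars M" and N: "module scalars N"
    and h: "h \<in> linear_maps M N" and f: "f \<in> carrier (dual_space M)"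
    and ker: "\<And>x. x \<in> carrier M \<Longrightarrow> h x = \<zero>\<^bsub>N\<^esub> \<Longrightarrow> f x = 0"
  shows "\<exists>g\<in>carrier (dual_space N). \<forall>x\<in>carrier M. f x = g (h x)"
proof (cases "\<forall>x\<in>carrier M. f x = 0")
  case True
  show ?thesis by (rule bexI[of _ "\<lambda>_. 0"]) (use True in \<open>auto simp: dual_space_iff\<close>)
next
  case False
  interpret M: scalar_module M by (rule scalar_moduleI) fact
  interpret N: scalar_module N by (rule scalar_moduleI) fact
  have fM: "f (x \<oplus>\<^bsub>M\<^esub> y) = f x + f y" "f (c \<odot>\<^bsub>M\<^esub> x) = c * f x" if "x \<in> carrier M" "y \<in> carrier M" for x y c
    using f that by (auto simp: dual_space_iff)
  have hM: "h (x \<oplus>\<^bsub>M\<^esub> y) = h x \<oplus>\<^bsub>N\<^esub> h y" "h (c \<odot>\<^bsub>M\<^esub> x) = c \<odot>\<^bsub>N\<^esub> h x" "h x \<in> carrier N"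
    if "x \<in> carrier M" "y \<in> carrier M" for x y c
    using h that by (auto simp: linear_maps_def)
  obtain x1 where x1: "x1 \<in> carrier M" "f x1 \<noteq> 0" using False by blast
  define x0 where "x0 = inverse (f x1) \<odot>\<^bsub>M\<^esub> x1"
  have x0: "x0 \<in> carrier M" "f x0 = 1" using x1 fM by (auto simp: x0_def)
  define U where "U = h ` {y \<in> carrier M. f y = 0}"
  have sub: "submodule U scalars N"
    unfolding submodule_iff[OF N]
  proof (intro conjI ballI allI)
    show "U \<subseteq> carrier N" using hM by (auto simp: U_def)
    have "h \<zero>\<^bsub>M\<^esub> = \<zero>\<^bsub>N\<^esub>" "f \<zero>\<^bsub>M\<^esub> = 0"
      using hM(2)[of "\<zero>\<^bsub>M\<^esub>" "\<zero>\<^bsub>M\<^esub>" 0] fM(2)[of "\<zero>\<^bsub>M\<^esub>" "\<zero>\<^bsub>M\<^esub>" 0] hM(3)[of "\<zero>\<^bsub>M\<^esub>" "\<zero>\<^bsub>M\<^esub>"] by auto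
    then show "\<zero>\<^bsub>N\<^esub> \<in> U" by (auto simp: U_def image_iff intro!: bexI[of _ "\<zero>\<^bsub>M\<^esub>"])
  next
    fix u v assume "u \<in> U" "v \<in> U"
    then obtain y z where "y \<in> carrier M" "f y = 0" "u = h y" "z \<in> carrier M" "f z = 0" "v = h z"
      by (auto simp: U_def)
    then show "u \<oplus>\<^bsub>N\<^esub> v \<in> U"
      using hM(1)[of y z] fM(1)[of y z] by (auto simp: U_def image_iff intro!: exI[of _ "y \<oplus>\<^bsub>M\<^esub> z"])
  next
    fix c u assume "u \<in> U"
    then obtain y where "y \<in> carrier M" "f y = 0" "u = h y" by (auto simp: U_def)
    then show "c \<odot>\<^bsub>N\<^esub> u \<in> U"
      using hM(2)[of y y c] fM(2)[of y y c] by (auto simp: U_def image_iff intro!: exI[of _ "c \<odot>\<^bsub>M\<^esub> y"])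
  qed
  have nU: "h x0 \<notin> U"
  proof
    assume "h x0 \<in> U"
    then obtain y where y: "y \<in> carrier M" "f y = 0" "h x0 = h y" by (auto simp: U_def)
    have c: "(- 1) \<odot>\<^bsub>M\<^esub> y \<in> carrier M" using y by simp
    have "h (x0 \<oplus>\<^bsub>M\<^esub> (- 1) \<odot>\<^bsub>M\<^esub> y) = h y \<oplus>\<^bsub>N\<^esub> (- 1) \<odot>\<^bsub>N\<^esub> h y"
      using x0 y c hM by simp
    also have "\<dots> = \<zero>\<^bsub>N\<^esub>"
      using N.smult_uminus[of "h y"] hM(3)[of y] y by (simp add: N.r_neg)
    finally have "f (x0 \<oplus>\<^bsub>M\<^esub> (- 1) \<odot>\<^bsub>M\<^esub> y) = 0" using ker x0 c by simp
    then show False using x0 y c fM by simp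
  qed
  obtain g where g: "g \<in> carrier (dual_space N)" "\<And>u. u \<in> U \<Longrightarrow> g u = 0" "g (h x0) = 1"
    using dual_space_separates[OF N sub hM(3)[OF x0(1) x0(1)] nU] by blast
  have gN: "g (x \<oplus>\<^bsub>N\<^esub> y) = g x + g y" "g (c \<odot>\<^bsub>N\<^esub> x) = c * g x" if "x \<in> carrier N" "y \<in> carrier N" for x y c
    using g(1) that by (auto simp: dual_space_iff)
  show ?thesis
  proof (rule bexI[OF _ g(1)], rule ballI)
    fix y assume y: "y \<in> carrier M"
    have c: "(- f y) \<odot>\<^bsub>M\<^esub> x0 \<in> carrier M" using x0 by simp
    have "f (y \<oplus>\<^bsub>M\<^esub> (- f y) \<odot>\<^bsub>M\<^esub> x0) = 0" using y x0 c fM by simp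
    then have "g (h (y \<oplus>\<^bsub>M\<^esub> (- f y) \<odot>\<^bsub>M\<^esub> x0)) = 0"
      using g(2) y c by (auto simp: U_def)
    then show "f y = g (h y)"
      using y x0 c hM(1,2) hM(3)[OF y y] hM(3)[OF x0(1) x0(1)] gN(1) gN(2)[of "h x0" "h x0" "- f y"] g(3) by simp
  qed
qed

section \<open>Bases through the double dual\<close>

interpretation fun_vs: vector_family "\<lambda>(c::'k::field) (f :: 'z \<Rightarrow> 'k) x. c * f x"
  by unfold_locales (simp_all add: fun_eq_iff algebra_simps)

text \<open>Embeds the carrier in a vector space on a whole type, where the library provides bases
  and coordinates. The value off the dual is 0, since additivity in \<open>x\<close> would fail at
  functions that are not functionals.\<close>

definition evaluation :: "('k::field, 'm) module \<Rightarrow> 'm \<Rightarrow> ('m \<Rightarrow> 'k) \<Rightarrow> 'k" where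
  "evaluation M x f = (if f \<in> carrier (dual_space M) then f x else 0)"

lemma evaluation_add:
  "x \<in> carrier M \<Longrightarrow> y \<in> carrier M \<Longrightarrow> evaluation M (x \<oplus>\<^bsub>M\<^esub> y) = evaluation M x + evaluation M y"
  by (auto simp: evaluation_def fun_eq_iff dual_space_iff)

lemma evaluation_smult:
  "x \<in> carrier M \<Longrightarrow> evaluation M (c \<odot>\<^bsub>M\<^esub> x) = (\<lambda>f. c * evaluation M x f)"
  by (auto simp: evaluation_def fun_eq_iff dual_space_iff)

lemma evaluation_inj:
  fixes M :: "('k::field, 'm) module"
  assumes M: "module scalars M"
  shows "inj_on (evaluation M) (carrier M)"
proof (rule inj_onI, rule ccontr)
  interpret scalar_module M by (rule scalar_moduleI) fact
  fix x y assume x: "x \<in> carrier M" and y: "y \<in> carrier M" and eq: "evaluation M x = evaluation M y"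
    and ne: "x \<noteq> y"
  define z where "z = x \<oplus>\<^bsub>M\<^esub> (- 1) \<odot>\<^bsub>M\<^esub> y"
  have neg: "(- 1) \<odot>\<^bsub>M\<^esub> y = \<ominus>\<^bsub>M\<^esub> y" using smult_uminus[of y] y by simp
  have "z \<noteq> \<zero>\<^bsub>M\<^esub>"
  proof
    assume "z = \<zero>\<^bsub>M\<^esub>"
    moreover have "x = z \<oplus>\<^bsub>M\<^esub> y" using x y by (simp add: z_def neg M.a_assoc M.l_neg)
    ultimately show False using ne y by simp
  qed
  moreover have sub: "submodule {\<zero>\<^bsub>M\<^esub>} scalars M"
    unfolding submodule_iff[OF M] by auto
  moreover have "z \<in> carrier M" using x y by (simp add: z_def)
  ultimately obtain f where f: "f \<in> carrier (dual_space M)" "f z = 1"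
    using dual_space_separates[OF M sub, of z] by blast
  have "f x = f y" using fun_cong[OF eq, of f] f by (simp add: evaluation_def)
  moreover have "f z = f x + (- 1) * f y"
    using f(1) x y by (auto simp: dual_space_iff z_def)
  ultimately show False using f by simp
qed

text \<open>A basis is pulled back along \<open>evaluation\<close>. It may be infinite at this
  stage, hence the finiteness clause on coordinates; generation is phrased through submodules to
  avoid linear combinations in a carrier.\<close>

lemma dual_basis_exists:
  fixes V :: "('k::field, 'v) module"
  assumes V: "module scalars V"
  shows "\<exists>B \<phi>. B \<subseteq> carrier V \<and> (\<forall>b\<in>B. \<phi> b \<in> carrier (dual_space V)) \<and>
    (\<forall>b\<in>B. \<forall>b'\<in>B. \<phi> b b' = (if b = b' then 1 else 0)) \<and>
    (\<forall>v\<in>carrier V. finite {b \<in> B. \<phi> b v \<noteq> 0}) \<and>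
    (\<forall>N. submodule N scalars V \<longrightarrow> B \<subseteq> N \<longrightarrow> N = carrier V)"
proof -
  interpret scalar_module V by (rule scalar_moduleI) fact
  let ?\<theta> = "evaluation V"
  have sub: "fun_vs.subspace (?\<theta> ` N)" if "submodule N scalars V" for N
  proof -
    have N: "N \<subseteq> carrier V" "\<zero>\<^bsub>V\<^esub> \<in> N" "\<And>x y. x \<in> N \<Longrightarrow> y \<in> N \<Longrightarrow> x \<oplus>\<^bsub>V\<^esub> y \<in> N" "\<And>c x. x \<in> N \<Longrightarrow> c \<odot>\<^bsub>V\<^esub> x \<in> N"
      using that by (auto simp: submodule_iff[OF V])
    have "?\<theta> \<zero>\<^bsub>V\<^esub> = 0" using evaluation_add[of "\<zero>\<^bsub>V\<^esub>" V "\<zero>\<^bsub>V\<^esub>"] by simp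
    then show ?thesis
    proof (intro fun_vs.subspaceI)
      show "0 \<in> ?\<theta> ` N" if "?\<theta> \<zero>\<^bsub>V\<^esub> = 0" using that N(2) by force
      show "u + v \<in> ?\<theta> ` N" if uv: "u \<in> ?\<theta> ` N" "v \<in> ?\<theta> ` N" for u v
      proof -
        obtain x y where "x \<in> N" "y \<in> N" "u = ?\<theta> x" "v = ?\<theta> y" using uv by blast
        then show ?thesis
          by (intro image_eqI[OF _ N(3)[of x y]]) (simp_all add: evaluation_add subsetD[OF N(1)])
      qed
      show "(\<lambda>x. c * u x) \<in> ?\<theta> ` N" if u: "u \<in> ?\<theta> ` N" for c u
      proof -
        obtain x where "x \<in> N" "u = ?\<theta> x" using u by blast
        then show ?thesis
          by (intro image_eqI[OF _ N(4)[of x c]]) (simp_all add: evaluation_smult subsetD[OF N(1)])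
      qed
    qed
  qed
  obtain Bs where Bs: "Bs \<subseteq> ?\<theta> ` carrier V" "fun_vs.independent Bs" "?\<theta> ` carrier V \<subseteq> fun_vs.span Bs"
    using fun_vs.maximal_independent_subset[of "?\<theta> ` carrier V"] by metis
  define B where "B = {v \<in> carrier V. ?\<theta> v \<in> Bs}"
  define \<phi> where "\<phi> b v = (if v \<in> carrier V then fun_vs.representation Bs (?\<theta> v) (?\<theta> b) else 0)" for b v
  have span: "v \<in> carrier V \<Longrightarrow> ?\<theta> v \<in> fun_vs.span Bs" for v using Bs(3) by blast
  have inj: "?\<theta> x = ?\<theta> y \<longleftrightarrow> x = y" if "x \<in> carrier V" "y \<in> carrier V" for x y
    using evaluation_inj[OF V] that by (auto simp: inj_on_def)
  show ?thesis
  proof (intro exI[of _ B] exI[of _ \<phi>] conjI ballI allI impI)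
    show "\<phi> b \<in> carrier (dual_space V)" for b
      unfolding dual_space_iff \<phi>_def
      by (auto simp: evaluation_add evaluation_smult span fun_vs.representation_add[OF Bs(2)]
          fun_vs.representation_scale[OF Bs(2)])
    show "\<phi> b b' = (if b = b' then 1 else 0)" if "b \<in> B" "b' \<in> B" for b b'
      using that inj[of b b'] by (auto simp: \<phi>_def B_def fun_vs.representation_basis[OF Bs(2)])
    show "finite {b \<in> B. \<phi> b v \<noteq> 0}" if "v \<in> carrier V" for v
    proof (rule inj_on_finite[of ?\<theta> _ "{c. fun_vs.representation Bs (?\<theta> v) c \<noteq> 0}"])
      show "inj_on ?\<theta> {b \<in> B. \<phi> b v \<noteq> 0}"
        by (rule inj_on_subset[OF evaluation_inj[OF V]]) (auto simp: B_def)
      show "?\<theta> ` {b \<in> B. \<phi> b v \<noteq> 0} \<subseteq> {c. fun_vs.representation Bs (?\<theta> v) c \<noteq> 0}"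
        using that by (auto simp: \<phi>_def)
      show "finite {c. fun_vs.representation Bs (?\<theta> v) c \<noteq> 0}"
        by (rule fun_vs.finite_representation)
    qed
    show "N = carrier V" if N: "submodule N scalars V" "B \<subseteq> N" for N
    proof
      show NV: "N \<subseteq> carrier V" using N(1) by (simp add: submodule_iff[OF V])
      have "Bs \<subseteq> ?\<theta> ` N"
      proof
        fix c assume c: "c \<in> Bs"
        then obtain v where "v \<in> carrier V" "c = ?\<theta> v" using Bs(1) by blast
        then have "v \<in> B" using c by (simp add: B_def)
        then show "c \<in> ?\<theta> ` N" using N(2) \<open>c = ?\<theta> v\<close> by blast
      qed
      then have "fun_vs.span Bs \<subseteq> ?\<theta> ` N"
        by (rule fun_vs.span_minimal) (rule sub[OF N(1)])
      then show "carrier V \<subseteq> N"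
        using span inj NV by blast
    qed
  qed (auto simp: B_def)
qed

section \<open>The free algebra and contractions\<close>

definition conv :: "('v list \<Rightarrow> 'k::field) \<Rightarrow> ('v list \<Rightarrow> 'k) \<Rightarrow> 'v list \<Rightarrow> 'k" where
  "conv f g w = (\<Sum>i\<le>length w. f (take i w) * g (drop i w))"

lemma conv_Nil [simp]: "conv f g [] = f [] * g []"
  by (simp add: conv_def)

text \<open>The cut before the first letter is separated from the others; this gives a recursion on
  words in place of sums over cut positions.\<close>

lemma conv_Cons: "conv f g (x # w) = f [] * g (x # w) + conv (\<lambda>u. f (x # u)) g w"
  by (simp add: conv_def sum.atMost_Suc_shift del: sum.atMost_Suc)

lemma conv_add_left: "conv (\<lambda>u. f u + g u) h = (\<lambda>w. conv f h w + conv g h w)"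
  and conv_add_right: "conv h (\<lambda>u. f u + g u) = (\<lambda>w. conv h f w + conv h g w)"
  and conv_scale_left: "conv (\<lambda>u. c * f u) h = (\<lambda>w. c * conv f h w)"
  and conv_scale_right: "conv h (\<lambda>u. c * f u) = (\<lambda>w. c * conv h f w)"
  by (auto simp: conv_def fun_eq_iff algebra_simps sum.distrib sum_distrib_left)

lemma conv_zero_left [simp]: "conv (\<lambda>u. 0) h = (\<lambda>w. 0)"
  and conv_zero_right [simp]: "conv h (\<lambda>u. 0) = (\<lambda>w. 0)"
  by (simp_all add: conv_def fun_eq_iff)

lemma conv_diff_right: "conv h (\<lambda>u. f u - g u) = (\<lambda>w. conv h f w - conv h g w)"
  and conv_diff_left: "conv (\<lambda>u. f u - g u) h = (\<lambda>w. conv f h w - conv g h w)"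
  by (auto simp: conv_def fun_eq_iff algebra_simps sum_subtractf)

lemma conv_assoc: "conv (conv f g) h = conv f (conv g h)"
proof
  fix w show "conv (conv f g) h w = conv f (conv g h) w"
  proof (induction w arbitrary: f)
    case (Cons x w)
    have "conv (\<lambda>u. f [] * g (x # u) + conv (\<lambda>u. f (x # u)) g u) h w =
        f [] * conv (\<lambda>u. g (x # u)) h w + conv (conv (\<lambda>u. f (x # u)) g) h w"
      by (simp add: conv_add_left conv_scale_left)
    then show ?case
      by (simp add: conv_Cons Cons.IH algebra_simps)
  qed (simp add: mult.assoc)
qed

lemma word_self [simp]: "word w w = 1"
  and word_Cons_Nil [simp]: "word (v # w) [] = 0"
  by (simp_all add: word_def)

lemma word_support [simp]: "{u. word w u \<noteq> (0 :: 'k::field)} = {w}"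
  by (auto simp: word_def)

lemma conv_word_Nil [simp]: "conv (word []) g = g" "conv g (word []) = g"
proof -
  show "conv (word []) g = g"
  proof
    fix w show "conv (word []) g w = g w"
      by (cases w) (simp_all add: conv_Cons, simp_all add: word_def)
  qed
  show "conv g (word []) = g"
  proof
    fix w show "conv g (word []) w = g w"
      by (induction w arbitrary: g) (simp_all add: conv_Cons, simp_all add: word_def)
  qed
qed

lemma conv_letter:
  fixes g :: "'v list \<Rightarrow> 'k::field"
  shows "conv (word [v]) g w = (case w of [] \<Rightarrow> 0 | x # u \<Rightarrow> if x = v then g u else 0)"
proof (cases w)
  case (Cons x u)
  have "(\<lambda>u. word [v] (v # u)) = (word [] :: 'v list \<Rightarrow> 'k)"
    "x \<noteq> v \<Longrightarrow> (\<lambda>u. word [v] (x # u)) = (\<lambda>_. 0 :: 'k)"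
    by (auto simp: word_def)
  then show ?thesis using Cons by (cases "x = v") (simp_all add: conv_Cons)
qed simp

lemma conv_letter_word: "conv (word [v]) (word w) = word (v # w)"
proof
  fix u show "conv (word [v]) (word w) u = word (v # w) u"
    by (cases u) (simp_all add: conv_letter, simp add: word_def)
qed

lemma word_induct [consumes 2, case_names zero add]:
  fixes f :: "'v list \<Rightarrow> 'k::field"
  assumes "finite {w. f w \<noteq> 0}" "{w. f w \<noteq> 0} \<subseteq> A"
    and zero: "P (\<lambda>_. 0)"
    and add: "\<And>f c w. w \<in> A \<Longrightarrow> finite {w. f w \<noteq> 0} \<Longrightarrow> {w. f w \<noteq> 0} \<subseteq> A \<Longrightarrow> P f \<Longrightarrow> P (\<lambda>u. f u + c * word w u)"
  shows "P f"
  using assms(1,2)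
proof (induction "card {w. f w \<noteq> 0}" arbitrary: f rule: less_induct)
  case less
  show ?case
  proof (cases "\<exists>w. f w \<noteq> 0")
    case False
    then have "f = (\<lambda>_. 0)" by auto
    then show ?thesis using zero by simp
  next
    case True
    then obtain w where w: "f w \<noteq> 0" by blast
    define g where "g = f(w := 0)"
    have supp: "{u. g u \<noteq> 0} = {u. f u \<noteq> 0} - {w}" by (auto simp: g_def)
    have "P g"
    proof (rule less.hyps)
      show "card {u. g u \<noteq> 0} < card {u. f u \<noteq> 0}"
        unfolding supp using w less.prems(1) by (intro card_Diff1_less) auto
    qed (use less.prems in \<open>auto simp: supp\<close>)
    moreover have "f = (\<lambda>u. g u + f w * word w u)" by (auto simp: g_def word_def)
    ultimately show ?thesis
      using add[of w g "f w"] less.prems w by (auto simp: supp)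
  qed
qed

text \<open>Left contraction, the antiderivation of degree -1 extending \<phi>: the first letter is
  paired with \<phi> or passed at the cost of a sign.\<close>

fun contract_word :: "('v \<Rightarrow> 'k::field) \<Rightarrow> 'v list \<Rightarrow> 'v list \<Rightarrow> 'k" where
  "contract_word \<phi> [] = (\<lambda>_. 0)"
| "contract_word \<phi> (v # w) = (\<lambda>u. \<phi> v * word w u - conv (word [v]) (contract_word \<phi> w) u)"

definition contract :: "('v \<Rightarrow> 'k::field) \<Rightarrow> ('v list \<Rightarrow> 'k) \<Rightarrow> 'v list \<Rightarrow> 'k" where
  "contract \<phi> f u = (\<Sum>w | f w \<noteq> 0. f w * contract_word \<phi> w u)"

lemma contract_superset:
  "finite S \<Longrightarrow> {w. f w \<noteq> 0} \<subseteq> S \<Longrightarrow> contract \<phi> f u = (\<Sum>w\<in>S. f w * contract_word \<phi> w u)"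
  unfolding contract_def by (intro sum.mono_neutral_left) auto

lemma contract_add:
  assumes "finite {w. f w \<noteq> 0}" "finite {w. g w \<noteq> 0}"
  shows "contract \<phi> (\<lambda>u. f u + g u) = (\<lambda>u. contract \<phi> f u + contract \<phi> g u)"
proof
  fix u
  let ?S = "{w. f w \<noteq> 0} \<union> {w. g w \<noteq> 0}"
  have "contract \<phi> (\<lambda>u. f u + g u) u = (\<Sum>w\<in>?S. (f w + g w) * contract_word \<phi> w u)"
    by (rule contract_superset) (use assms in auto)
  also have "\<dots> = (\<Sum>w\<in>?S. f w * contract_word \<phi> w u) + (\<Sum>w\<in>?S. g w * contract_word \<phi> w u)"
    by (simp add: algebra_simps sum.distrib)
  also have "\<dots> = contract \<phi> f u + contract \<phi> g u"
    using contract_superset[of ?S f \<phi> u] contract_superset[of ?S g \<phi> u] assms by simp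
  finally show "contract \<phi> (\<lambda>u. f u + g u) u = contract \<phi> f u + contract \<phi> g u" .
qed

lemma contract_scale: "contract \<phi> (\<lambda>u. c * f u) = (\<lambda>u. c * contract \<phi> f u)"
  by (cases "c = 0") (auto simp: contract_def fun_eq_iff sum_distrib_left mult.assoc)

lemma contract_zero [simp]: "contract \<phi> (\<lambda>_. 0) = (\<lambda>_. 0)"
  by (simp add: contract_def fun_eq_iff)

lemma contract_of_word: "contract \<phi> (word w) = contract_word \<phi> w"
  by (simp add: fun_eq_iff contract_def)

lemma finite_word: "finite {u. c * word w u \<noteq> (0 :: 'k::field)}"
  by (rule finite_subset[of _ "{w}"]) (auto simp: word_def)

lemma finite_conv:
  assumes "finite {w. f w \<noteq> 0}" "finite {w. g w \<noteq> 0}"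
  shows "{w. conv f g w \<noteq> 0} \<subseteq> (\<lambda>(u, v). u @ v) ` ({w. f w \<noteq> 0} \<times> {w. g w \<noteq> 0})"
    "finite {w. conv f g w \<noteq> 0}"
proof -
  show 1: "{w. conv f g w \<noteq> 0} \<subseteq> (\<lambda>(u, v). u @ v) ` ({w. f w \<noteq> 0} \<times> {w. g w \<noteq> 0})"
  proof
    fix w assume "w \<in> {w. conv f g w \<noteq> 0}"
    then obtain i where "f (take i w) * g (drop i w) \<noteq> 0"
      unfolding conv_def by (metis (mono_tags, lifting) mem_Collect_eq sum.neutral)
    then show "w \<in> (\<lambda>(u, v). u @ v) ` ({w. f w \<noteq> 0} \<times> {w. g w \<noteq> 0})"
      by (intro image_eqI[of _ _ "(take i w, drop i w)"]) auto
  qed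
  show "finite {w. conv f g w \<noteq> 0}"
    by (rule finite_subset[OF 1]) (use assms in auto)
qed

lemma contract_conv_letter:
  fixes g :: "'v list \<Rightarrow> 'k::field"
  assumes "finite {w. g w \<noteq> 0}"
  shows "contract \<phi> (conv (word [v]) g) = (\<lambda>u. \<phi> v * g u - conv (word [v]) (contract \<phi> g) u)"
  using assms subset_UNIV
proof (induction g rule: word_induct)
  case (add f c w)
  have fin: "finite {u. word [v] u \<noteq> (0 :: 'k)}" by simp
  have "contract \<phi> (conv (word [v]) (\<lambda>u. f u + c * word w u)) =
      contract \<phi> (\<lambda>u. conv (word [v]) f u + c * word (v # w) u)"
    by (simp add: conv_add_right conv_scale_right conv_letter_word)
  also have "\<dots> = (\<lambda>u. contract \<phi> (conv (word [v]) f) u + c * contract_word \<phi> (v # w) u)"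
    using finite_conv(2)[OF fin add.hyps(2)] finite_word[of c "v # w"]
    by (simp add: contract_add contract_scale contract_of_word)
  also have "\<dots> = (\<lambda>u. \<phi> v * (f u + c * word w u) - conv (word [v]) (contract \<phi> (\<lambda>u. f u + c * word w u)) u)"
    using add.hyps(2) finite_word[of c w]
    by (simp add: add.IH contract_add contract_scale contract_of_word conv_add_right conv_scale_right
        algebra_simps)
  finally show ?case .
qed simp

locale exterior = scalar_module V for V :: "('k::field, 'v) module"
begin

definition FA :: "('v list \<Rightarrow> 'k) set" where
  "FA = {f. finite {w. f w \<noteq> 0} \<and> (\<forall>w. f w \<noteq> 0 \<longrightarrow> set w \<subseteq> carrier V)}"

definition hom_part :: "nat \<Rightarrow> ('v list \<Rightarrow> 'k) set" where
  "hom_part j = {f \<in> FA. \<forall>w. f w \<noteq> 0 \<longrightarrow> length w = j}"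

lemma free_algebra_simps [simp]:
  "carrier (free_algebra V) = FA" "\<zero>\<^bsub>free_algebra V\<^esub> = (\<lambda>_. 0)" "\<one>\<^bsub>free_algebra V\<^esub> = word []"
  "f \<oplus>\<^bsub>free_algebra V\<^esub> g = (\<lambda>w. f w + g w)" "f \<otimes>\<^bsub>free_algebra V\<^esub> g = conv f g"
  by (simp_all add: free_algebra_def FA_def conv_def fun_eq_iff)

lemma FA_finite: "f \<in> FA \<Longrightarrow> finite {w. f w \<noteq> 0}"
  by (simp add: FA_def)

lemma FA_zero [simp]: "(\<lambda>_. 0) \<in> FA"
  by (simp add: FA_def)

lemma FA_add [simp]: "f \<in> FA \<Longrightarrow> g \<in> FA \<Longrightarrow> (\<lambda>w. f w + g w) \<in> FA"
proof -
  assume fg: "f \<in> FA" "g \<in> FA"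
  have "finite {w. f w + g w \<noteq> 0}"
    by (rule finite_subset[of _ "{w. f w \<noteq> 0} \<union> {w. g w \<noteq> 0}"]) (use fg in \<open>auto simp: FA_def\<close>)
  moreover have "set w \<subseteq> carrier V" if "f w + g w \<noteq> 0" for w
    using that fg by (cases "f w = 0") (auto simp: FA_def)
  ultimately show ?thesis by (auto simp: FA_def)
qed

lemma FA_scale [simp]: "f \<in> FA \<Longrightarrow> (\<lambda>w. c * f w) \<in> FA"
  by (auto simp: FA_def)

lemma FA_uminus [simp]: "f \<in> FA \<Longrightarrow> (\<lambda>w. - f w) \<in> FA"
  using FA_scale[of f "- 1"] by simp

lemma FA_diff [simp]: "f \<in> FA \<Longrightarrow> g \<in> FA \<Longrightarrow> (\<lambda>w. f w - g w) \<in> FA"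
  using FA_add[OF _ FA_scale[of g "- 1"], of f] by simp

lemma FA_conv [simp]: "f \<in> FA \<Longrightarrow> g \<in> FA \<Longrightarrow> conv f g \<in> FA"
  using finite_conv[of f g] by (fastforce simp: FA_def)

lemma FA_word [simp]: "set w \<subseteq> carrier V \<Longrightarrow> word w \<in> FA"
  using finite_word[of 1 w] by (auto simp: FA_def word_def)

lemma FA_induct [consumes 1, case_names zero add]:
  assumes "f \<in> FA" "P (\<lambda>_. 0)"
    "\<And>f c w. f \<in> FA \<Longrightarrow> set w \<subseteq> carrier V \<Longrightarrow> P f \<Longrightarrow> P (\<lambda>u. f u + c * word w u)"
  shows "P f"
proof -
  have "finite {w. f w \<noteq> 0}" "{w. f w \<noteq> 0} \<subseteq> {w. set w \<subseteq> carrier V}"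
    using assms(1) by (auto simp: FA_def)
  then show ?thesis
  proof (induction rule: word_induct)
    case (add f c w)
    then show ?case using assms(3)[of f w c] by (auto simp: FA_def Collect_mono_iff)
  qed (rule assms(2))
qed

lemma hom_part_FA: "f \<in> hom_part j \<Longrightarrow> f \<in> FA"
  by (simp add: hom_part_def)

lemma hom_part_induct [consumes 1, case_names zero add]:
  assumes "f \<in> hom_part j" "P (\<lambda>_. 0)"
    "\<And>f c w. f \<in> hom_part j \<Longrightarrow> set w \<subseteq> carrier V \<Longrightarrow> length w = j \<Longrightarrow> P f \<Longrightarrow> P (\<lambda>u. f u + c * word w u)"
  shows "P f"
proof -
  have "finite {w. f w \<noteq> 0}" "{w. f w \<noteq> 0} \<subseteq> {w. set w \<subseteq> carrier V \<and> length w = j}"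
    using assms(1) by (auto simp: FA_def hom_part_def)
  then show ?thesis
  proof (induction rule: word_induct)
    case (add f c w)
    then show ?case using assms(3)[of f w c] by (auto simp: FA_def hom_part_def Collect_mono_iff)
  qed (rule assms(2))
qed

lemma hom_part_zero [simp]: "(\<lambda>_. 0) \<in> hom_part j"
  by (simp add: hom_part_def)

lemma hom_part_add [simp]: "f \<in> hom_part j \<Longrightarrow> g \<in> hom_part j \<Longrightarrow> (\<lambda>w. f w + g w) \<in> hom_part j"
  by (auto simp: hom_part_def) (metis add_0)

lemma hom_part_scale [simp]: "f \<in> hom_part j \<Longrightarrow> (\<lambda>w. c * f w) \<in> hom_part j"
  by (auto simp: hom_part_def)

lemma hom_part_diff [simp]: "f \<in> hom_part j \<Longrightarrow> g \<in> hom_part j \<Longrightarrow> (\<lambda>w. f w - g w) \<in> hom_part j"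
  using hom_part_add[OF _ hom_part_scale[of g j "- 1"], of f] by simp

lemma hom_part_word: "set w \<subseteq> carrier V \<Longrightarrow> word w \<in> hom_part (length w)"
  by (auto simp: hom_part_def) (auto simp: word_def split: if_splits)

lemma hom_part_letter: "v \<in> carrier V \<Longrightarrow> f \<in> hom_part j \<Longrightarrow> conv (word [v]) f \<in> hom_part (Suc j)"
  by (auto simp: hom_part_def conv_letter split: list.splits if_splits)

lemma hom_part_Suc_decomposition:
  assumes "f \<in> hom_part (Suc j)" and P0: "P (\<lambda>_. 0)"
    and Padd: "\<And>f v g. v \<in> carrier V \<Longrightarrow> g \<in> hom_part j \<Longrightarrow> f \<in> hom_part (Suc j) \<Longrightarrow> P f \<Longrightarrow>
      P (\<lambda>u. f u + conv (word [v]) g u)"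
  shows "P f"
  using assms(1)
proof (induction rule: hom_part_induct)
  case (add f c w)
  obtain v w' where w: "w = v # w'" using add by (cases w) auto
  have "conv (word [v]) (\<lambda>u. c * word w' u) = (\<lambda>u. c * word w u)"
    by (simp add: conv_scale_right conv_letter_word w)
  moreover have "(\<lambda>u. c * word w' u) \<in> hom_part j"
    using add hom_part_word[of w'] w by auto
  ultimately show ?case
    using Padd[of v "\<lambda>u. c * word w' u" f] add w by simp
qed (rule P0)

lemma free_algebra_ring: "ring (free_algebra V)"
proof (rule ringI)
  show "abelian_group (free_algebra V)"
  proof (rule abelian_groupI)
    show "\<exists>y\<in>carrier (free_algebra V). y \<oplus>\<^bsub>free_algebra V\<^esub> f = \<zero>\<^bsub>free_algebra V\<^esub>"
      if "f \<in> carrier (free_algebra V)" for f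
      using that by (intro bexI[of _ "\<lambda>w. - f w"]) simp_all
  qed (simp_all add: algebra_simps)
  show "monoid (free_algebra V)"
    by (rule monoidI) (simp_all add: conv_assoc)
qed (simp_all add: conv_add_left conv_add_right)

sublocale FA: ring "free_algebra V" by (rule free_algebra_ring)

lemma FA_a_inv: "f \<in> FA \<Longrightarrow> \<ominus>\<^bsub>free_algebra V\<^esub> f = (\<lambda>w. - f w)"
  using FA_scale[of f "- 1"] by (intro FA.minus_equality) simp_all

abbreviation "I \<equiv> ext_ideal V"

definition relators :: "('v list \<Rightarrow> 'k) set" where
  "relators = {(\<lambda>u. word [x \<oplus>\<^bsub>V\<^esub> y] u - word [x] u - word [y] u) | x y. x \<in> carrier V \<and> y \<in> carrier V} \<union>
      {(\<lambda>u. word [c \<odot>\<^bsub>V\<^esub> x] u - c * word [x] u) | c x. x \<in> carrier V} \<union>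
      {word [x, x] | x. x \<in> carrier V}"

lemma relators_FA: "relators \<subseteq> FA"
  by (auto simp: relators_def)

lemma ext_ideal_eq: "I = Idl\<^bsub>free_algebra V\<^esub> relators"
  by (simp add: ext_ideal_def relators_def)

lemma ideal_I: "ideal I (free_algebra V)"
  unfolding ext_ideal_eq by (rule FA.genideal_ideal) (simp add: relators_FA)

sublocale I: ideal I "free_algebra V" by (rule ideal_I)

lemma I_FA: "f \<in> I \<Longrightarrow> f \<in> FA"
  using I.a_subset by auto

lemma I_zero [simp]: "(\<lambda>_. 0) \<in> I"
  using I.zero_closed by simp

lemma I_add: "f \<in> I \<Longrightarrow> g \<in> I \<Longrightarrow> (\<lambda>w. f w + g w) \<in> I"
  using I.a_closed[of f g] by simp

lemma I_left: "f \<in> I \<Longrightarrow> g \<in> FA \<Longrightarrow> conv g f \<in> I"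
  using I.I_l_closed[of f g] by simp

lemma I_right: "f \<in> I \<Longrightarrow> g \<in> FA \<Longrightarrow> conv f g \<in> I"
  using I.I_r_closed[of f g] by simp

lemma I_scale: "f \<in> I \<Longrightarrow> (\<lambda>w. c * f w) \<in> I"
  using I_left[of f "\<lambda>w. c * word [] w"] by (simp add: conv_scale_left)

lemma I_neg: "f \<in> I \<Longrightarrow> (\<lambda>w. - f w) \<in> I"
  using I_scale[of f "- 1"] by simp

lemma I_diff: "f \<in> I \<Longrightarrow> g \<in> I \<Longrightarrow> (\<lambda>w. f w - g w) \<in> I"
  using I_add[OF _ I_scale[of g "- 1"], of f] by simp

lemma relators_I: "relators \<subseteq> I"
  unfolding ext_ideal_eq by (rule FA.genideal_self) (simp add: relators_FA)

lemma I_sum_relator: "x \<in> carrier V \<Longrightarrow> y \<in> carrier V \<Longrightarrow>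
    (\<lambda>u. word [x \<oplus>\<^bsub>V\<^esub> y] u - word [x] u - word [y] u) \<in> I"
  and I_scale_relator: "x \<in> carrier V \<Longrightarrow> (\<lambda>u. word [c \<odot>\<^bsub>V\<^esub> x] u - c * word [x] u) \<in> I"
  and I_square: "x \<in> carrier V \<Longrightarrow> word [x, x] \<in> I"
  using relators_I by (auto simp: relators_def)

lemma contract_in_FA: "f \<in> FA \<Longrightarrow> contract \<phi> f \<in> FA"
proof (induction rule: FA_induct)
  case (add f c w)
  have "contract_word \<phi> w \<in> FA"
    using add(2) by (induction w) auto
  then show ?case
    using add finite_word[of c w] by (simp add: contract_add FA_finite contract_scale contract_of_word)
qed simp

lemma contract_hom_part:
  "f \<in> hom_part (Suc j) \<Longrightarrow> contract \<phi> f \<in> hom_part j"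
  "f \<in> hom_part 0 \<Longrightarrow> contract \<phi> f = (\<lambda>_. 0)"
proof -
  have word: "length w = Suc j \<Longrightarrow> set w \<subseteq> carrier V \<Longrightarrow> contract_word \<phi> w \<in> hom_part j" for w j
  proof (induction w arbitrary: j)
    case (Cons v w)
    then show ?case
      using hom_part_word[of w] hom_part_letter[of v "contract_word \<phi> w"]
      by (cases w) (auto simp del: contract_word.simps simp: contract_word.simps(1) contract_word.simps(2)[of \<phi> v])
  qed simp
  show "f \<in> hom_part (Suc j) \<Longrightarrow> contract \<phi> f \<in> hom_part j"
  proof (induction rule: hom_part_induct)
    case (add f c w)
    then show ?case
      using finite_word[of c w] word[of w j]
      by (simp add: contract_add FA_finite hom_part_FA contract_scale contract_of_word)
  qed simp
  show "f \<in> hom_part 0 \<Longrightarrow> contract \<phi> f = (\<lambda>_. 0)"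
  proof (induction rule: hom_part_induct)
    case (add f c w)
    then show ?case
      using finite_word[of c w]
      by (simp add: contract_add FA_finite hom_part_FA contract_scale contract_of_word)
  qed simp
qed

lemma contract_letter:
  "g \<in> FA \<Longrightarrow> contract \<phi> (conv (word [v]) g) = (\<lambda>u. \<phi> v * g u - conv (word [v]) (contract \<phi> g) u)"
  by (rule contract_conv_letter) (rule FA_finite)

lemma contract_FA_add:
  "f \<in> FA \<Longrightarrow> g \<in> FA \<Longrightarrow> contract \<phi> (\<lambda>u. f u + g u) = (\<lambda>u. contract \<phi> f u + contract \<phi> g u)"
  by (simp add: contract_add FA_finite)

lemma contract_FA_diff:
  assumes "f \<in> FA" "g \<in> FA"
  shows "contract \<phi> (\<lambda>u. f u - g u) = (\<lambda>u. contract \<phi> f u - contract \<phi> g u)"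
proof -
  have "contract \<phi> (\<lambda>u. f u - g u) = contract \<phi> (\<lambda>u. f u + (- 1) * g u)" by simp
  also have "\<dots> = (\<lambda>u. contract \<phi> f u + (- 1) * contract \<phi> g u)"
    by (subst contract_FA_add) (use assms FA_scale in \<open>blast, blast, simp only: contract_scale\<close>)
  finally show ?thesis by simp
qed

text \<open>The elements of the ideal all of whose right multiples contract into it form an ideal
  that contains the relators. Contraction therefore descends to the exterior algebra.\<close>

lemma contract_in_I:
  assumes \<phi>: "\<phi> \<in> carrier (dual_space V)" and f: "f \<in> I"
  shows "contract \<phi> f \<in> I"
proof -
  \<comment> \<open>The quantifier over right factors builds in closure under right multiplication;
    closure on the left is shown letter by letter with the Leibniz rule.\<close>
  define K where "K = {f \<in> I. \<forall>g\<in>FA. contract \<phi> (conv f g) \<in> I}"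
  have K_FA: "f \<in> FA" if "f \<in> K" for f using that I_FA by (simp add: K_def)
  have K_left_word: "contract \<phi> (conv (word w) (conv f g)) \<in> I"
    if f: "f \<in> K" and g: "g \<in> FA" and w: "set w \<subseteq> carrier V" for f g w
    using w
  proof (induction w)
    case Nil
    then show ?case using f g by (simp add: K_def)
  next
    case (Cons v w)
    have fg: "conv (word w) (conv f g) \<in> I"
      using f g Cons by (intro I_left I_right) (auto simp: K_def)
    have "conv (word (v # w)) (conv f g) = conv (word [v]) (conv (word w) (conv f g))"
      by (simp add: conv_letter_word conv_assoc[symmetric])
    then have "contract \<phi> (conv (word (v # w)) (conv f g)) =
        (\<lambda>u. \<phi> v * conv (word w) (conv f g) u - conv (word [v]) (contract \<phi> (conv (word w) (conv f g))) u)"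
      using contract_letter[OF I_FA[OF fg]] by simp
    then show ?case
      using Cons fg by (auto intro!: I_diff I_scale I_left)
  qed
  have "ideal K (free_algebra V)"
  proof (rule idealI)
    show "subgroup K (add_monoid (free_algebra V))"
    proof (rule FA.add.subgroupI)
      show "K \<subseteq> carrier (free_algebra V)" using K_FA by auto
      show "K \<noteq> {}" by (auto simp: K_def intro!: exI[of _ "\<lambda>_. 0"])
      show "f \<oplus>\<^bsub>free_algebra V\<^esub> g \<in> K" if "f \<in> K" "g \<in> K" for f g
        using that K_FA[of f] K_FA[of g] by (simp add: K_def I_add conv_add_left contract_FA_add)
      fix f assume f: "f \<in> K"
      have "(\<lambda>w. (- 1) * f w) \<in> K"
        using f unfolding K_def mem_Collect_eq conv_scale_left contract_scale by (blast intro: I_scale)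
      then show "\<ominus>\<^bsub>free_algebra V\<^esub> f \<in> K" using K_FA[OF f] by (simp add: FA_a_inv)
    qed
    show "f \<otimes>\<^bsub>free_algebra V\<^esub> h \<in> K" if "f \<in> K" "h \<in> carrier (free_algebra V)" for f h
      using that by (simp add: K_def I_right conv_assoc)
    show "h \<otimes>\<^bsub>free_algebra V\<^esub> f \<in> K" if f: "f \<in> K" and h: "h \<in> carrier (free_algebra V)" for f h
    proof -
      have "contract \<phi> (conv h (conv f g)) \<in> I" if g: "g \<in> FA" for g
        using h unfolding free_algebra_simps
      proof (induction rule: FA_induct)
        case (add h c w)
        then show ?case
          using K_left_word[OF f g add(2)] g K_FA[OF f]
          by (simp add: conv_add_left conv_scale_left contract_FA_add contract_scale I_add I_scale)
      qed simp
      then show ?thesis using f h by (simp add: K_def I_left conv_assoc)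
    qed
  qed (rule free_algebra_ring)
  moreover have "relators \<subseteq> K"
  proof
    fix r assume r: "r \<in> relators"
    have "contract \<phi> (conv r g) \<in> I" if g: "g \<in> FA" for g
      using r unfolding relators_def
    proof (elim UnE CollectE exE conjE)
      fix x y assume *: "r = (\<lambda>u. word [x \<oplus>\<^bsub>V\<^esub> y] u - word [x] u - word [y] u)" "x \<in> carrier V" "y \<in> carrier V"
      have \<phi>xy: "\<phi> (x \<oplus>\<^bsub>V\<^esub> y) = \<phi> x + \<phi> y" using \<phi> * by (simp add: dual_space_iff)
      have "contract \<phi> (conv r g) = (\<lambda>u. - conv r (contract \<phi> g) u)"
        using * g by (simp add: conv_diff_left conv_add_left contract_FA_diff contract_FA_add contract_letter \<phi>xy algebra_simps)
      then show ?thesis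
        using r relators_I contract_in_FA[OF g] by (auto intro!: I_neg I_right)
    next
      fix c x assume *: "r = (\<lambda>u. word [c \<odot>\<^bsub>V\<^esub> x] u - c * word [x] u)" "x \<in> carrier V"
      have \<phi>cx: "\<phi> (c \<odot>\<^bsub>V\<^esub> x) = c * \<phi> x" using \<phi> * by (simp add: dual_space_iff)
      have "contract \<phi> (conv r g) = (\<lambda>u. - conv r (contract \<phi> g) u)"
        using * g by (simp add: conv_diff_left conv_scale_left contract_FA_diff contract_scale contract_letter \<phi>cx algebra_simps)
      then show ?thesis
        using r relators_I contract_in_FA[OF g] by (auto intro!: I_neg I_right)
    next
      \<comment> \<open>In x x g the two terms containing \<phi> x have opposite signs and
        cancel.\<close>
      fix x assume *: "r = word [x, x]" "x \<in> carrier V"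
      have "conv r h = conv (word [x]) (conv (word [x]) h)" for h
        by (simp add: * conv_assoc[symmetric] conv_letter_word)
      then have "contract \<phi> (conv r g) = conv r (contract \<phi> g)"
        using * g by (simp add: contract_letter conv_diff_right conv_scale_right)
      then show ?thesis
        using r relators_I contract_in_FA[OF g] by (auto intro!: I_right)
    qed
    then show "r \<in> K" using r relators_I by (auto simp: K_def)
  qed
  ultimately have IK: "I \<subseteq> K" unfolding ext_ideal_eq by (rule FA.genideal_minimal)
  have "word [] \<in> FA" by simp
  then have "contract \<phi> (conv f (word [])) \<in> I" using IK f unfolding K_def by blast
  then show ?thesis by simp
qed

text \<open>By the Leibniz rule the error consists of multiples of the contraction of g, which lies
  in the ideal. So contraction commutes with right multiplication by g, and this is how matrices of
  differentials act.\<close>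

lemma contract_conv_mod_I:
  assumes f: "f \<in> FA" and g: "g \<in> FA" "contract \<phi> g \<in> I"
  shows "(\<lambda>u. contract \<phi> (conv f g) u - conv (contract \<phi> f) g u) \<in> I"
  using f
proof (induction rule: FA_induct)
  case (add f c w)
  have word: "(\<lambda>u. contract \<phi> (conv (word w) g) u - conv (contract_word \<phi> w) g u) \<in> I"
    using add(2)
  proof (induction w)
    case (Cons v w)
    have FA: "conv (word w) g \<in> FA" using Cons g by simp
    have "conv (word (v # w)) g = conv (word [v]) (conv (word w) g)"
      by (simp add: conv_letter_word conv_assoc[symmetric])
    then have eq: "(\<lambda>u. contract \<phi> (conv (word (v # w)) g) u - conv (contract_word \<phi> (v # w)) g u) =
        (\<lambda>u. - conv (word [v]) (\<lambda>u. contract \<phi> (conv (word w) g) u - conv (contract_word \<phi> w) g u) u)"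
      by (simp add: contract_letter[OF FA] conv_diff_left conv_diff_right conv_scale_left conv_assoc algebra_simps)
    show ?case unfolding eq by (intro I_neg I_left Cons.IH) (use Cons in simp_all)
  qed (simp add: g)
  have "contract \<phi> (conv (\<lambda>u. f u + c * word w u) g) =
      (\<lambda>u. contract \<phi> (conv f g) u + c * contract \<phi> (conv (word w) g) u)"
    using add g by (simp add: conv_add_left conv_scale_left contract_FA_add contract_scale)
  moreover have "conv (contract \<phi> (\<lambda>u. f u + c * word w u)) g =
      (\<lambda>u. conv (contract \<phi> f) g u + c * conv (contract_word \<phi> w) g u)"
    using add by (simp add: contract_FA_add contract_scale contract_of_word conv_add_left conv_scale_left)
  ultimately show ?case
    using I_add[OF add.IH I_scale[OF word, of c]] by (simp add: algebra_simps)
qed simp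

end

section \<open>The exterior algebra\<close>

context exterior
begin

abbreviation "lin \<equiv> Vector_Spaces.linear (\<lambda>(c::'k) (f :: 'v list \<Rightarrow> 'k) x. c * f x) (\<lambda>c f x. c * f x)"

lemma I_subspace: "fun_vs.subspace I"
  by (rule fun_vs.subspaceI) (simp_all add: zero_fun_def plus_fun_def I_add I_scale)

text \<open>Cosets of the ideal are replaced by the values of a linear projection with kernel \<open>I\<close>.\<close>

definition red :: "('v list \<Rightarrow> 'k) \<Rightarrow> 'v list \<Rightarrow> 'k" where
  "red = (SOME P. (\<forall>f g. P (\<lambda>w. f w + g w) = (\<lambda>w. P f w + P g w)) \<and> (\<forall>c f. P (\<lambda>w. c * f w) = (\<lambda>w. c * P f w)) \<and>
    (\<forall>f\<in>I. P f = (\<lambda>_. 0)) \<and> (\<forall>f. (\<lambda>w. f w - P f w) \<in> I))"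

lemma red:
  "(\<forall>f g. red (\<lambda>w. f w + g w) = (\<lambda>w. red f w + red g w)) \<and> (\<forall>c f. red (\<lambda>w. c * f w) = (\<lambda>w. c * red f w)) \<and>
    (\<forall>f\<in>I. red f = (\<lambda>_. 0)) \<and> (\<forall>f. (\<lambda>w. f w - red f w) \<in> I)"
proof -
  interpret pair: vector_space_pair "\<lambda>(c::'k) (f :: 'v list \<Rightarrow> 'k) x. c * f x" "\<lambda>(c::'k) (f :: 'v list \<Rightarrow> 'k) x. c * f x"
    by unfold_locales
  have "inj_on (\<lambda>f. f) I" by simp
  \<comment> \<open>A linear retraction of the function space onto the ideal; the complementary
    projection is the witness for \<open>red\<close>.\<close>
  then obtain Q where Q: "range Q \<subseteq> I" "lin Q" "\<And>f. f \<in> I \<Longrightarrow> Q f = f"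
    using pair.linear_exists_left_inverse_on[OF fun_vs.linear_ident I_subspace] by blast
  note Ql = fun_vs.linearD[OF Q(2), unfolded plus_fun_def]
  show ?thesis
    unfolding red_def
    by (rule someI[of _ "\<lambda>f w. f w - Q f w"])
       (use Q Ql in \<open>auto simp: fun_eq_iff algebra_simps\<close>)
qed

lemma red_add: "red (\<lambda>w. f w + g w) = (\<lambda>w. red f w + red g w)"
  and red_scale: "red (\<lambda>w. c * f w) = (\<lambda>w. c * red f w)"
  and red_I: "f \<in> I \<Longrightarrow> red f = (\<lambda>_. 0)"
  and red_diff_I: "(\<lambda>w. f w - red f w) \<in> I"
  using red by auto

lemma red_zero [simp]: "red (\<lambda>_. 0) = (\<lambda>_. 0)"
  by (rule red_I) simp

lemma red_diff: "red (\<lambda>w. f w - g w) = (\<lambda>w. red f w - red g w)"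
  using red_add[of f "\<lambda>w. (- 1) * g w"] red_scale[of "- 1" g] by simp

lemma red_eq_iff: "red f = red g \<longleftrightarrow> (\<lambda>w. f w - g w) \<in> I"
proof
  assume eq: "red f = red g"
  have "(\<lambda>w. (f w - red f w) - (g w - red g w)) \<in> I"
    by (rule I_diff) (rule red_diff_I)+
  then show "(\<lambda>w. f w - g w) \<in> I" by (simp add: eq)
next
  assume "(\<lambda>w. f w - g w) \<in> I"
  then have "red (\<lambda>w. f w - g w) = (\<lambda>_. 0)" by (rule red_I)
  then show "red f = red g" by (simp add: red_diff fun_eq_iff)
qed

lemma red_red [simp]: "red (red f) = red f"
  using red_diff_I[of f] red_eq_iff[of f "red f"] by simp

lemma red_FA [simp]: "f \<in> FA \<Longrightarrow> red f \<in> FA"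
  using FA_diff[of f "\<lambda>w. f w - red f w"] I_FA[OF red_diff_I] by simp

section \<open>Exterior powers as spaces of normal forms\<close>

definition \<Lambda> :: "nat \<Rightarrow> ('v list \<Rightarrow> 'k) set" where
  "\<Lambda> j = red ` hom_part j"

definition ext_mult :: "'v \<Rightarrow> ('v list \<Rightarrow> 'k) \<Rightarrow> 'v list \<Rightarrow> 'k" where
  "ext_mult v y = red (conv (word [v]) y)"

definition ext_contract :: "('v \<Rightarrow> 'k) \<Rightarrow> ('v list \<Rightarrow> 'k) \<Rightarrow> 'v list \<Rightarrow> 'k" where
  "ext_contract \<phi> y = red (contract \<phi> y)"

lemma red_conv_right: "g \<in> FA \<Longrightarrow> red (conv g (red f)) = red (conv g f)"
  using I_left[OF red_diff_I, of g f] by (subst eq_commute) (simp add: red_eq_iff conv_diff_right)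

lemma red_conv_left: "g \<in> FA \<Longrightarrow> red (conv (red f) g) = red (conv f g)"
  using I_right[OF red_diff_I, of g f] by (subst eq_commute) (simp add: red_eq_iff conv_diff_left)

lemma ext_mult_red: "v \<in> carrier V \<Longrightarrow> ext_mult v (red f) = red (conv (word [v]) f)"
  by (simp add: ext_mult_def red_conv_right)

lemma ext_contract_red: "\<phi> \<in> carrier (dual_space V) \<Longrightarrow> f \<in> FA \<Longrightarrow> ext_contract \<phi> (red f) = red (contract \<phi> f)"
  using contract_in_I[OF _ red_diff_I, of \<phi> f]
  by (subst eq_commute) (simp add: ext_contract_def red_eq_iff contract_FA_diff)

lemma \<Lambda>_FA: "y \<in> \<Lambda> j \<Longrightarrow> y \<in> FA"
  by (auto simp: \<Lambda>_def hom_part_FA)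

lemma red_\<Lambda>: "y \<in> \<Lambda> j \<Longrightarrow> red y = y"
  by (auto simp: \<Lambda>_def)

lemma \<Lambda>_zero [simp]: "(\<lambda>_. 0) \<in> \<Lambda> j"
  unfolding \<Lambda>_def by (rule image_eqI[of _ _ "\<lambda>_. 0"]) simp_all

lemma \<Lambda>_add: "x \<in> \<Lambda> j \<Longrightarrow> y \<in> \<Lambda> j \<Longrightarrow> (\<lambda>w. x w + y w) \<in> \<Lambda> j"
  unfolding \<Lambda>_def using hom_part_add by (fastforce simp: red_add[symmetric])

lemma \<Lambda>_scale: "x \<in> \<Lambda> j \<Longrightarrow> (\<lambda>w. c * x w) \<in> \<Lambda> j"
  unfolding \<Lambda>_def using hom_part_scale by (fastforce simp: red_scale[symmetric])

lemma \<Lambda>_diff: "x \<in> \<Lambda> j \<Longrightarrow> y \<in> \<Lambda> j \<Longrightarrow> (\<lambda>w. x w - y w) \<in> \<Lambda> j"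
  using \<Lambda>_add[OF _ \<Lambda>_scale[of y j "- 1"], of x] by simp

lemma ext_mult_\<Lambda>: "v \<in> carrier V \<Longrightarrow> y \<in> \<Lambda> j \<Longrightarrow> ext_mult v y \<in> \<Lambda> (Suc j)"
  by (auto simp: \<Lambda>_def ext_mult_red hom_part_letter)

lemma ext_contract_\<Lambda>: "\<phi> \<in> carrier (dual_space V) \<Longrightarrow> y \<in> \<Lambda> (Suc j) \<Longrightarrow> ext_contract \<phi> y \<in> \<Lambda> j"
  by (auto simp: \<Lambda>_def ext_contract_red hom_part_FA contract_hom_part)

lemma ext_contract_\<Lambda>_0: "\<phi> \<in> carrier (dual_space V) \<Longrightarrow> y \<in> \<Lambda> 0 \<Longrightarrow> ext_contract \<phi> y = (\<lambda>_. 0)"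
  by (auto simp: \<Lambda>_def ext_contract_red hom_part_FA contract_hom_part)

lemma ext_mult_add: "ext_mult v (\<lambda>w. x w + y w) = (\<lambda>w. ext_mult v x w + ext_mult v y w)"
  by (simp add: ext_mult_def conv_add_right red_add)

lemma ext_mult_scale: "ext_mult v (\<lambda>w. c * x w) = (\<lambda>w. c * ext_mult v x w)"
  by (simp add: ext_mult_def conv_scale_right red_scale)

lemma ext_contract_add: "x \<in> FA \<Longrightarrow> y \<in> FA \<Longrightarrow> ext_contract \<phi> (\<lambda>w. x w + y w) = (\<lambda>w. ext_contract \<phi> x w + ext_contract \<phi> y w)"
  by (simp add: ext_contract_def contract_FA_add red_add)

lemma ext_mult_add_vector:
  assumes "v \<in> carrier V" "v' \<in> carrier V" "y \<in> FA"
  shows "ext_mult (v \<oplus>\<^bsub>V\<^esub> v') y = (\<lambda>w. ext_mult v y w + ext_mult v' y w)"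
proof -
  have "red (conv (word [v \<oplus>\<^bsub>V\<^esub> v']) y) = red (conv (\<lambda>u. word [v] u + word [v'] u) y)"
    using I_right[OF I_sum_relator[OF assms(1,2)] assms(3)]
    by (simp add: red_eq_iff conv_diff_left conv_add_left algebra_simps)
  then show ?thesis by (simp add: ext_mult_def conv_add_left red_add)
qed

lemma ext_mult_scale_vector:
  assumes "v \<in> carrier V" "y \<in> FA"
  shows "ext_mult (c \<odot>\<^bsub>V\<^esub> v) y = (\<lambda>w. c * ext_mult v y w)"
proof -
  have "red (conv (word [c \<odot>\<^bsub>V\<^esub> v]) y) = red (conv (\<lambda>u. c * word [v] u) y)"
    using I_right[OF I_scale_relator[OF assms(1)] assms(2)]
    by (simp add: red_eq_iff conv_diff_left)
  then show ?thesis by (simp add: ext_mult_def conv_scale_left red_scale)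
qed

lemma ext_mult_ext_mult: "v \<in> carrier V \<Longrightarrow> v' \<in> carrier V \<Longrightarrow> ext_mult v (ext_mult v' y) = red (conv (word [v, v']) y)"
  by (simp add: ext_mult_def red_conv_right conv_assoc[symmetric] conv_letter_word)

lemma ext_mult_square: "v \<in> carrier V \<Longrightarrow> y \<in> FA \<Longrightarrow> ext_mult v (ext_mult v y) = (\<lambda>_. 0)"
  by (simp add: ext_mult_ext_mult red_I I_right I_square)

text \<open>Polarisation: expand the square of v + v' and discard the two pure squares.\<close>

lemma ext_mult_anti:
  assumes "v \<in> carrier V" "v' \<in> carrier V" "y \<in> FA"
  shows "(\<lambda>w. ext_mult v (ext_mult v' y) w + ext_mult v' (ext_mult v y) w) = (\<lambda>_. 0)"
proof -
  have FA: "ext_mult v y \<in> FA" "ext_mult v' y \<in> FA" using assms by (simp_all add: ext_mult_def)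
  have "ext_mult (v \<oplus>\<^bsub>V\<^esub> v') (ext_mult (v \<oplus>\<^bsub>V\<^esub> v') y) = (\<lambda>_. 0)"
    using assms by (intro ext_mult_square) simp_all
  then show ?thesis
    using assms FA by (simp add: ext_mult_add_vector ext_mult_add ext_mult_square fun_eq_iff add.commute)
qed

text \<open>The Leibniz rule on normal forms; it supplies the law \<open>\<iota>_e\<close> of
  \<open>contraction_system\<close>.\<close>

lemma ext_contract_ext_mult:
  assumes "\<phi> \<in> carrier (dual_space V)" "v \<in> carrier V" "y \<in> \<Lambda> j"
  shows "ext_contract \<phi> (ext_mult v y) = (\<lambda>w. \<phi> v * y w - ext_mult v (ext_contract \<phi> y) w)"
proof -
  have FA: "y \<in> FA" using assms(3) by (rule \<Lambda>_FA)
  have "ext_contract \<phi> (ext_mult v y) = red (contract \<phi> (conv (word [v]) y))"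
    using assms FA by (simp add: ext_mult_def ext_contract_red)
  also have "\<dots> = (\<lambda>w. \<phi> v * y w - red (conv (word [v]) (contract \<phi> y)) w)"
    using FA red_\<Lambda>[OF assms(3)] by (simp add: contract_letter red_diff red_scale)
  finally show ?thesis using assms(2) by (simp add: ext_contract_def ext_mult_red)
qed

lemma \<Lambda>_Suc_induct [consumes 1, case_names zero add]:
  assumes "y \<in> \<Lambda> (Suc j)" "P (\<lambda>_. 0)"
    "\<And>x v z. v \<in> carrier V \<Longrightarrow> z \<in> \<Lambda> j \<Longrightarrow> x \<in> \<Lambda> (Suc j) \<Longrightarrow> P x \<Longrightarrow> P (\<lambda>u. x u + ext_mult v z u)"
  shows "P y"
proof -
  obtain f where f: "f \<in> hom_part (Suc j)" "y = red f" using assms(1) by (auto simp: \<Lambda>_def)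
  have "P (red f)"
    using f(1)
  proof (rule hom_part_Suc_decomposition[where P = "\<lambda>f. P (red f)"])
    fix f v g assume "v \<in> carrier V" "g \<in> hom_part j" "f \<in> hom_part (Suc j)" "P (red f)"
    then show "P (red (\<lambda>u. f u + conv (word [v]) g u))"
      using assms(3)[of v "red g" "red f"] by (simp add: red_add ext_mult_red) (simp add: \<Lambda>_def)
  qed (simp add: assms(2))
  then show ?thesis using f by simp
qed

lemma \<Lambda>_0: "y \<in> \<Lambda> 0 \<Longrightarrow> \<exists>c. y = (\<lambda>w. c * red (word []) w)"
proof -
  assume "y \<in> \<Lambda> 0"
  then obtain f where f: "f \<in> hom_part 0" "y = red f" by (auto simp: \<Lambda>_def)
  have "f = (\<lambda>w. f [] * word [] w)"
  proof
    fix w show "f w = f [] * word [] w"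
      using f(1) by (cases "w = []") (auto simp: hom_part_def word_def)
  qed
  then have "y = red (\<lambda>w. f [] * word [] w)" using f(2) by simp
  then show ?thesis by (auto simp: red_scale)
qed

lemma red_unit_\<Lambda>: "red (word []) \<in> \<Lambda> 0"
  using hom_part_word[of "[]"] by (simp add: \<Lambda>_def)

section \<open>Cosets of the ideal and their normal forms\<close>

lemma ext_class_eq: "f \<in> FA \<Longrightarrow> ext_class V f = {g. (\<lambda>w. g w - f w) \<in> I}"
proof -
  assume "f \<in> FA"
  have "ext_class V f = (\<lambda>i w. i w + f w) ` I"
    by (auto simp: ext_class_def a_r_coset_def r_coset_def)
  also have "\<dots> = {g. (\<lambda>w. g w - f w) \<in> I}"
  proof (rule Set.set_eqI, rule iffI)
    fix g assume "g \<in> {g. (\<lambda>w. g w - f w) \<in> I}"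
    then show "g \<in> (\<lambda>i w. i w + f w) ` I"
      by (intro image_eqI[of _ _ "\<lambda>w. g w - f w"]) auto
  qed auto
  finally show ?thesis .
qed

lemma ext_class_eq_iff:
  assumes "f \<in> FA" "g \<in> FA"
  shows "ext_class V f = ext_class V g \<longleftrightarrow> red f = red g"
proof -
  have "ext_class V h = {u. red u = red h}" if "h \<in> FA" for h
    using that by (simp add: ext_class_eq red_eq_iff)
  then show ?thesis using assms by (auto simp: set_eq_iff)
qed

lemma ext_class_red: "f \<in> FA \<Longrightarrow> ext_class V (red f) = ext_class V f"
  by (simp add: ext_class_eq_iff)

lemma ext_algebra_simps:
  "add (ext_algebra V) = set_add (free_algebra V)" "monoid.mult (ext_algebra V) = rcoset_mult (free_algebra V) I"
  "\<zero>\<^bsub>ext_algebra V\<^esub> = I" "\<one>\<^bsub>ext_algebra V\<^esub> = ext_class V (word [])"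
  "carrier (ext_algebra V) = a_rcosets\<^bsub>free_algebra V\<^esub> I"
  by (simp_all add: ext_algebra_def FactRing_def ext_class_def)

lemma ext_class_add: "f \<in> FA \<Longrightarrow> g \<in> FA \<Longrightarrow>
    ext_class V f \<oplus>\<^bsub>ext_algebra V\<^esub> ext_class V g = ext_class V (\<lambda>w. f w + g w)"
  using I.a_rcos_sum[of f g] by (simp add: ext_class_def ext_algebra_simps)

lemma ext_class_mult: "f \<in> FA \<Longrightarrow> g \<in> FA \<Longrightarrow>
    ext_class V f \<otimes>\<^bsub>ext_algebra V\<^esub> ext_class V g = ext_class V (conv f g)"
  using I.rcoset_mult_add[of f g] by (simp add: ext_class_def ext_algebra_simps)

lemma ext_class_zero: "\<zero>\<^bsub>ext_algebra V\<^esub> = ext_class V (\<lambda>_. 0)"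
  by (simp add: ext_class_eq ext_algebra_simps)

lemma ext_power_smult: "f \<in> FA \<Longrightarrow> c \<odot>\<^bsub>ext_power V i\<^esub> ext_class V f = ext_class V (\<lambda>w. c * f w)"
  by (simp add: ext_power_def ext_class_mult conv_scale_left)

lemma carrier_ext_power: "carrier (ext_power V (int j)) = ext_class V ` \<Lambda> j"
proof -
  have "carrier (ext_power V (int j)) = ext_class V ` hom_part j"
    by (simp add: ext_power_def hom_part_def)
  also have "\<dots> = ext_class V ` \<Lambda> j"
    by (simp add: \<Lambda>_def image_image ext_class_red hom_part_FA cong: image_cong_simp)
  finally show ?thesis .
qed

lemma carrier_ext_power_negative:
  assumes "i < 0"
  shows "carrier (ext_power V i) = {\<zero>\<^bsub>ext_algebra V\<^esub>}"
proof -
  have "{f \<in> FA. \<forall>w. f w \<noteq> 0 \<longrightarrow> int (length w) = i} = {\<lambda>_. 0}"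
    using assms by (auto simp: fun_eq_iff)
  then show ?thesis by (simp add: ext_power_def ext_class_zero)
qed

text \<open>Applying \<open>red\<close> to a chosen member makes the value independent of the
  choice, so \<open>rep\<close> inverts \<open>ext_class\<close> on each
  \<open>\<Lambda> j\<close>.\<close>

definition rep :: "('v list \<Rightarrow> 'k) set \<Rightarrow> 'v list \<Rightarrow> 'k" where
  "rep X = red (SOME f. f \<in> FA \<and> ext_class V f = X)"

lemma rep_ext_class: "f \<in> FA \<Longrightarrow> rep (ext_class V f) = red f"
proof -
  assume f: "f \<in> FA"
  define g where "g = (SOME g. g \<in> FA \<and> ext_class V g = ext_class V f)"
  have "g \<in> FA \<and> ext_class V g = ext_class V f"
    unfolding g_def by (rule someI[of _ f]) (use f in simp)
  then have "red g = red f" using f ext_class_eq_iff by blast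
  then show ?thesis by (simp add: rep_def g_def)
qed

lemma rep_\<Lambda>: "y \<in> \<Lambda> j \<Longrightarrow> rep (ext_class V y) = y"
  by (simp add: rep_ext_class \<Lambda>_FA red_\<Lambda>)

lemma rep_in: "X \<in> carrier (ext_power V (int j)) \<Longrightarrow> rep X \<in> \<Lambda> j"
  and ext_class_rep: "X \<in> carrier (ext_power V (int j)) \<Longrightarrow> ext_class V (rep X) = X"
  by (auto simp: carrier_ext_power rep_\<Lambda>)

lemma letter_in_ext_power: "v \<in> carrier V \<Longrightarrow> ext_class V (word [v]) \<in> carrier (ext_power V 1)"
  using hom_part_word[of "[v]"] by (auto simp: ext_power_def hom_part_def)

text \<open>Contraction sees only the letters in the support of \<open>f\<close>; there are finitely
  many, and each has finitely many nonzero coordinates.\<close>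

lemma ext_contract_finite:
  assumes \<phi>: "\<And>b. b \<in> B \<Longrightarrow> \<phi> b \<in> carrier (dual_space V)"
    and fin: "\<And>v. v \<in> carrier V \<Longrightarrow> finite {b \<in> B. \<phi> b v \<noteq> 0}"
    and f: "f \<in> FA"
  shows "finite {b \<in> B. contract (\<phi> b) f \<noteq> (\<lambda>_. 0)}"
  using f
proof (induction rule: FA_induct)
  case (add f c w)
  have "finite {b \<in> B. contract_word (\<phi> b) w \<noteq> (\<lambda>_. 0)}"
    using add(2)
  proof (induction w)
    case (Cons v w)
    have "{b \<in> B. contract_word (\<phi> b) (v # w) \<noteq> (\<lambda>_. 0)} \<subseteq>
        {b \<in> B. \<phi> b v \<noteq> 0} \<union> {b \<in> B. contract_word (\<phi> b) w \<noteq> (\<lambda>_. 0)}"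
      by auto
    then show ?case
      by (rule finite_subset) (use Cons fin in auto)
  qed simp
  moreover have "{b \<in> B. contract (\<phi> b) (\<lambda>u. f u + c * word w u) \<noteq> (\<lambda>_. 0)} \<subseteq>
      {b \<in> B. contract (\<phi> b) f \<noteq> (\<lambda>_. 0)} \<union> {b \<in> B. contract_word (\<phi> b) w \<noteq> (\<lambda>_. 0)}"
    using add by (auto simp: contract_FA_add contract_scale contract_of_word)
  ultimately show ?case
    using add.IH by (metis (no_types, lifting) finite_UnI finite_subset)
qed simp

lemma ext_contract_conv:
  assumes "\<phi> \<in> carrier (dual_space V)" "x \<in> FA" "z \<in> FA" "ext_contract \<phi> z = (\<lambda>_. 0)"
  shows "ext_contract \<phi> (red (conv x z)) = red (conv (ext_contract \<phi> x) z)"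
proof -
  have "contract \<phi> z \<in> I" using assms(4) red_diff_I[of "contract \<phi> z"] by (simp add: ext_contract_def)
  then have "red (contract \<phi> (conv x z)) = red (conv (contract \<phi> x) z)"
    using contract_conv_mod_I[of x z \<phi>] assms by (simp add: red_eq_iff)
  then show ?thesis using assms by (simp add: ext_contract_red) (simp add: ext_contract_def red_conv_left)
qed

end

section \<open>Linear free resolutions over the exterior algebra\<close>

text \<open>The elements of \<open>Mg\<close> are functions with pointwise operations because
  \<open>Mg\<close> will be a shifted graded dual; this places them in a vector space on a whole
  type.\<close>

locale linear_free_resolution = exterior V for V :: "('k::field, 'v) module" +
  fixes Mg :: "('k, ('v list \<Rightarrow> 'k) set, 'h \<Rightarrow> 'k) graded_module"
    and b :: "nat \<Rightarrow> nat"
    and \<epsilon> :: "int \<Rightarrow> (nat \<Rightarrow> ('v list \<Rightarrow> 'k) set) \<Rightarrow> 'h \<Rightarrow> 'k"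
    and d :: "nat \<Rightarrow> int \<Rightarrow> (nat \<Rightarrow> ('v list \<Rightarrow> 'k) set) \<Rightarrow> nat \<Rightarrow> ('v list \<Rightarrow> 'k) set"
  assumes graded: "graded_ext_module V Mg"
    and Mg_zero: "\<zero>\<^bsub>component Mg i\<^esub> = (\<lambda>_. 0)"
    and Mg_add: "f \<oplus>\<^bsub>component Mg i\<^esub> g = (\<lambda>h. f h + g h)"
    and Mg_smult: "c \<odot>\<^bsub>component Mg i\<^esub> f = (\<lambda>h. c * f h)"
    and \<epsilon>_hom: "\<epsilon> \<in> graded_hom V (free_module V (b 0) 0) Mg"
    and d_hom: "d p \<in> graded_hom V (free_module V (b (Suc p)) (int (Suc p))) (free_module V (b p) (int p))"
    and \<epsilon>_surj: "\<epsilon> i ` carrier (component (free_module V (b 0) 0) i) = carrier (component Mg i)"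
    and \<epsilon>_exact: "d 0 i ` carrier (component (free_module V (b 1) 1) i) =
        {x \<in> carrier (component (free_module V (b 0) 0) i). \<epsilon> i x = \<zero>\<^bsub>component Mg i\<^esub>}"
    and d_exact: "d (Suc p) i ` carrier (component (free_module V (b (Suc (Suc p))) (int (Suc (Suc p)))) i) =
        {x \<in> carrier (component (free_module V (b (Suc p)) (int (Suc p))) i).
          d p i x = \<zero>\<^bsub>component (free_module V (b p) (int p)) i\<^esub>}"
begin

abbreviation F :: "nat \<Rightarrow> int \<Rightarrow> ('k, nat \<Rightarrow> ('v list \<Rightarrow> 'k) set) module" where
  "F p i \<equiv> component (free_module V (b p) (int p)) i"

text \<open>\<open>GG p j\<close> is the component of degree \<open>p + j\<close> of the \<open>p\<close>-th module of the resolution.\<close>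

definition GG :: "nat \<Rightarrow> nat \<Rightarrow> (nat \<Rightarrow> 'v list \<Rightarrow> 'k) set" where
  "GG p j = {x. \<forall>s. if s < b p then x s \<in> \<Lambda> j else x s = (\<lambda>_. 0)}"

text \<open>\<open>\<Psi>\<close> and \<open>\<Phi>\<close> translate between normal forms and the
  coset-valued free modules of the definition. Beyond the rank, entries are 0 on the first side and
  \<open>undefined\<close> on the second.\<close>

definition \<Psi> :: "nat \<Rightarrow> (nat \<Rightarrow> 'v list \<Rightarrow> 'k) \<Rightarrow> nat \<Rightarrow> ('v list \<Rightarrow> 'k) set" where
  "\<Psi> p x = (\<lambda>s\<in>{..<b p}. ext_class V (x s))"

definition \<Phi> :: "nat \<Rightarrow> (nat \<Rightarrow> ('v list \<Rightarrow> 'k) set) \<Rightarrow> nat \<Rightarrow> 'v list \<Rightarrow> 'k" where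
  "\<Phi> p X = (\<lambda>s. if s < b p then rep (X s) else (\<lambda>_. 0))"

text \<open>Internal degree j of the module with index p + 1 is total degree p + 1 + j, hence
  internal degree j + 1 of its target.\<close>

definition D :: "nat \<Rightarrow> nat \<Rightarrow> (nat \<Rightarrow> 'v list \<Rightarrow> 'k) \<Rightarrow> nat \<Rightarrow> 'v list \<Rightarrow> 'k" where
  "D p j x = \<Phi> p (d p (int (Suc p + j)) (\<Psi> (Suc p) x))"

definition eps :: "nat \<Rightarrow> (nat \<Rightarrow> 'v list \<Rightarrow> 'k) \<Rightarrow> 'h \<Rightarrow> 'k" where
  "eps j x = \<epsilon> (int j) (\<Psi> 0 x)"

lemma F_simps:
  "carrier (F p i) = {..<b p} \<rightarrow>\<^sub>E carrier (ext_power V (i - int p))"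
  "\<zero>\<^bsub>F p i\<^esub> = (\<lambda>s\<in>{..<b p}. \<zero>\<^bsub>ext_algebra V\<^esub>)"
  "X \<oplus>\<^bsub>F p i\<^esub> Y = (\<lambda>s\<in>{..<b p}. X s \<oplus>\<^bsub>ext_algebra V\<^esub> Y s)"
  "c \<odot>\<^bsub>F p i\<^esub> X = (\<lambda>s\<in>{..<b p}. c \<odot>\<^bsub>ext_power V (i - int p)\<^esub> X s)"
  "act (free_module V (b p) (int p)) j i e X = (\<lambda>s\<in>{..<b p}. e \<otimes>\<^bsub>ext_algebra V\<^esub> X s)"
  by (simp_all add: free_module_def)

lemma GG_in: "x \<in> GG p j \<Longrightarrow> x s \<in> \<Lambda> j"
  unfolding GG_def by (cases "s < b p") (use \<Lambda>_zero in force)+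

lemma GG_out: "x \<in> GG p j \<Longrightarrow> \<not> s < b p \<Longrightarrow> x s = (\<lambda>_. 0)"
  by (simp add: GG_def)

lemma GG_FA: "x \<in> GG p j \<Longrightarrow> x s \<in> FA"
  by (rule \<Lambda>_FA) (rule GG_in)

lemma \<Psi>_in: "x \<in> GG p j \<Longrightarrow> \<Psi> p x \<in> carrier (F p (int (p + j)))"
  by (auto simp: F_simps \<Psi>_def carrier_ext_power GG_in)

lemma \<Phi>_in: "X \<in> carrier (F p (int (p + j))) \<Longrightarrow> \<Phi> p X \<in> GG p j"
  by (auto simp: F_simps \<Phi>_def GG_def rep_in PiE_def Pi_def)

lemma \<Phi>_\<Psi>: "x \<in> GG p j \<Longrightarrow> \<Phi> p (\<Psi> p x) = x"
  by (auto simp: \<Phi>_def \<Psi>_def fun_eq_iff GG_out rep_\<Lambda>[OF GG_in])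

lemma \<Psi>_\<Phi>:
  assumes "X \<in> carrier (F p (int (p + j)))"
  shows "\<Psi> p (\<Phi> p X) = X"
proof
  fix s show "\<Psi> p (\<Phi> p X) s = X s"
    using assms ext_class_rep[of "X s" j] by (auto simp: F_simps \<Phi>_def \<Psi>_def PiE_def Pi_def extensional_def)
qed

lemma \<Psi>_zero: "\<Psi> p 0 = \<zero>\<^bsub>F p i\<^esub>"
  by (auto simp: \<Psi>_def F_simps ext_class_zero zero_fun_def fun_eq_iff)

lemma \<Psi>_add: "x \<in> GG p j \<Longrightarrow> y \<in> GG p j \<Longrightarrow> \<Psi> p (x + y) = \<Psi> p x \<oplus>\<^bsub>F p i\<^esub> \<Psi> p y"
  by (auto simp: \<Psi>_def F_simps plus_fun_def fun_eq_iff ext_class_add GG_FA)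

lemma \<Psi>_scale: "x \<in> GG p j \<Longrightarrow> \<Psi> p (\<lambda>s w. c * x s w) = c \<odot>\<^bsub>F p i\<^esub> \<Psi> p x"
  by (auto simp: \<Psi>_def F_simps fun_eq_iff ext_power_smult GG_FA)

lemma \<Psi>_ext_mult: "v \<in> carrier V \<Longrightarrow> x \<in> GG p j \<Longrightarrow>
    \<Psi> p (\<lambda>s. ext_mult v (x s)) = act (free_module V (b p) (int p)) k i (ext_class V (word [v])) (\<Psi> p x)"
  by (auto simp: \<Psi>_def F_simps fun_eq_iff ext_class_mult GG_FA ext_mult_def ext_class_red)

lemma GG_zero: "0 \<in> GG p j"
  by (simp add: GG_def zero_fun_def)

lemma GG_add: "x \<in> GG p j \<Longrightarrow> y \<in> GG p j \<Longrightarrow> x + y \<in> GG p j"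
  by (auto simp: GG_def plus_fun_def \<Lambda>_add)

lemma GG_diff: "x \<in> GG p j \<Longrightarrow> y \<in> GG p j \<Longrightarrow> x - y \<in> GG p j"
  by (auto simp: GG_def fun_diff_def \<Lambda>_diff)

lemma ext_mult_zero [simp]: "ext_mult v (\<lambda>_. 0) = (\<lambda>_. 0)"
  by (simp add: ext_mult_def)

lemma ext_contract_zero [simp]: "ext_contract \<phi> (\<lambda>_. 0) = (\<lambda>_. 0)"
  by (simp add: ext_contract_def)

lemma GG_ext_mult: "v \<in> carrier V \<Longrightarrow> x \<in> GG p j \<Longrightarrow> (\<lambda>s. ext_mult v (x s)) \<in> GG p (Suc j)"
  by (auto simp: GG_def ext_mult_\<Lambda>)

lemma GG_ext_contract: "\<phi> \<in> carrier (dual_space V) \<Longrightarrow> x \<in> GG p (Suc j) \<Longrightarrow> (\<lambda>s. ext_contract \<phi> (x s)) \<in> GG p j"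
  by (auto simp: GG_def ext_contract_\<Lambda>)

lemma d_in: "x \<in> GG (Suc p) j \<Longrightarrow> d p (int (Suc p + j)) (\<Psi> (Suc p) x) \<in> carrier (F p (int (p + Suc j)))"
  using \<Psi>_in[of x "Suc p" j] d_hom[of p] by (auto simp: graded_hom_def linear_maps_def)

lemma D_in: "x \<in> GG (Suc p) j \<Longrightarrow> D p j x \<in> GG p (Suc j)"
  unfolding D_def by (rule \<Phi>_in) (rule d_in)

lemma \<Psi>_D: "x \<in> GG (Suc p) j \<Longrightarrow> \<Psi> p (D p j x) = d p (int (Suc p + j)) (\<Psi> (Suc p) x)"
  unfolding D_def by (rule \<Psi>_\<Phi>) (rule d_in)

lemma \<Psi>_inject: "x \<in> GG p j \<Longrightarrow> y \<in> GG p j \<Longrightarrow> \<Psi> p x = \<Psi> p y \<Longrightarrow> x = y"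
  using \<Phi>_\<Psi> by metis

lemma D_add:
  assumes x: "x \<in> GG (Suc p) j" and y: "y \<in> GG (Suc p) j"
  shows "D p j (x + y) = D p j x + D p j y"
proof (rule \<Psi>_inject)
  let ?i = "int (Suc p + j)"
  have "\<Psi> p (D p j (x + y)) = d p ?i (\<Psi> (Suc p) x \<oplus>\<^bsub>F (Suc p) ?i\<^esub> \<Psi> (Suc p) y)"
    by (simp only: \<Psi>_D[OF GG_add[OF x y]] \<Psi>_add[OF x y, of ?i])
  also have "\<dots> = d p ?i (\<Psi> (Suc p) x) \<oplus>\<^bsub>F p ?i\<^esub> d p ?i (\<Psi> (Suc p) y)"
    using d_hom[of p] \<Psi>_in[OF x] \<Psi>_in[OF y] unfolding graded_hom_def linear_maps_def by blast
  also have "\<dots> = \<Psi> p (D p j x + D p j y)"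
    by (simp only: \<Psi>_D[OF x, symmetric] \<Psi>_D[OF y, symmetric] \<Psi>_add[OF D_in[OF x] D_in[OF y], of ?i])
  finally show "\<Psi> p (D p j (x + y)) = \<Psi> p (D p j x + D p j y)" .
qed (use x y in \<open>auto intro: D_in GG_add\<close>)

lemma D_ext_mult:
  assumes v: "v \<in> carrier V" and x: "x \<in> GG (Suc p) j"
  shows "D p (Suc j) (\<lambda>s. ext_mult v (x s)) = (\<lambda>s. ext_mult v (D p j x s))"
proof (rule \<Psi>_inject)
  let ?i = "int (Suc p + j)" and ?v = "ext_class V (word [v])"
  have "\<Psi> p (D p (Suc j) (\<lambda>s. ext_mult v (x s))) =
      d p (?i + 1) (act (free_module V (b (Suc p)) (int (Suc p))) 1 ?i ?v (\<Psi> (Suc p) x))"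
    by (simp only: \<Psi>_D[OF GG_ext_mult[OF v x]] \<Psi>_ext_mult[OF v x, of 1 ?i]) (simp add: algebra_simps)
  also have "\<dots> = act (free_module V (b p) (int p)) 1 ?i ?v (d p ?i (\<Psi> (Suc p) x))"
    using d_hom[of p] \<Psi>_in[OF x] letter_in_ext_power[OF v] unfolding graded_hom_def by blast
  also have "\<dots> = \<Psi> p (\<lambda>s. ext_mult v (D p j x s))"
    by (simp only: \<Psi>_D[OF x, symmetric] \<Psi>_ext_mult[OF v D_in[OF x], of 1 ?i])
  finally show "\<Psi> p (D p (Suc j) (\<lambda>s. ext_mult v (x s))) = \<Psi> p (\<lambda>s. ext_mult v (D p j x s))" .
qed (use v x in \<open>auto intro: D_in GG_ext_mult\<close>)

lemma D_zero_iff: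
  assumes "x \<in> GG (Suc p) j"
  shows "D p j x = 0 \<longleftrightarrow> d p (int (Suc p + j)) (\<Psi> (Suc p) x) = \<zero>\<^bsub>F p (int (Suc p + j))\<^esub>"
  using \<Psi>_D[OF assms] \<Psi>_zero[of p "int (Suc p + j)"] \<Psi>_inject[OF D_in[OF assms] GG_zero] by metis

lemma \<Psi>_surj: "\<Psi> p ` GG p j = carrier (F p (int (p + j)))"
proof
  show "carrier (F p (int (p + j))) \<subseteq> \<Psi> p ` GG p j"
  proof
    fix X assume "X \<in> carrier (F p (int (p + j)))"
    then show "X \<in> \<Psi> p ` GG p j" using \<Psi>_\<Phi> \<Phi>_in by (intro image_eqI[of _ _ "\<Phi> p X"]) simp_all
  qed
qed (rule image_subsetI, rule \<Psi>_in)

lemma D_exact_iff: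
  assumes x: "x \<in> GG (Suc p) (Suc j)"
  shows "D p (Suc j) x = 0 \<longleftrightarrow> x \<in> D (Suc p) j ` GG (Suc (Suc p)) j"
proof -
  let ?i = "int (Suc p + Suc j)"
  have i: "?i = int (Suc (Suc p) + j)" by simp
  have "D p (Suc j) x = 0 \<longleftrightarrow> \<Psi> (Suc p) x \<in> d (Suc p) ?i ` carrier (F (Suc (Suc p)) ?i)"
    unfolding d_exact using D_zero_iff[OF x] \<Psi>_in[OF x] by simp
  also have "\<dots> \<longleftrightarrow> \<Psi> (Suc p) x \<in> \<Psi> (Suc p) ` D (Suc p) j ` GG (Suc (Suc p)) j"
    unfolding i \<Psi>_surj[symmetric] image_image by (simp add: \<Psi>_D cong: image_cong_simp)
  also have "\<dots> \<longleftrightarrow> x \<in> D (Suc p) j ` GG (Suc (Suc p)) j"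
    using \<Psi>_inject[OF x] D_in[of _ "Suc p" j] by blast
  finally show ?thesis .
qed

lemma eps_in: "x \<in> GG 0 j \<Longrightarrow> eps j x \<in> carrier (component Mg (int j))"
  using \<Psi>_in[of x 0 j] \<epsilon>_surj[of "int j"] by (auto simp: eps_def)

lemma eps_surj: "eps j ` GG 0 j = carrier (component Mg (int j))"
proof -
  have "eps j ` GG 0 j = \<epsilon> (int j) ` \<Psi> 0 ` GG 0 j"
    unfolding eps_def image_image ..
  then show ?thesis using \<Psi>_surj[of 0 j] \<epsilon>_surj[of "int j"] by simp
qed

lemma eps_add: "x \<in> GG 0 j \<Longrightarrow> y \<in> GG 0 j \<Longrightarrow> eps j (x + y) = (\<lambda>h. eps j x h + eps j y h)"
  using \<epsilon>_hom \<Psi>_in[of x 0 j] \<Psi>_in[of y 0 j] \<Psi>_add[of x 0 j y "int j"]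
  by (simp add: eps_def graded_hom_def linear_maps_def Mg_add)

lemma eps_scale: "x \<in> GG 0 j \<Longrightarrow> eps j (\<lambda>s w. c * x s w) = (\<lambda>h. c * eps j x h)"
  using \<epsilon>_hom \<Psi>_in[of x 0 j] \<Psi>_scale[of x 0 j c "int j"]
  by (simp add: eps_def graded_hom_def linear_maps_def Mg_smult)

lemma eps_ext_mult:
  assumes v: "v \<in> carrier V" and x: "x \<in> GG 0 j"
  shows "eps (Suc j) (\<lambda>s. ext_mult v (x s)) = act Mg 1 (int j) (ext_class V (word [v])) (eps j x)"
proof -
  have "\<epsilon> (int j + 1) (act (free_module V (b 0) 0) 1 (int j) (ext_class V (word [v])) (\<Psi> 0 x)) =
      act Mg 1 (int j) (ext_class V (word [v])) (\<epsilon> (int j) (\<Psi> 0 x))"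
    using \<epsilon>_hom \<Psi>_in[OF x] letter_in_ext_power[OF v] by (simp add: graded_hom_def)
  then show ?thesis
    using \<Psi>_ext_mult[OF v x, of 1 "int j"] by (simp add: eps_def add.commute)
qed

lemma eps_exact_iff:
  assumes x: "x \<in> GG 0 (Suc j)"
  shows "eps (Suc j) x = (\<lambda>_. 0) \<longleftrightarrow> x \<in> D 0 j ` GG (Suc 0) j"
proof -
  let ?i = "int (0 + Suc j)"
  have i: "?i = int (Suc 0 + j)" by simp
  have "eps (Suc j) x = (\<lambda>_. 0) \<longleftrightarrow> \<Psi> 0 x \<in> d 0 ?i ` carrier (F (Suc 0) ?i)"
    using \<epsilon>_exact[of ?i] \<Psi>_in[OF x] by (simp add: eps_def Mg_zero)
  also have "\<dots> \<longleftrightarrow> \<Psi> 0 x \<in> \<Psi> 0 ` D 0 j ` GG (Suc 0) j"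
    unfolding i \<Psi>_surj[symmetric] image_image by (simp add: \<Psi>_D cong: image_cong_simp)
  also have "\<dots> \<longleftrightarrow> x \<in> D 0 j ` GG (Suc 0) j"
    using \<Psi>_inject[OF x] D_in[of _ 0 j] by blast
  finally show ?thesis .
qed

text \<open>The next module of the resolution is generated in degree 1 and vanishes in degree 0, so
  there are no relations in that degree.\<close>

lemma eps_0_injective:
  assumes x: "x \<in> GG 0 0" "eps 0 x = (\<lambda>_. 0)"
  shows "x = 0"
proof -
  have "\<Psi> 0 x \<in> d 0 0 ` carrier (F (Suc 0) 0)"
    using \<epsilon>_exact[of 0] \<Psi>_in[OF x(1)] x(2) by (simp add: eps_def Mg_zero)
  then obtain X where X: "X \<in> carrier (F (Suc 0) 0)" "\<Psi> 0 x = d 0 0 X" by auto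
  have X': "X \<in> {..<b (Suc 0)} \<rightarrow>\<^sub>E carrier (ext_power V (0 - int (Suc 0)))"
    using X(1) by (simp only: F_simps)
  have "carrier (ext_power V (0 - int (Suc 0))) = {\<zero>\<^bsub>ext_algebra V\<^esub>}"
    by (rule carrier_ext_power_negative) simp
  then have "X s = \<zero>\<^bsub>F (Suc 0) 0\<^esub> s" for s
    using PiE_mem[OF X', of s] PiE_arb[OF X', of s] unfolding F_simps by (cases "s < b (Suc 0)") auto
  then have "X = \<zero>\<^bsub>F (Suc 0) 0\<^esub>" by auto
  moreover have "d 0 0 \<zero>\<^bsub>F (Suc 0) 0\<^esub> = \<zero>\<^bsub>F 0 0\<^esub>"
  proof -
    have c: "\<zero>\<^bsub>F (Suc 0) 0\<^esub> \<in> carrier (F (Suc 0) 0)"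
      using X(1) calculation by simp
    have z: "0 \<odot>\<^bsub>ext_power V i\<^esub> \<zero>\<^bsub>ext_algebra V\<^esub> = \<zero>\<^bsub>ext_algebra V\<^esub>" for i
      by (simp add: ext_class_zero ext_power_smult)
    have "0 \<odot>\<^bsub>F (Suc 0) 0\<^esub> \<zero>\<^bsub>F (Suc 0) 0\<^esub> = \<zero>\<^bsub>F (Suc 0) 0\<^esub>"
      unfolding F_simps by (rule ext) (simp add: z restrict_def)
    moreover have "d 0 0 (0 \<odot>\<^bsub>F (Suc 0) 0\<^esub> \<zero>\<^bsub>F (Suc 0) 0\<^esub>) = 0 \<odot>\<^bsub>F 0 0\<^esub> d 0 0 \<zero>\<^bsub>F (Suc 0) 0\<^esub>"
      "d 0 0 \<zero>\<^bsub>F (Suc 0) 0\<^esub> \<in> carrier (F 0 0)"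
      using d_hom[of 0] c unfolding graded_hom_def linear_maps_def by auto
    moreover have "0 \<odot>\<^bsub>F 0 0\<^esub> Y = \<zero>\<^bsub>F 0 0\<^esub>" if Y: "Y \<in> carrier (F 0 0)" for Y
    proof -
      have "Y = \<Psi> 0 (\<Phi> 0 Y)" "\<Phi> 0 Y \<in> GG 0 0"
        using \<Psi>_\<Phi>[of Y 0 0] \<Phi>_in[of Y 0 0] Y by simp_all
      then show ?thesis
        using \<Psi>_scale[of "\<Phi> 0 Y" 0 0 0 0] \<Psi>_zero[of 0 0] by (simp add: zero_fun_def)
    qed
    ultimately show ?thesis by simp
  qed
  ultimately have "\<Psi> 0 x = \<Psi> 0 0" using X(2) \<Psi>_zero[of 0 0] by simp
  then show ?thesis using \<Psi>_inject[OF x(1) GG_zero] by simp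
qed

end

section \<open>Finite-dimensionality in degree one\<close>

context exterior
begin

text \<open>The vectors on which both sides agree form a submodule containing the basis. The values
  are functions so that the lemma covers multiplication in the exterior algebra as well as the
  action on \<open>Mg\<close>.\<close>

lemma dual_basis_expansion:
  fixes f :: "'v \<Rightarrow> 'z \<Rightarrow> 'k" and m :: nat
  assumes ev: "\<And>l. l < m \<Longrightarrow> ev l \<in> carrier V" and \<phi>: "\<And>l. l < m \<Longrightarrow> \<phi> l \<in> carrier (dual_space V)"
    and \<delta>: "\<And>l k. l < m \<Longrightarrow> k < m \<Longrightarrow> \<phi> l (ev k) = (if l = k then 1 else 0)"
    and gen: "\<And>N. submodule N scalars V \<Longrightarrow> ev ` {..<m} \<subseteq> N \<Longrightarrow> N = carrier V"
    and f: "\<And>v w. v \<in> carrier V \<Longrightarrow> w \<in> carrier V \<Longrightarrow> f (v \<oplus>\<^bsub>V\<^esub> w) = (\<lambda>z. f v z + f w z)"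
      "\<And>c v. v \<in> carrier V \<Longrightarrow> f (c \<odot>\<^bsub>V\<^esub> v) = (\<lambda>z. c * f v z)"
    and v: "v \<in> carrier V"
  shows "f v = (\<lambda>z. \<Sum>l<m. \<phi> l v * f (ev l) z)"
proof -
  define N where "N = {v \<in> carrier V. f v = (\<lambda>z. \<Sum>l<m. \<phi> l v * f (ev l) z)}"
  have \<phi>_add: "\<phi> l (v \<oplus>\<^bsub>V\<^esub> w) = \<phi> l v + \<phi> l w" if "l < m" "v \<in> carrier V" "w \<in> carrier V" for l v w
    using \<phi>[OF that(1)] that by (auto simp: dual_space_iff)
  have \<phi>_smult: "\<phi> l (c \<odot>\<^bsub>V\<^esub> v) = c * \<phi> l v" if "l < m" "v \<in> carrier V" for l v c
    using \<phi>[OF that(1)] that by (auto simp: dual_space_iff)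
  have "submodule N scalars V"
    unfolding submodule_iff[OF module_axioms]
  proof (intro conjI ballI allI)
    show "N \<subseteq> carrier V" by (auto simp: N_def)
    have "f \<zero>\<^bsub>V\<^esub> = (\<lambda>z. 0)" using f(2)[of "\<zero>\<^bsub>V\<^esub>" 0] by simp
    moreover have "\<phi> l \<zero>\<^bsub>V\<^esub> = 0" if "l < m" for l
      using \<phi>_smult[OF that, of "\<zero>\<^bsub>V\<^esub>" 0] by simp
    ultimately show "\<zero>\<^bsub>V\<^esub> \<in> N" by (simp add: N_def)
  next
    fix v w assume "v \<in> N" "w \<in> N"
    then show "v \<oplus>\<^bsub>V\<^esub> w \<in> N" by (simp add: N_def f \<phi>_add algebra_simps sum.distrib)
  next
    fix c v assume "v \<in> N"
    then show "c \<odot>\<^bsub>V\<^esub> v \<in> N"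
      by (auto simp add: N_def f \<phi>_smult sum_distrib_left mult.assoc)
  qed
  moreover have "ev ` {..<m} \<subseteq> N"
  proof
    fix u assume "u \<in> ev ` {..<m}"
    then obtain k where k: "k < m" "u = ev k" by auto
    have "(\<Sum>l<m. \<phi> l (ev k) * f (ev l) z) = (\<Sum>l<m. if l = k then f (ev l) z else 0)" for z
      using k by (intro sum.cong) (auto simp: \<delta>)
    then show "u \<in> N" using k ev by (simp add: N_def)
  qed
  ultimately have "N = carrier V" by (rule gen)
  then show ?thesis using v unfolding N_def by blast
qed

end

context linear_free_resolution
begin

section \<open>The matrix of a differential\<close>

definition unit_vector :: "nat \<Rightarrow> ('v list \<Rightarrow> 'k) \<Rightarrow> nat \<Rightarrow> 'v list \<Rightarrow> 'k" where
  "unit_vector s y = (\<lambda>t. if t = s then y else (\<lambda>_. 0))"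

lemma unit_vector_in: "s < b p \<Longrightarrow> y \<in> \<Lambda> j \<Longrightarrow> unit_vector s y \<in> GG p j"
  by (auto simp: unit_vector_def GG_def)

lemma GG_sum: "(\<And>i. i \<in> S \<Longrightarrow> f i \<in> GG p j) \<Longrightarrow> sum f S \<in> GG p j"
  by (induction S rule: infinite_finite_induct) (simp_all add: GG_zero GG_add)

lemma D_0: "D p j 0 = 0"
  using D_add[OF GG_zero GG_zero, of p j] by simp

lemma D_sum: "(\<And>i. i \<in> S \<Longrightarrow> f i \<in> GG (Suc p) j) \<Longrightarrow> D p j (sum f S) = (\<Sum>i\<in>S. D p j (f i))"
  by (induction S rule: infinite_finite_induct) (simp_all add: D_0 D_add GG_sum)

lemma sum_fun_apply: "(\<Sum>i\<in>S. f i) x = (\<Sum>i\<in>S. f i x :: 'z::ab_group_add)"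
  by (induction S rule: infinite_finite_induct) simp_all

lemma unit_vector_expansion: "w \<in> GG p j \<Longrightarrow> w = (\<Sum>s<b p. unit_vector s (w s))"
proof
  fix t assume w: "w \<in> GG p j"
  have "(\<Sum>s<b p. unit_vector s (w s)) t = (\<Sum>s<b p. if t = s then w s else 0)"
    unfolding sum_fun_apply[of _ _ t] by (intro sum.cong) (auto simp: unit_vector_def zero_fun_def)
  then show "w t = (\<Sum>s<b p. unit_vector s (w s)) t"
    using w by (auto simp: GG_out zero_fun_def)
qed

text \<open>The differential is linear for multiplication from the left, so the coefficient
  \<open>y\<close> stands to the left of the image of the generator.\<close>

lemma D_unit_vector:
  assumes s: "s < b (Suc p)" and y: "y \<in> \<Lambda> j"
  shows "D p j (unit_vector s y) t = red (conv y (D p 0 (unit_vector s (red (word []))) t))"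
proof -
  let ?i = "int (Suc p)" and ?u = "unit_vector s (red (word []))"
  have u: "?u \<in> GG (Suc p) 0" by (rule unit_vector_in[OF s red_unit_\<Lambda>])
  have yFA: "y \<in> FA" using y by (rule \<Lambda>_FA)
  have Y: "ext_class V y \<in> carrier (ext_power V (int j))" using y by (simp add: carrier_ext_power)
  let ?z = "\<lambda>t. red (conv y (D p 0 ?u t))"
  have zFA: "D p 0 ?u t \<in> FA" for t by (rule GG_FA[OF D_in[OF u]])
  have dyu: "unit_vector s y \<in> GG (Suc p) j" by (rule unit_vector_in[OF s y])
  have "conv y (red (word [])) \<in> FA" using yFA by simp
  moreover have "red (conv y (red (word []))) = y"
    using yFA red_conv_right[of y "word []"] red_\<Lambda>[OF y] by simp
  ultimately have "ext_class V (conv y (red (word []))) = ext_class V y"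
    using yFA red_\<Lambda>[OF y] by (simp add: ext_class_eq_iff)
  then have "\<Psi> (Suc p) (unit_vector s y) = act (free_module V (b (Suc p)) (int (Suc p))) (int j) ?i (ext_class V y) (\<Psi> (Suc p) ?u)"
    unfolding F_simps \<Psi>_def
    by (intro ext) (simp add: ext_class_mult yFA GG_FA[OF u], simp add: unit_vector_def)
  moreover have "?i + int j = int (Suc p + j)" by simp
  moreover have "d p (?i + int j) (act (free_module V (b (Suc p)) (int (Suc p))) (int j) ?i (ext_class V y) (\<Psi> (Suc p) ?u)) =
      act (free_module V (b p) (int p)) (int j) ?i (ext_class V y) (d p ?i (\<Psi> (Suc p) ?u))"
    using d_hom[of p] Y \<Psi>_in[OF u] unfolding graded_hom_def by simp
  moreover have "d p ?i (\<Psi> (Suc p) ?u) = \<Psi> p (D p 0 ?u)" using \<Psi>_D[OF u] by simp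
  ultimately have "D p j (unit_vector s y) =
      \<Phi> p (act (free_module V (b p) (int p)) (int j) ?i (ext_class V y) (\<Psi> p (D p 0 ?u)))"
    by (simp only: D_def)
  then have *: "D p j (unit_vector s y) = (\<lambda>t. if t < b p then red (conv y (D p 0 ?u t)) else (\<lambda>_. 0))"
    unfolding F_simps \<Phi>_def \<Psi>_def
    by (intro ext) (simp add: ext_class_mult yFA zFA rep_ext_class)
  show ?thesis
    unfolding * using GG_out[OF D_in[OF u], of t] by (auto simp: )
qed

lemma D_matrix:
  assumes w: "w \<in> GG (Suc p) j"
  shows "D p j w t = (\<Sum>s<b (Suc p). red (conv (w s) (D p 0 (unit_vector s (red (word []))) t)))"
proof -
  have "D p j w = (\<Sum>s<b (Suc p). D p j (unit_vector s (w s)))"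
    using unit_vector_expansion[OF w] D_sum[of "{..<b (Suc p)}" "\<lambda>s. unit_vector s (w s)" p j]
      unit_vector_in GG_in[OF w] by simp
  then show ?thesis
    by (simp add: sum_fun_apply D_unit_vector[OF _ GG_in[OF w]])
qed

lemma ext_contract_sum:
  assumes "\<And>i. i \<in> S \<Longrightarrow> f i \<in> FA"
  shows "sum f S \<in> FA \<and> ext_contract \<phi> (sum f S) = (\<Sum>i\<in>S. ext_contract \<phi> (f i))"
proof -
  have 0: "0 \<in> FA" "ext_contract \<phi> 0 = 0" by (simp_all only: zero_fun_def FA_zero ext_contract_zero)
  have add: "x + y \<in> FA" "ext_contract \<phi> (x + y) = ext_contract \<phi> x + ext_contract \<phi> y" if "x \<in> FA" "y \<in> FA" for x y
    unfolding plus_fun_def using that by (simp_all only: FA_add ext_contract_add)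
  show ?thesis
    using assms by (induction S rule: infinite_finite_induct) (simp_all add: 0 add)
qed

text \<open>When contraction kills the matrix entries, \<open>ext_contract_conv\<close> lets it pass
  to the coefficients alone. In internal degree 0 these are scalars and contract to 0.\<close>

lemma ext_contract_D:
  assumes \<phi>: "\<phi> \<in> carrier (dual_space V)" and w: "w \<in> GG (Suc p) j"
    and z: "\<And>s t. s < b (Suc p) \<Longrightarrow> ext_contract \<phi> (D p 0 (unit_vector s (red (word []))) t) = (\<lambda>_. 0)"
  shows "j = 0 \<Longrightarrow> ext_contract \<phi> (D p j w t) = (\<lambda>_. 0)"
    "j = Suc i \<Longrightarrow> ext_contract \<phi> (D p j w t) = D p i (\<lambda>s. ext_contract \<phi> (w s)) t"
proof -
  let ?z = "\<lambda>s. D p 0 (unit_vector s (red (word []))) t"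
  have zFA: "s < b (Suc p) \<Longrightarrow> ?z s \<in> FA" for s
    by (rule GG_FA[OF D_in[OF unit_vector_in[OF _ red_unit_\<Lambda>]]])
  have "ext_contract \<phi> (D p j w t) = (\<Sum>s<b (Suc p). ext_contract \<phi> (red (conv (w s) (?z s))))"
    unfolding D_matrix[OF w] using zFA GG_FA[OF w] by (intro conjunct2[OF ext_contract_sum]) auto
  also have "\<dots> = (\<Sum>s<b (Suc p). red (conv (ext_contract \<phi> (w s)) (?z s)))"
    using zFA GG_FA[OF w] z \<phi> by (intro sum.cong refl ext_contract_conv) auto
  finally have eq: "ext_contract \<phi> (D p j w t) = (\<Sum>s<b (Suc p). red (conv (ext_contract \<phi> (w s)) (?z s)))" .
  show "ext_contract \<phi> (D p j w t) = (\<lambda>_. 0)" if "j = 0"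
  proof -
    have "red (conv (ext_contract \<phi> (w s)) (?z s)) = 0" for s
      using ext_contract_\<Lambda>_0[OF \<phi>, of "w s"] GG_in[OF w, of s] that by (simp add: zero_fun_def)
    then have "ext_contract \<phi> (D p j w t) = 0" unfolding eq by (simp only: sum.neutral_const)
    then show ?thesis by (simp only: zero_fun_def)
  qed
  show "ext_contract \<phi> (D p j w t) = D p i (\<lambda>s. ext_contract \<phi> (w s)) t" if "j = Suc i"
    unfolding eq using D_matrix[OF GG_ext_contract[OF \<phi>, of w "Suc p" i]] w that by simp
qed

text \<open>For all but finitely many basis vectors \<open>\<beta>\<close> of \<open>V\<close>, contraction with \<open>\<phi> \<beta>\<close> commutes with the
  matrix of the first differential. Multiplying a generator by \<open>n + 1\<close> of these \<open>\<beta>\<close> gives an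
  element of the free module that is not a relation, although it has too large a degree.\<close>

lemma finite_dual_basis:
  assumes B: "B \<subseteq> carrier V" "\<And>\<beta>. \<beta> \<in> B \<Longrightarrow> \<phi> \<beta> \<in> carrier (dual_space V)"
    "\<And>\<beta> \<beta>'. \<beta> \<in> B \<Longrightarrow> \<beta>' \<in> B \<Longrightarrow> \<phi> \<beta> \<beta>' = (if \<beta> = \<beta>' then 1 else 0)"
    "\<And>v. v \<in> carrier V \<Longrightarrow> finite {\<beta> \<in> B. \<phi> \<beta> v \<noteq> 0}"
    and b0: "b 0 > 0" and unit: "red (word []) \<noteq> (\<lambda>_. 0)"
    and top: "carrier (component Mg (int n)) = {\<lambda>_. 0}"
  shows "finite B"
proof (rule ccontr)
  assume inf: "infinite B"
  define z where "z s t = D 0 0 (unit_vector s (red (word []))) t" for s t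
  \<comment> \<open>There are finitely many matrix entries, and by
    \<open>ext_contract_finite\<close> only finitely many basis vectors contract one of them to
    something nonzero.\<close>
  define B0 where "B0 = (\<Union>s<b 1. \<Union>t<b 0. {\<beta> \<in> B. contract (\<phi> \<beta>) (z s t) \<noteq> (\<lambda>_. 0)})"
  have uGG: "s < b 1 \<Longrightarrow> unit_vector s (red (word [])) \<in> GG (Suc 0) 0" for s
    using unit_vector_in[of s "Suc 0" _ 0, OF _ red_unit_\<Lambda>] by simp
  have "finite B0"
    unfolding B0_def
    by (intro finite_UN_I finite_lessThan ext_contract_finite B)
       (use GG_FA[OF D_in[OF uGG]] in \<open>auto simp: z_def\<close>)
  have z0: "ext_contract (\<phi> \<beta>) (z s t) = (\<lambda>_. 0)" if "\<beta> \<in> B - B0" "s < b (Suc 0)" for \<beta> s t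
  proof (cases "t < b 0")
    case True
    then have "contract (\<phi> \<beta>) (z s t) = (\<lambda>_. 0)" using that by (auto simp: B0_def)
    then show ?thesis by (simp add: ext_contract_def)
  next
    case False
    then show ?thesis using GG_out[OF D_in[OF uGG], of s t] that(2) by (simp add: z_def)
  qed
  \<comment> \<open>The relations in degree k of the zeroth module; degree 0 has only 0, as the next
    module starts in degree 1.\<close>
  define Im where "Im k = (case k of 0 \<Rightarrow> {0} | Suc i \<Rightarrow> D 0 i ` GG (Suc 0) i)" for k
  \<comment> \<open>\<open>C\<close> collects the basis vectors already spent. Contraction with the
    others outside \<open>B0\<close> still kills \<open>x\<close>, which permits one more
    multiplication.\<close>
  have "\<exists>x\<in>GG 0 k. \<exists>C. finite C \<and> (\<forall>\<beta>\<in>B - B0 - C. \<forall>t. ext_contract (\<phi> \<beta>) (x t) = (\<lambda>_. 0)) \<and> x \<notin> Im k" for k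
  proof (induction k)
    case 0
    let ?x = "unit_vector 0 (red (word []))"
    have x: "?x \<in> GG 0 0" by (rule unit_vector_in[OF b0 red_unit_\<Lambda>])
    have "?x 0 \<noteq> 0 0" using unit by (simp add: unit_vector_def zero_fun_def)
    then have "?x \<noteq> 0" by auto
    moreover have "ext_contract (\<phi> \<beta>) (?x t) = (\<lambda>_. 0)" if "\<beta> \<in> B" for \<beta> t
      using ext_contract_\<Lambda>_0[OF B(2)[OF that]] GG_in[OF x] by simp
    ultimately show ?case using x by (intro bexI[OF _ x] exI[of _ "{}"]) (auto simp: Im_def)
  next
    case (Suc k)
    then obtain x C where x: "x \<in> GG 0 k" "finite C" "x \<notin> Im k"
      and xC: "\<And>\<beta> t. \<beta> \<in> B - B0 - C \<Longrightarrow> ext_contract (\<phi> \<beta>) (x t) = (\<lambda>_. 0)" by metis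
    have "infinite (B - B0 - C)" using inf \<open>finite B0\<close> x(2) by simp
    then obtain \<beta> where \<beta>: "\<beta> \<in> B - B0 - C" using infinite_imp_nonempty by blast
    then have \<beta>V: "\<beta> \<in> carrier V" "\<phi> \<beta> \<in> carrier (dual_space V)" using B by auto
    define x' where "x' = (\<lambda>t. ext_mult \<beta> (x t))"
    have x': "x' \<in> GG 0 (Suc k)" unfolding x'_def by (rule GG_ext_mult[OF \<beta>V(1) x(1)])
    have co': "ext_contract (\<phi> \<gamma>) (x' t) = (\<lambda>_. 0)" if "\<gamma> \<in> B - B0 - insert \<beta> C" for \<gamma> t
      using ext_contract_ext_mult[OF B(2) \<beta>V(1) GG_in[OF x(1)], of \<gamma> t] that \<beta> B(3)[of \<gamma> \<beta>] xC[of \<gamma> t] by (simp add: x'_def)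
    have ext_contract\<beta>: "ext_contract (\<phi> \<beta>) (x' t) = x t" for t
      using ext_contract_ext_mult[OF \<beta>V(2,1) GG_in[OF x(1)], of t] \<beta> B(3)[of \<beta> \<beta>] xC[OF \<beta>, of t] by (simp add: x'_def)
    \<comment> \<open>Contraction with \<beta> undoes the multiplication and commutes with the
      differential, so a relation \<open>x'\<close> would make \<open>x\<close> a relation.\<close>
    have "x' \<notin> Im (Suc k)"
    proof
      assume "x' \<in> Im (Suc k)"
      then obtain w where w: "w \<in> GG (Suc 0) k" "x' = D 0 k w" by (auto simp: Im_def)
      have zz: "ext_contract (\<phi> \<beta>) (D 0 0 (unit_vector s (red (word []))) t) = (\<lambda>_. 0)" if "s < b (Suc 0)" for s t
        using z0[of \<beta> s t] \<beta> that by (simp add: z_def)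
      show False
      proof (cases k)
        case 0
        have "x t = (\<lambda>_. 0)" for t
          using ext_contract_D(1)[OF \<beta>V(2) w(1) zz 0, of t] ext_contract\<beta>[of t] w(2) by simp
        then show False using x(3) 0 by (auto simp: Im_def zero_fun_def fun_eq_iff)
      next
        case (Suc i)
        have "x = D 0 i (\<lambda>s. ext_contract (\<phi> \<beta>) (w s))"
          using ext_contract_D(2)[OF \<beta>V(2) w(1) zz Suc] ext_contract\<beta> w(2) by (intro ext[of x]) metis
        moreover have "(\<lambda>s. ext_contract (\<phi> \<beta>) (w s)) \<in> GG (Suc 0) i"
          using GG_ext_contract[OF \<beta>V(2), of w] w(1) Suc by simp
        ultimately show False using x(3) Suc by (auto simp: Im_def)
      qed
    qed
    moreover have "finite (insert \<beta> C)" using x(2) by simp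
    moreover have "\<forall>\<gamma>\<in>B - B0 - insert \<beta> C. \<forall>t. ext_contract (\<phi> \<gamma>) (x' t) = (\<lambda>_. 0)"
      by (intro ballI allI) (rule co')
    ultimately show ?case using x' by blast
  qed
  then obtain x where x: "x \<in> GG 0 n" "x \<notin> Im n" by blast
  have "eps n x = (\<lambda>_. 0)" using eps_in[OF x(1)] top by simp
  then have "x \<in> Im n"
  proof (cases n)
    case 0
    then show ?thesis using eps_0_injective[of x] x(1) \<open>eps n x = (\<lambda>_. 0)\<close> by (simp add: Im_def)
  next
    case (Suc i)
    then show ?thesis using eps_exact_iff[of x i] x(1) \<open>eps n x = (\<lambda>_. 0)\<close> by (simp add: Im_def)
  qed
  then show False using x(2) by simp
qed

end

section \<open>Exactness for modules with a linear resolution\<close>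

context linear_free_resolution
begin

lemma Mg_closed:
  shows "f \<in> carrier (component Mg i) \<Longrightarrow> g \<in> carrier (component Mg i) \<Longrightarrow> (\<lambda>h. f h + g h) \<in> carrier (component Mg i)"
    and "f \<in> carrier (component Mg i) \<Longrightarrow> (\<lambda>h. c * f h) \<in> carrier (component Mg i)"
    and "(\<lambda>h. 0) \<in> carrier (component Mg i)"
proof -
  interpret N: scalar_module "component Mg i"
    using graded by (intro scalar_moduleI) (simp add: graded_ext_module_def)
  show "f \<in> carrier (component Mg i) \<Longrightarrow> g \<in> carrier (component Mg i) \<Longrightarrow> (\<lambda>h. f h + g h) \<in> carrier (component Mg i)"
    using N.a_closed[of f g] by (simp add: Mg_add)
  show "f \<in> carrier (component Mg i) \<Longrightarrow> (\<lambda>h. c * f h) \<in> carrier (component Mg i)"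
    using N.smult_in[of f c] by (simp add: Mg_smult)
  show "(\<lambda>h. 0) \<in> carrier (component Mg i)"
    using N.zero_closed by (simp add: Mg_zero)
qed

lemma graded_rules:
  "e \<in> carrier (ext_power V j) \<Longrightarrow> act Mg j i e \<in> linear_maps (component Mg i) (component Mg (i + j))"
  "e \<in> carrier (ext_power V j) \<Longrightarrow> e' \<in> carrier (ext_power V j) \<Longrightarrow> x \<in> carrier (component Mg i) \<Longrightarrow>
    act Mg j i (e \<oplus>\<^bsub>ext_algebra V\<^esub> e') x = act Mg j i e x \<oplus>\<^bsub>component Mg (i + j)\<^esub> act Mg j i e' x"
  "e \<in> carrier (ext_power V j) \<Longrightarrow> x \<in> carrier (component Mg i) \<Longrightarrow>
    act Mg j i (c \<odot>\<^bsub>ext_power V j\<^esub> e) x = c \<odot>\<^bsub>component Mg (i + j)\<^esub> act Mg j i e x"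
  "e \<in> carrier (ext_power V j) \<Longrightarrow> e' \<in> carrier (ext_power V l) \<Longrightarrow> x \<in> carrier (component Mg i) \<Longrightarrow>
    act Mg (j + l) i (e \<otimes>\<^bsub>ext_algebra V\<^esub> e') x = act Mg j (i + l) e (act Mg l i e' x)"
  using graded unfolding graded_ext_module_def by simp_all

lemma act_in:
  "X \<in> carrier (ext_power V j) \<Longrightarrow> x \<in> carrier (component Mg i) \<Longrightarrow> act Mg j i X x \<in> carrier (component Mg (i + j))"
  using graded_rules(1)[of X j i] by (auto simp: linear_maps_def)

lemma act_class_add:
  assumes "f \<in> FA" "g \<in> FA" "ext_class V f \<in> carrier (ext_power V j)" "ext_class V g \<in> carrier (ext_power V j)"
    "x \<in> carrier (component Mg i)"
  shows "act Mg j i (ext_class V (\<lambda>w. f w + g w)) x = (\<lambda>h. act Mg j i (ext_class V f) x h + act Mg j i (ext_class V g) x h)"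
  using graded_rules(2)[OF assms(3-5)] by (simp add: ext_class_add assms Mg_add)

lemma act_class_scale:
  assumes "f \<in> FA" "ext_class V f \<in> carrier (ext_power V j)" "x \<in> carrier (component Mg i)"
  shows "act Mg j i (ext_class V (\<lambda>w. c * f w)) x = (\<lambda>h. c * act Mg j i (ext_class V f) x h)"
  using graded_rules(3)[OF assms(2,3), of c] by (simp add: ext_power_smult assms Mg_smult)

lemma ext_class_in_power: "f \<in> hom_part j \<Longrightarrow> ext_class V f \<in> carrier (ext_power V (int j))"
  by (simp add: ext_power_def hom_part_def)

lemma act_class_zero:
  assumes "f \<in> FA" "red f = (\<lambda>_. 0)" "ext_class V f \<in> carrier (ext_power V j)" "x \<in> carrier (component Mg i)"
  shows "act Mg j i (ext_class V f) x = (\<lambda>_. 0)"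
proof -
  have "ext_class V (\<lambda>w. 0 * f w) = ext_class V f"
    using assms(1,2) by (simp add: ext_class_eq_iff)
  then show ?thesis using act_class_scale[OF assms(1,3,4), of 0] by simp
qed

lemma act_letters:
  assumes v: "v \<in> carrier V" "w \<in> carrier V" and x: "x \<in> carrier (component Mg i)"
  shows "act Mg 1 (i + 1) (ext_class V (word [v])) (act Mg 1 i (ext_class V (word [w])) x) =
      act Mg 2 i (ext_class V (word [v, w])) x"
proof -
  have "act Mg (1 + 1) i (ext_class V (word [v]) \<otimes>\<^bsub>ext_algebra V\<^esub> ext_class V (word [w])) x =
      act Mg 1 (i + 1) (ext_class V (word [v])) (act Mg 1 i (ext_class V (word [w])) x)"
    by (rule graded_rules(4)[OF letter_in_ext_power[OF v(1)] letter_in_ext_power[OF v(2)] x])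
  then show ?thesis using v by (simp add: ext_class_mult conv_letter_word)
qed

lemma two_letters_in_ext_power:
  "v \<in> carrier V \<Longrightarrow> w \<in> carrier V \<Longrightarrow> ext_class V (word [v, w]) \<in> carrier (ext_power V 2)"
  using ext_class_in_power[OF hom_part_word[of "[v, w]"]] by simp

lemma act_square:
  assumes "v \<in> carrier V" "x \<in> carrier (component Mg i)"
  shows "act Mg 1 (i + 1) (ext_class V (word [v])) (act Mg 1 i (ext_class V (word [v])) x) = (\<lambda>_. 0)"
  using assms by (simp add: act_letters act_class_zero red_I I_square two_letters_in_ext_power)

lemma act_anti:
  assumes v: "v \<in> carrier V" "w \<in> carrier V" and x: "x \<in> carrier (component Mg i)"
  shows "(\<lambda>h. act Mg 1 (i + 1) (ext_class V (word [v])) (act Mg 1 i (ext_class V (word [w])) x) h +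
      act Mg 1 (i + 1) (ext_class V (word [w])) (act Mg 1 i (ext_class V (word [v])) x) h) = (\<lambda>_. 0)"
proof -
  have "red (\<lambda>u. word [v, w] u + word [w, v] u) = (\<lambda>_. 0)"
    using ext_mult_anti[OF v, of "word []"] v by (simp add: ext_mult_ext_mult red_add)
  moreover have "ext_class V (\<lambda>u. word [v, w] u + word [w, v] u) \<in> carrier (ext_power V 2)"
    using ext_class_in_power[of _ 2] hom_part_word[of "[v, w]"] hom_part_word[of "[w, v]"] v
      hom_part_add[of "word [v, w]" 2 "word [w, v]"] by (simp add: numeral_2_eq_2)
  ultimately have "act Mg 2 i (ext_class V (\<lambda>u. word [v, w] u + word [w, v] u)) x = (\<lambda>_. 0)"
    using v x by (intro act_class_zero) auto
  then show ?thesis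
    using act_class_add[of "word [v, w]" "word [w, v]" 2 x i] v x
    by (simp add: act_letters two_letters_in_ext_power)
qed

lemma act_vector_add:
  assumes "v \<in> carrier V" "w \<in> carrier V" "x \<in> carrier (component Mg i)"
  shows "act Mg 1 i (ext_class V (word [v \<oplus>\<^bsub>V\<^esub> w])) x =
      (\<lambda>h. act Mg 1 i (ext_class V (word [v])) x h + act Mg 1 i (ext_class V (word [w])) x h)"
proof -
  have "ext_class V (word [v \<oplus>\<^bsub>V\<^esub> w]) = ext_class V (\<lambda>u. word [v] u + word [w] u)"
    using assms I_sum_relator[of v w] by (simp add: ext_class_eq_iff red_eq_iff algebra_simps)
  then show ?thesis
    using assms act_class_add[of "word [v]" "word [w]" 1 x i] letter_in_ext_power by simp
qed

lemma act_vector_scale: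
  assumes "v \<in> carrier V" "x \<in> carrier (component Mg i)"
  shows "act Mg 1 i (ext_class V (word [c \<odot>\<^bsub>V\<^esub> v])) x = (\<lambda>h. c * act Mg 1 i (ext_class V (word [v])) x h)"
proof -
  have "ext_class V (word [c \<odot>\<^bsub>V\<^esub> v]) = ext_class V (\<lambda>u. c * word [v] u)"
    using assms I_scale_relator[of v c] by (simp add: ext_class_eq_iff red_eq_iff)
  then show ?thesis
    using assms act_class_scale[of "word [v]" 1 x i c] letter_in_ext_power by simp
qed

text \<open>\<open>b0\<close>, \<open>unit\<close> and \<open>top\<close> serve to make the basis of
  V finite. Linearity of the action is assumed on all functions because
  \<open>resolved_module\<close> asks for linear operators on a whole type.\<close>

theorem module_exactness_propagates:
  fixes j :: nat
  assumes b0: "b 0 > 0" and unit: "red (word []) \<noteq> (\<lambda>_. 0)"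
    and top: "carrier (component Mg (int n)) = {\<lambda>_. 0}"
    and act_linear: "\<And>i X f g. act Mg 1 i X (\<lambda>h. f h + g h) = (\<lambda>h. act Mg 1 i X f h + act Mg 1 i X g h)"
      "\<And>i X c f. act Mg 1 i X (\<lambda>h. c * f h) = (\<lambda>h. c * act Mg 1 i X f h)"
    and a: "a \<in> carrier V"
    and exact: "\<And>x. x \<in> carrier (component Mg (int j)) \<Longrightarrow>
      act Mg 1 (int j) (ext_class V (word [a])) x = (\<lambda>_. 0) \<Longrightarrow>
      \<exists>y\<in>carrier (component Mg (int j - 1)). x = act Mg 1 (int j - 1) (ext_class V (word [a])) y"
    and x: "x \<in> carrier (component Mg (int j + 1))" "act Mg 1 (int j + 1) (ext_class V (word [a])) x = (\<lambda>_. 0)"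
  shows "\<exists>y\<in>carrier (component Mg (int j)). x = act Mg 1 (int j) (ext_class V (word [a])) y"
proof -
  obtain B \<psi> where "B \<subseteq> carrier V \<and> (\<forall>\<beta>\<in>B. \<psi> \<beta> \<in> carrier (dual_space V)) \<and>
    (\<forall>\<beta>\<in>B. \<forall>\<beta>'\<in>B. \<psi> \<beta> \<beta>' = (if \<beta> = \<beta>' then 1 else 0)) \<and>
    (\<forall>v\<in>carrier V. finite {\<beta> \<in> B. \<psi> \<beta> v \<noteq> 0}) \<and>
    (\<forall>N. submodule N scalars V \<longrightarrow> B \<subseteq> N \<longrightarrow> N = carrier V)"
    using dual_basis_exists[OF module_axioms] by (elim exE)
  then have B: "B \<subseteq> carrier V" "\<And>\<beta>. \<beta> \<in> B \<Longrightarrow> \<psi> \<beta> \<in> carrier (dual_space V)"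
    "\<And>\<beta> \<beta>'. \<beta> \<in> B \<Longrightarrow> \<beta>' \<in> B \<Longrightarrow> \<psi> \<beta> \<beta>' = (if \<beta> = \<beta>' then 1 else 0)"
    "\<And>v. v \<in> carrier V \<Longrightarrow> finite {\<beta> \<in> B. \<psi> \<beta> v \<noteq> 0}"
    "\<And>N. submodule N scalars V \<Longrightarrow> B \<subseteq> N \<Longrightarrow> N = carrier V"
    by simp_all
  have "finite B" by (rule finite_dual_basis[OF B(1-4) b0 unit top])
  then obtain ev where ev_bij: "bij_betw ev {0..<card B} B" using ex_bij_betw_nat_finite by blast
  define m where "m = card B"
  define \<phi> where "\<phi> l = \<psi> (ev l)" for l
  have evB: "l < m \<Longrightarrow> ev l \<in> B" for l using ev_bij by (auto simp: bij_betw_def m_def)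
  have ev: "l < m \<Longrightarrow> ev l \<in> carrier V" for l using evB B(1) by blast
  have \<phi>: "l < m \<Longrightarrow> \<phi> l \<in> carrier (dual_space V)" for l using evB B(2) by (simp add: \<phi>_def)
  have \<delta>: "\<phi> l (ev k) = (if l = k then 1 else 0)" if "l < m" "k < m" for l k
  proof -
    have "ev l = ev k \<longleftrightarrow> l = k" using ev_bij that by (auto simp: bij_betw_def m_def inj_on_def)
    then show ?thesis using B(3)[OF evB[OF that(1)] evB[OF that(2)]] by (simp add: \<phi>_def)
  qed
  have ev_image: "ev ` {..<m} = B" using ev_bij by (simp add: bij_betw_def m_def lessThan_atLeast0)
  have gen: "submodule N scalars V \<Longrightarrow> ev ` {..<m} \<subseteq> N \<Longrightarrow> N = carrier V" for N
    using B(5) ev_image by simp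
  have ext_mult_expansion: "ext_mult v y = (\<lambda>w. \<Sum>l<m. \<phi> l v * ext_mult (ev l) y w)" if "v \<in> carrier V" "y \<in> FA" for v y
    by (rule dual_basis_expansion[where f = "\<lambda>v. ext_mult v y"])
       (simp_all add: ev \<phi> \<delta> gen that ext_mult_add_vector ext_mult_scale_vector)
  have act_expansion: "act Mg 1 i (ext_class V (word [v])) y =
      (\<lambda>h. \<Sum>l<m. \<phi> l v * act Mg 1 i (ext_class V (word [ev l])) y h)"
    if "v \<in> carrier V" "y \<in> carrier (component Mg i)" for v y i
    by (rule dual_basis_expansion[where f = "\<lambda>v. act Mg 1 i (ext_class V (word [v])) y"])
       (simp_all add: ev \<phi> \<delta> gen that act_vector_add act_vector_scale)
  define e where "e l x = (\<lambda>s. ext_mult (ev l) (x s))" for l and x :: "nat \<Rightarrow> 'v list \<Rightarrow> 'k"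
  define \<iota> where "\<iota> l x = (\<lambda>s. ext_contract (\<phi> l) (x s))" for l and x :: "nat \<Rightarrow> 'v list \<Rightarrow> 'k"
  have cs: "contraction_system (GG p) e \<iota> m" for p
  proof
    fix l k :: nat and x y :: "nat \<Rightarrow> 'v list \<Rightarrow> 'k" and j
    show "0 \<in> GG p j" by (rule GG_zero)
    show "x \<in> GG p j \<Longrightarrow> y \<in> GG p j \<Longrightarrow> x - y \<in> GG p j" by (rule GG_diff)
    show "l < m \<Longrightarrow> x \<in> GG p j \<Longrightarrow> e l x \<in> GG p (Suc j)"
      unfolding e_def by (intro GG_ext_mult ev)
    show "l < m \<Longrightarrow> x \<in> GG p j \<Longrightarrow> y \<in> GG p j \<Longrightarrow> e l (x + y) = e l x + e l y"
      unfolding e_def plus_fun_def ext_mult_add ..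
    show "l < m \<Longrightarrow> k < m \<Longrightarrow> x \<in> GG p j \<Longrightarrow> e l (e k x) + e k (e l x) = 0"
      unfolding e_def plus_fun_def zero_fun_def using ext_mult_anti[OF ev ev GG_FA] by blast
    show "l < m \<Longrightarrow> x \<in> GG p j \<Longrightarrow> e l (e l x) = 0"
      unfolding e_def zero_fun_def using ext_mult_square[OF ev GG_FA] by blast
    show "l < m \<Longrightarrow> x \<in> GG p j \<Longrightarrow> y \<in> GG p j \<Longrightarrow> \<iota> l (x + y) = \<iota> l x + \<iota> l y"
      unfolding \<iota>_def plus_fun_def using ext_contract_add[OF GG_FA GG_FA] by blast
    show "l < m \<Longrightarrow> x \<in> GG p 0 \<Longrightarrow> \<iota> l x = 0"
      unfolding \<iota>_def zero_fun_def using ext_contract_\<Lambda>_0[OF \<phi> GG_in] by blast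
    show "l < m \<Longrightarrow> k < m \<Longrightarrow> x \<in> GG p j \<Longrightarrow> \<iota> l (e k x) = (if l = k then x else 0) - e k (\<iota> l x)"
      using ext_contract_ext_mult[OF \<phi> ev GG_in, of l k x p j] by (auto simp: \<iota>_def e_def fun_eq_iff \<delta>)
    assume x: "x \<in> GG p (Suc j)"
    \<comment> \<open>A product with an arbitrary vector is rewritten by
      \<open>ext_mult_expansion\<close>, and the coefficients of each basis vector are
      collected.\<close>
    have "\<exists>z. (\<forall>l<m. z l \<in> \<Lambda> j) \<and> y = (\<lambda>w. \<Sum>l<m. ext_mult (ev l) (z l) w)" if "y \<in> \<Lambda> (Suc j)" for y
      using that
    proof (induction rule: \<Lambda>_Suc_induct)
      case zero
      show ?case by (intro exI[of _ "\<lambda>_ _. 0"]) simp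
    next
      case (add x v y)
      then obtain z where z: "\<forall>l<m. z l \<in> \<Lambda> j" "x = (\<lambda>w. \<Sum>l<m. ext_mult (ev l) (z l) w)" by blast
      have "ext_mult v y = (\<lambda>w. \<Sum>l<m. \<phi> l v * ext_mult (ev l) y w)"
        by (rule ext_mult_expansion[OF add(1) \<Lambda>_FA[OF add(2)]])
      then have "(\<lambda>u. x u + ext_mult v y u) = (\<lambda>w. \<Sum>l<m. ext_mult (ev l) (\<lambda>u. z l u + \<phi> l v * y u) w)"
        by (simp add: z(2) ext_mult_add ext_mult_scale sum.distrib)
      moreover have "\<forall>l<m. (\<lambda>u. z l u + \<phi> l v * y u) \<in> \<Lambda> j"
        using z(1) add(2) by (auto intro: \<Lambda>_add \<Lambda>_scale)
      ultimately show ?case by (intro exI[of _ "\<lambda>l u. z l u + \<phi> l v * y u"]) simp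
    qed
    then have "\<exists>z. (\<forall>l<m. z l \<in> \<Lambda> j) \<and> x s = (\<lambda>w. \<Sum>l<m. ext_mult (ev l) (z l) w)" for s
      using GG_in[OF x] by blast
    then obtain z where z: "\<And>s l. l < m \<Longrightarrow> z s l \<in> \<Lambda> j" "\<And>s. x s = (\<lambda>w. \<Sum>l<m. ext_mult (ev l) (z s l) w)"
      by metis
    define y where "y l = (\<lambda>s. if s < b p then z s l else (\<lambda>_. 0))" for l
    have "\<forall>l<m. y l \<in> GG p j" using z(1) by (auto simp: y_def GG_def)
    moreover have "x = (\<Sum>l<m. e l (y l))"
    proof
      fix s
      show "x s = (\<Sum>l<m. e l (y l)) s"
        using GG_out[OF x, of s] z(2)[of s]
        by (cases "s < b p") (auto simp: sum_fun_apply e_def y_def fun_eq_iff)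
    qed
    ultimately show "\<exists>y. (\<forall>l<m. y l \<in> GG p j) \<and> x = (\<Sum>l<m. e l (y l))" by blast
  qed
  have lr: "linear_resolution GG e \<iota> m D"
  proof (rule linear_resolution.intro)
    fix l p j and x y :: "nat \<Rightarrow> 'v list \<Rightarrow> 'k"
    show "contraction_system (GG p) e \<iota> m" by (rule cs)
    show "x \<in> GG (Suc p) j \<Longrightarrow> D p j x \<in> GG p (Suc j)" by (rule D_in)
    show "x \<in> GG (Suc p) j \<Longrightarrow> y \<in> GG (Suc p) j \<Longrightarrow> D p j (x + y) = D p j x + D p j y" by (rule D_add)
    show "l < m \<Longrightarrow> x \<in> GG (Suc p) j \<Longrightarrow> D p (Suc j) (e l x) = e l (D p j x)"
      unfolding e_def by (rule D_ext_mult[OF ev])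
    show "x \<in> GG (Suc (Suc p)) j \<Longrightarrow> D p (Suc j) (D (Suc p) j x) = 0"
      using D_exact_iff[OF D_in] by blast
    show "x \<in> GG (Suc p) (Suc j) \<Longrightarrow> D p (Suc j) x = 0 \<Longrightarrow> x \<in> D (Suc p) j ` GG (Suc (Suc p)) j"
      using D_exact_iff by blast
  qed
  define M where "M i = carrier (component Mg i)" for i
  \<comment> \<open>The value 0 beyond the basis makes linearity and \<open>eM_in\<close> hold for
    every index.\<close>
  define eM where "eM i l = (if l < m then act Mg 1 i (ext_class V (word [ev l])) else (\<lambda>_ _. 0))" for i l
  \<comment> \<open>The images of the free generators; they span degree 0, where the coefficients
    are scalars.\<close>
  define T where "T = (\<lambda>s. eps 0 (unit_vector s (red (word [])))) ` {..<b 0}"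
  have eM: "l < m \<Longrightarrow> eM i l = act Mg 1 i (ext_class V (word [ev l]))" for i l by (simp add: eM_def)
  have "resolved_module GG e \<iota> m D (\<lambda>c f x. c * f x) M eM eps T"
  proof (intro resolved_module.intro lr fun_vs.vector_family_axioms resolved_module_axioms.intro)
    fix l k i j c and f :: "'h \<Rightarrow> 'k" and u v :: "nat \<Rightarrow> 'v list \<Rightarrow> 'k"
    show "fun_vs.subspace (M i)"
      by (rule fun_vs.subspaceI) (simp_all add: M_def zero_fun_def plus_fun_def Mg_closed)
    show "Vector_Spaces.linear (\<lambda>c f x. c * f x) (\<lambda>c f x. c * f x) (eM i l)"
      by (rule fun_vs.linearI) (simp_all add: eM_def plus_fun_def act_linear)
    show "f \<in> M i \<Longrightarrow> eM i l f \<in> M (i + 1)"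
      using act_in[OF letter_in_ext_power[OF ev], of l f i] by (auto simp: M_def eM_def Mg_closed)
    show "l < m \<Longrightarrow> k < m \<Longrightarrow> f \<in> M i \<Longrightarrow> eM (i + 1) l (eM i k f) + eM (i + 1) k (eM i l f) = 0"
      using act_anti[OF ev ev, of l k f i] by (simp add: eM M_def plus_fun_def zero_fun_def)
    show "l < m \<Longrightarrow> f \<in> M i \<Longrightarrow> eM (i + 1) l (eM i l f) = 0"
      using act_square[OF ev, of l f i] by (simp add: eM M_def zero_fun_def)
    show "eps j ` GG 0 j = M (int j)" by (simp add: eps_surj M_def)
    show "u \<in> GG 0 j \<Longrightarrow> v \<in> GG 0 j \<Longrightarrow> eps j (u + v) = eps j u + eps j v"
      by (simp add: eps_add plus_fun_def[of "eps j u"])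
    show "l < m \<Longrightarrow> u \<in> GG 0 j \<Longrightarrow> eps (Suc j) (e l u) = eM (int j) l (eps j u)"
      unfolding e_def eM by (simp add: eps_ext_mult[OF ev] eM)
    show "u \<in> GG 1 j \<Longrightarrow> eps (Suc j) (D 0 j u) = 0"
      using eps_exact_iff[OF D_in[of u 0 j]] by (auto simp: zero_fun_def)
    show "u \<in> GG 0 (Suc j) \<Longrightarrow> eps (Suc j) u = 0 \<Longrightarrow> u \<in> D 0 j ` GG 1 j"
      using eps_exact_iff[of u j] by (simp add: zero_fun_def)
    show "finite T" by (simp add: T_def)
    show "M 0 \<subseteq> fun_vs.span T"
    proof
      fix f assume "f \<in> M 0"
      then obtain u where u: "u \<in> GG 0 0" "f = eps 0 u" using eps_surj[of 0] by (auto simp: M_def)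
      have eps_sum: "eps 0 (sum g S) = (\<Sum>s\<in>S. eps 0 (g s))" if "finite S" "\<And>s. s \<in> S \<Longrightarrow> g s \<in> GG 0 0"
        for S :: "nat set" and g
        using that
      proof (induction S rule: finite_induct)
        case empty
        have "eps 0 0 = (\<lambda>_. 0)"
          using eps_scale[OF GG_zero, of 0 0] by (simp add: zero_fun_def)
        then show ?case by (simp add: zero_fun_def)
      next
        case (insert s S)
        then show ?case using eps_add[of "g s" 0 "sum g S"] by (simp add: GG_sum plus_fun_def)
      qed
      have "f = (\<Sum>s<b 0. eps 0 (unit_vector s (u s)))"
        using u unit_vector_expansion[OF u(1)] eps_sum[of "{..<b 0}" "\<lambda>s. unit_vector s (u s)"]
          unit_vector_in GG_in[OF u(1)] by simp
      moreover have "eps 0 (unit_vector s (u s)) \<in> fun_vs.span T" if s: "s < b 0" for s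
      proof -
        obtain c where c: "u s = (\<lambda>w. c * red (word []) w)" using \<Lambda>_0[OF GG_in[OF u(1)], of s] by blast
        have "unit_vector s (u s) = (\<lambda>t w. c * unit_vector s (red (word [])) t w)"
          by (auto simp: unit_vector_def c fun_eq_iff)
        then have eq: "eps 0 (unit_vector s (u s)) = (\<lambda>h. c * eps 0 (unit_vector s (red (word []))) h)"
          using eps_scale[OF unit_vector_in[OF s red_unit_\<Lambda>]] by simp
        have "eps 0 (unit_vector s (red (word []))) \<in> T" using s by (simp add: T_def)
        then show ?thesis
          unfolding eq by (intro fun_vs.span_scale fun_vs.span_base)
      qed
      ultimately show "f \<in> fun_vs.span T" by (auto intro: fun_vs.span_sum)
    qed
  qed
  then interpret R: resolved_module GG e \<iota> m D "\<lambda>c f x. c * f x" M eM eps T .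
  \<comment> \<open>With the coordinates of \<open>a\<close> as coefficients, the combination of the
    basis operators is multiplication by \<open>a\<close>.\<close>
  have A: "(\<Sum>l<m. (\<lambda>h. \<phi> l a * eM i l y h)) = act Mg 1 i (ext_class V (word [a])) y" if "y \<in> M i" for i y
    using act_expansion[OF a, of y i] that by (simp add: M_def fun_eq_iff sum_fun_apply eM)
  have "\<exists>y\<in>M (int j). x = (\<Sum>l<m. (\<lambda>h. \<phi> l a * eM (int j) l y h))"
  proof (rule R.exactness_propagates)
    fix x assume x: "x \<in> M (int j)" "(\<Sum>l<m. (\<lambda>h. \<phi> l a * eM (int j) l x h)) = 0"
    then have "\<exists>y\<in>M (int j - 1). x = act Mg 1 (int j - 1) (ext_class V (word [a])) y"
      using exact[of x] A[OF x(1)] by (simp add: M_def zero_fun_def)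
    then show "\<exists>y\<in>M (int j - 1). x = (\<Sum>l<m. (\<lambda>h. \<phi> l a * eM (int j - 1) l y h))"
      using A by auto
  qed (use x A in \<open>simp_all add: M_def zero_fun_def\<close>)
  then show ?thesis using A by (auto simp: M_def)
qed

end

section \<open>Duality\<close>

text \<open>The elements of the quotient are the cosets N + x with x in K, and such a coset is the
  zero N exactly when x is in N. Nonzero cohomology thus means that a kernel is not contained in an
  image.\<close>

lemma quotient_space_nontrivial_iff:
  fixes M :: "('k::field, 'm) module"
  assumes M: "module scalars M" and N: "submodule N scalars M" and K: "submodule K scalars M"
  shows "carrier (quotient_space (M\<lparr>carrier := K\<rparr>) N) \<noteq> {\<zero>\<^bsub>quotient_space (M\<lparr>carrier := K\<rparr>) N\<^esub>} \<longleftrightarrow> \<not> K \<subseteq> N"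
proof -
  interpret scalar_module M by (rule scalar_moduleI) fact
  note N' = N[unfolded submodule_iff[OF M]] and K' = K[unfolded submodule_iff[OF M]]
  have carrier: "carrier (quotient_space (M\<lparr>carrier := K\<rparr>) N) = (\<lambda>x. N +>\<^bsub>M\<^esub> x) ` K"
    by (auto simp: quotient_space_def A_RCOSETS_def RCOSETS_def a_r_coset_def r_coset_def)
  have zero: "\<zero>\<^bsub>quotient_space (M\<lparr>carrier := K\<rparr>) N\<^esub> = N"
    by (simp add: quotient_space_def)
  have sub: "subgroup N (add_monoid M)" using N by (rule submodule.axioms(1))
  have "N +>\<^bsub>M\<^esub> x = N \<longleftrightarrow> x \<in> N" if "x \<in> K" for x
  proof
    have x: "x \<in> carrier M" using that K' by blast
    show "N +>\<^bsub>M\<^esub> x = N" if "x \<in> N" by (rule a_coset_join2[OF x sub that])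
    have "\<zero>\<^bsub>M\<^esub> \<oplus>\<^bsub>M\<^esub> x \<in> N +>\<^bsub>M\<^esub> x" using N' by (auto simp: a_r_coset_def r_coset_def)
    then show "x \<in> N" if "N +>\<^bsub>M\<^esub> x = N" using that x by simp
  qed
  note coset = this
  have "K \<noteq> {}" using K' by blast
  then have "(\<lambda>x. N +>\<^bsub>M\<^esub> x) ` K = {N} \<longleftrightarrow> (\<forall>x\<in>K. N +>\<^bsub>M\<^esub> x = N)" by blast
  also have "\<dots> \<longleftrightarrow> (\<forall>x\<in>K. x \<in> N)" by (rule ball_cong[OF refl]) (rule coset)
  finally show ?thesis unfolding carrier zero subset_iff Ball_def by simp
qed

locale koszul_dual = exterior V for V :: "('k::field, 'v) module" +
  fixes A :: "('k, ('v list \<Rightarrow> 'k) set, 'm) graded_module" and n :: nat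
  assumes A_graded: "graded_ext_module V A"
    and koszul: "koszul_module V (shift (int n) (graded_dual A))"
    and A_negative: "i < 0 \<Longrightarrow> carrier (component A i) = {\<zero>\<^bsub>component A i\<^esub>}"
    and A_0: "carrier (component A 0) \<noteq> {\<zero>\<^bsub>component A 0\<^esub>}"
begin

abbreviation "Mg \<equiv> shift (int n) (graded_dual A)"

abbreviation mult_by :: "'v \<Rightarrow> int \<Rightarrow> 'm \<Rightarrow> 'm" where
  "mult_by a i \<equiv> act A 1 i (ext_class V (word [a]))"

definition exact_at :: "'v \<Rightarrow> int \<Rightarrow> bool" where
  "exact_at a i \<longleftrightarrow> (\<forall>x\<in>carrier (component A i). mult_by a i x = \<zero>\<^bsub>component A (i + 1)\<^esub> \<longrightarrow>
     (\<exists>y\<in>carrier (component A (i - 1)). x = mult_by a (i - 1) y))"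

lemma A_module: "module scalars (component A i)"
  using A_graded by (simp add: graded_ext_module_def)

sublocale A: scalar_module "component A i" for i
  by (rule scalar_moduleI) (rule A_module)

lemma Mg_component: "component Mg i = dual_space (component A (int n - i))"
  by (simp add: shift_def graded_dual_def)

lemma Mg_act:
  "act Mg 1 i X f = (\<lambda>x. if x \<in> carrier (component A (int n - i - 1))
     then (- 1) powi (i - int n) * f (act A 1 (int n - i - 1) X x) else 0)"
  by (simp add: shift_def graded_dual_def fun_eq_iff algebra_simps)

lemma mult_by_linear: "a \<in> carrier V \<Longrightarrow> mult_by a i \<in> linear_maps (component A i) (component A (i + 1))"
  using A_graded letter_in_ext_power[of a] by (simp add: graded_ext_module_def)

lemma mult_by_rules:
  assumes "a \<in> carrier V" "x \<in> carrier (component A i)"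
  shows "mult_by a i x \<in> carrier (component A (i + 1))"
    "y \<in> carrier (component A i) \<Longrightarrow> mult_by a i (x \<oplus>\<^bsub>component A i\<^esub> y) = mult_by a i x \<oplus>\<^bsub>component A (i + 1)\<^esub> mult_by a i y"
    "mult_by a i (c \<odot>\<^bsub>component A i\<^esub> x) = c \<odot>\<^bsub>component A (i + 1)\<^esub> mult_by a i x"
  using mult_by_linear[OF assms(1), of i] assms(2) by (auto simp: linear_maps_def)

lemma mult_by_zero: "a \<in> carrier V \<Longrightarrow> mult_by a i \<zero>\<^bsub>component A i\<^esub> = \<zero>\<^bsub>component A (i + 1)\<^esub>"
  using mult_by_rules(3)[of a "\<zero>\<^bsub>component A i\<^esub>" i 0] mult_by_rules(1)[of a "\<zero>\<^bsub>component A i\<^esub>" i] by simp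

lemma image_submodule:
  assumes a: "a \<in> carrier V"
  shows "submodule (mult_by a i ` carrier (component A i)) scalars (component A (i + 1))"
  unfolding submodule_iff[OF A_module]
proof (intro conjI ballI allI)
  show "mult_by a i ` carrier (component A i) \<subseteq> carrier (component A (i + 1))"
    using mult_by_rules(1)[OF a] by blast
  show "\<zero>\<^bsub>component A (i + 1)\<^esub> \<in> mult_by a i ` carrier (component A i)"
    using mult_by_zero[OF a, of i] by (metis A.zero_closed image_eqI)
next
  fix u v assume "u \<in> mult_by a i ` carrier (component A i)" "v \<in> mult_by a i ` carrier (component A i)"
  then obtain x y where "x \<in> carrier (component A i)" "y \<in> carrier (component A i)" "u = mult_by a i x" "v = mult_by a i y"
    by blast
  then show "u \<oplus>\<^bsub>component A (i + 1)\<^esub> v \<in> mult_by a i ` carrier (component A i)"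
    by (intro image_eqI[of _ _ "x \<oplus>\<^bsub>component A i\<^esub> y"]) (simp_all add: mult_by_rules[OF a])
next
  fix c u assume "u \<in> mult_by a i ` carrier (component A i)"
  then obtain x where "x \<in> carrier (component A i)" "u = mult_by a i x" by blast
  then show "c \<odot>\<^bsub>component A (i + 1)\<^esub> u \<in> mult_by a i ` carrier (component A i)"
    by (intro image_eqI[of _ _ "c \<odot>\<^bsub>component A i\<^esub> x"]) (simp_all add: mult_by_rules[OF a])
qed

lemma sign_square: "(- 1 :: 'k) powi i * (- 1) powi i = 1"
  by (simp add: power_int_mult_distrib[symmetric])

lemma dual_zero: "f \<in> carrier (dual_space (component A i)) \<Longrightarrow> f \<zero>\<^bsub>component A i\<^esub> = 0"
proof -
  assume f: "f \<in> carrier (dual_space (component A i))"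
  have "f (0 \<odot>\<^bsub>component A i\<^esub> \<zero>\<^bsub>component A i\<^esub>) = 0 * f \<zero>\<^bsub>component A i\<^esub>"
    using f A.zero_closed unfolding dual_space_iff by blast
  then show ?thesis by simp
qed

lemma dual_scale: "f \<in> carrier (dual_space (component A i)) \<Longrightarrow> (\<lambda>x. c * f x) \<in> carrier (dual_space (component A i))"
  by (simp add: dual_space_iff algebra_simps)

text \<open>A functional killed by \<open>a\<close> vanishes on the image of \<open>a\<close>, hence
  by exactness on the kernel of the following map, so it factors through multiplication by
  \<open>a\<close>.\<close>

lemma dual_exact:
  assumes a: "a \<in> carrier V" and exact: "exact_at a i"
    and f: "f \<in> carrier (component Mg (int n - i))" "act Mg 1 (int n - i) (ext_class V (word [a])) f = (\<lambda>_. 0)"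
  shows "\<exists>g\<in>carrier (component Mg (int n - i - 1)). f = act Mg 1 (int n - i - 1) (ext_class V (word [a])) g"
proof -
  have fd: "f \<in> carrier (dual_space (component A i))" using f(1) by (simp add: Mg_component)
  have f0: "f (mult_by a (i - 1) y) = 0" if "y \<in> carrier (component A (i - 1))" for y
  proof -
    have "(- 1) powi (- i) * f (mult_by a (i - 1) y) = 0"
      using fun_cong[OF f(2), of y] that by (simp add: Mg_act)
    then show ?thesis by simp
  qed
  have "\<exists>g\<in>carrier (dual_space (component A (i + 1))). \<forall>x\<in>carrier (component A i). f x = g (mult_by a i x)"
  proof (rule linear_map_kernel_factor[OF A_module A_module mult_by_linear[OF a] fd])
    show "f x = 0" if "x \<in> carrier (component A i)" "mult_by a i x = \<zero>\<^bsub>component A (i + 1)\<^esub>" for x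
      using exact that f0 unfolding exact_at_def by blast
  qed
  then obtain g where g: "g \<in> carrier (dual_space (component A (i + 1)))"
    "\<And>x. x \<in> carrier (component A i) \<Longrightarrow> f x = g (mult_by a i x)" by blast
  \<comment> \<open>The Koszul sign of the dual action in degree n - i - 1; it is its own inverse,
    so scaling \<open>g\<close> by it cancels it.\<close>
  let ?s = "(- 1 :: 'k) powi (- i - 1)"
  have "f = act Mg 1 (int n - i - 1) (ext_class V (word [a])) (\<lambda>x. ?s * g x)"
  proof
    fix x
    show "f x = act Mg 1 (int n - i - 1) (ext_class V (word [a])) (\<lambda>x. ?s * g x) x"
    proof (cases "x \<in> carrier (component A i)")
      case True
      have "?s * (?s * g (mult_by a i x)) = f x"
        using sign_square[of "- i - 1"] g(2)[OF True] by (simp only: mult.assoc[symmetric] mult_1)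
      then show ?thesis using True by (simp add: Mg_act)
    qed (use fd in \<open>simp add: Mg_act dual_space_iff\<close>)
  qed
  moreover have "(\<lambda>x. ?s * g x) \<in> carrier (component Mg (int n - i - 1))"
    using dual_scale[OF g(1)] by (simp add: Mg_component)
  ultimately show ?thesis by blast
qed

text \<open>If \<open>x\<close> were outside the image, a functional vanishing on the image with
  value 1 at \<open>x\<close> would be killed by \<open>a\<close>. Up to sign it would then be some
  g after multiplication by \<open>a\<close>, and would vanish at \<open>x\<close>.\<close>

lemma exact_at_if_dual_exact:
  assumes a: "a \<in> carrier V"
    and exact: "\<And>f. f \<in> carrier (component Mg (int n - i)) \<Longrightarrow>
      act Mg 1 (int n - i) (ext_class V (word [a])) f = (\<lambda>_. 0) \<Longrightarrow>
      \<exists>g\<in>carrier (component Mg (int n - i - 1)). f = act Mg 1 (int n - i - 1) (ext_class V (word [a])) g"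
  shows "exact_at a i"
  unfolding exact_at_def
proof (intro ballI impI)
  fix x assume x: "x \<in> carrier (component A i)" "mult_by a i x = \<zero>\<^bsub>component A (i + 1)\<^esub>"
  let ?U = "mult_by a (i - 1) ` carrier (component A (i - 1))"
  have "x \<in> ?U"
  proof (rule ccontr)
    assume "x \<notin> ?U"
    moreover have "submodule ?U scalars (component A i)" using image_submodule[OF a, of "i - 1"] by simp
    ultimately obtain f where f: "f \<in> carrier (dual_space (component A i))" "\<And>u. u \<in> ?U \<Longrightarrow> f u = 0" "f x = 1"
      using dual_space_separates[OF A_module _ x(1)] by blast
    have "act Mg 1 (int n - i) (ext_class V (word [a])) f = (\<lambda>_. 0)"
      using f(2) by (auto simp: Mg_act fun_eq_iff)
    then obtain g where g: "g \<in> carrier (component Mg (int n - i - 1))" "f = act Mg 1 (int n - i - 1) (ext_class V (word [a])) g"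
      using exact[of f] f(1) by (auto simp: Mg_component)
    have "f x = (- 1) powi (- i - 1) * g \<zero>\<^bsub>component A (i + 1)\<^esub>"
      unfolding g(2) using x by (simp add: Mg_act)
    also have "g \<zero>\<^bsub>component A (i + 1)\<^esub> = 0" using g(1) by (intro dual_zero) (simp add: Mg_component)
    finally show False using f(3) by simp
  qed
  then show "\<exists>y\<in>carrier (component A (i - 1)). x = mult_by a (i - 1) y" by blast
qed

text \<open>Degree i of \<open>A\<close> is dual to degree n - i of \<open>Mg\<close>, so upward
  propagation in \<open>Mg\<close> becomes downward propagation in \<open>A\<close>.\<close>

theorem exact_at_pred:
  assumes a: "a \<in> carrier V" and i: "i \<le> int n" and exact: "exact_at a i"
  shows "exact_at a (i - 1)"
proof -
  have Mg: "graded_ext_module V Mg" and res: "has_linear_free_resolution V Mg"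
    using koszul by (simp_all add: koszul_module_def)
  obtain b \<epsilon> d where "linear_free_resolution V Mg b \<epsilon> d"
    using res unfolding has_linear_free_resolution_def Let_def
  proof (elim exE conjE)
    fix b \<epsilon> d
    assume "\<epsilon> \<in> graded_hom V (free_module V (b 0) (int 0)) Mg"
      "\<forall>p. d p \<in> graded_hom V (free_module V (b (Suc p)) (int (Suc p))) (free_module V (b p) (int p))"
      "\<forall>i. \<epsilon> i ` carrier (component (free_module V (b 0) (int 0)) i) = carrier (component Mg i)"
      "\<forall>i. d 0 i ` carrier (component (free_module V (b 1) (int 1)) i) =
        {x \<in> carrier (component (free_module V (b 0) (int 0)) i). \<epsilon> i x = \<zero>\<^bsub>component Mg i\<^esub>}"
      "\<forall>p i. d (Suc p) i ` carrier (component (free_module V (b (Suc (Suc p))) (int (Suc (Suc p)))) i) =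
        {x \<in> carrier (component (free_module V (b (Suc p)) (int (Suc p))) i).
          d p i x = \<zero>\<^bsub>component (free_module V (b p) (int p)) i\<^esub>}"
    then have "linear_free_resolution V Mg b \<epsilon> d"
      using Mg exterior_axioms
      by (intro linear_free_resolution.intro linear_free_resolution_axioms.intro)
         (simp_all add: Mg_component, simp_all add: dual_space_def)
    then show thesis by (rule that)
  qed
  then interpret R: linear_free_resolution V Mg b \<epsilon> d .
  obtain u where u: "u \<in> carrier (component A 0)" "u \<noteq> \<zero>\<^bsub>component A 0\<^esub>" using A_0 A.zero_closed by blast
  have "submodule {\<zero>\<^bsub>component A 0\<^esub>} scalars (component A 0)"
    unfolding submodule_iff[OF A_module] by simp
  then obtain f where f: "f \<in> carrier (dual_space (component A 0))" "f u = 1"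
    using dual_space_separates[OF A_module _ u(1)] u(2) by blast
  have f': "f \<in> carrier (component Mg (int n))" "f \<noteq> (\<lambda>_. 0)"
    using f by (auto simp: Mg_component)
  \<comment> \<open>If the unit of the exterior algebra were zero, it could not act as the identity
    on the nonzero \<open>f\<close>.\<close>
  have unit: "red (word []) \<noteq> (\<lambda>_. 0)"
  proof
    assume "red (word []) = (\<lambda>_. 0)"
    then have "act Mg 0 (int n) (ext_class V (word [])) f = (\<lambda>_. 0)"
      using R.act_class_zero[of "word []" 0 f "int n"] f'(1) R.ext_class_in_power[OF hom_part_word[of "[]"]] by simp
    moreover have "act Mg 0 (int n) (ext_class V (word [])) f = f"
      using Mg f'(1) by (simp add: graded_ext_module_def ext_algebra_simps)
    ultimately show False using f'(2) by simp
  qed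
  \<comment> \<open>Without generators the zeroth module would be zero and could not map onto the
    component of \<open>Mg\<close> that contains \<open>f\<close>.\<close>
  have b0: "b 0 > 0"
  proof (rule ccontr)
    assume "\<not> b 0 > 0"
    then have "x = y" if "x \<in> R.GG 0 n" "y \<in> R.GG 0 n" for x y
      using that by (auto simp: R.GG_def)
    then have "g = h" if "g \<in> carrier (component Mg (int n))" "h \<in> carrier (component Mg (int n))" for g h
      using that unfolding R.eps_surj[symmetric] by blast
    then show False using f' R.Mg_closed(3)[of "int n"] by blast
  qed
  \<comment> \<open>Degree n + 1 of \<open>Mg\<close> is the dual of degree -1 of \<open>A\<close>,
    which is zero.\<close>
  have "f = (\<lambda>_. 0)" if f: "f \<in> carrier (component Mg (int (Suc n)))" for f
  proof
    fix x
    have fd: "f \<in> carrier (dual_space (component A (- 1)))" using f by (simp add: Mg_component)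
    then show "f x = 0"
      using A_negative[of "- 1"] dual_zero[OF fd] by (cases "x \<in> carrier (component A (- 1))") (auto simp: dual_space_iff)
  qed
  then have top: "carrier (component Mg (int (Suc n))) = {\<lambda>_. 0}"
    using R.Mg_closed(3) by blast
  have lin: "act Mg 1 i X (\<lambda>h. f h + g h) = (\<lambda>h. act Mg 1 i X f h + act Mg 1 i X g h)"
    "act Mg 1 i X (\<lambda>h. c * f h) = (\<lambda>h. c * act Mg 1 i X f h)" for i X f g c
    by (auto simp: Mg_act fun_eq_iff algebra_simps)
  \<comment> \<open>The bound \<open>i\<close> \<le> n makes n - i a natural number, hence a degree
    that the resolution describes.\<close>
  define j where "j = nat (int n - i)"
  have j: "int j = int n - i" using i by (simp add: j_def)
  show ?thesis
  proof (rule exact_at_if_dual_exact[OF a])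
    fix f assume f: "f \<in> carrier (component Mg (int n - (i - 1)))"
      "act Mg 1 (int n - (i - 1)) (ext_class V (word [a])) f = (\<lambda>_. 0)"
    have "\<exists>y\<in>carrier (component Mg (int j)). f = act Mg 1 (int j) (ext_class V (word [a])) y"
    proof (rule R.module_exactness_propagates[OF b0 unit top lin a])
      fix g assume "g \<in> carrier (component Mg (int j))" "act Mg 1 (int j) (ext_class V (word [a])) g = (\<lambda>_. 0)"
      then show "\<exists>y\<in>carrier (component Mg (int j - 1)). g = act Mg 1 (int j - 1) (ext_class V (word [a])) y"
        unfolding j by (rule dual_exact[OF a exact])
    qed (use f in \<open>simp_all add: j algebra_simps\<close>)
    then show "\<exists>g\<in>carrier (component Mg (int n - (i - 1) - 1)). f = act Mg 1 (int n - (i - 1) - 1) (ext_class V (word [a])) g"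
      by (simp add: j algebra_simps)
  qed
qed

end

section \<open>Singular cohomology\<close>

context koszul_dual
begin

lemma kernel_submodule:
  assumes a: "a \<in> carrier V"
  shows "submodule {x \<in> carrier (component A i). mult_by a i x = \<zero>\<^bsub>component A (i + 1)\<^esub>} scalars (component A i)"
  unfolding submodule_iff[OF A_module]
  using mult_by_zero[OF a, of i] by (auto simp: mult_by_rules[OF a])

section \<open>Degree zero of a cyclic module\<close>

lemma A_rules:
  "e \<in> carrier (ext_power V j) \<Longrightarrow> act A j i e \<in> linear_maps (component A i) (component A (i + j))"
  "e \<in> carrier (ext_power V j) \<Longrightarrow> e' \<in> carrier (ext_power V j) \<Longrightarrow> x \<in> carrier (component A i) \<Longrightarrow>
    act A j i (e \<oplus>\<^bsub>ext_algebra V\<^esub> e') x = act A j i e x \<oplus>\<^bsub>component A (i + j)\<^esub> act A j i e' x"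
  "e \<in> carrier (ext_power V j) \<Longrightarrow> x \<in> carrier (component A i) \<Longrightarrow>
    act A j i (c \<odot>\<^bsub>ext_power V j\<^esub> e) x = c \<odot>\<^bsub>component A (i + j)\<^esub> act A j i e x"
  "x \<in> carrier (component A i) \<Longrightarrow> act A 0 i \<one>\<^bsub>ext_algebra V\<^esub> x = x"
  "e \<in> carrier (ext_power V j) \<Longrightarrow> e' \<in> carrier (ext_power V l) \<Longrightarrow> x \<in> carrier (component A i) \<Longrightarrow>
    act A (j + l) i (e \<otimes>\<^bsub>ext_algebra V\<^esub> e') x = act A j (i + l) e (act A l i e' x)"
  using A_graded unfolding graded_ext_module_def by simp_all

lemma A_act_in:
  "e \<in> carrier (ext_power V j) \<Longrightarrow> x \<in> carrier (component A i) \<Longrightarrow> act A j i e x \<in> carrier (component A (i + j))"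
  using A_rules(1)[of e j i] by (auto simp: linear_maps_def)

text \<open>The variant of \<open>hom_part\<close> with integer degree; differences of degrees then
  need no case distinction.\<close>

definition homogeneous :: "int \<Rightarrow> ('v list \<Rightarrow> 'k) set" where
  "homogeneous i = {f \<in> FA. \<forall>w. f w \<noteq> 0 \<longrightarrow> int (length w) = i}"

lemma ext_power_homogeneous: "carrier (ext_power V i) = ext_class V ` homogeneous i"
  by (simp add: ext_power_def homogeneous_def)

lemma homogeneous_add: "f \<in> homogeneous i \<Longrightarrow> g \<in> homogeneous i \<Longrightarrow> (\<lambda>w. f w + g w) \<in> homogeneous i"
  by (auto simp: homogeneous_def) (metis add_0)

lemma homogeneous_conv: "f \<in> homogeneous i \<Longrightarrow> g \<in> homogeneous j \<Longrightarrow> conv f g \<in> homogeneous (i + j)"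
proof -
  assume fg: "f \<in> homogeneous i" "g \<in> homogeneous j"
  then have FA: "f \<in> FA" "g \<in> FA" by (auto simp: homogeneous_def)
  have "int (length w) = i + j" if "conv f g w \<noteq> 0" for w
  proof -
    have "w \<in> (\<lambda>(u, v). u @ v) ` ({w. f w \<noteq> 0} \<times> {w. g w \<noteq> 0})"
      using finite_conv(1)[OF FA_finite[OF FA(1)] FA_finite[OF FA(2)]] that by blast
    then obtain u v where "w = u @ v" "f u \<noteq> 0" "g v \<noteq> 0" by auto
    then show ?thesis using fg by (simp add: homogeneous_def)
  qed
  then show ?thesis using FA by (simp add: homogeneous_def)
qed

lemma ext_power_closed:
  "\<zero>\<^bsub>ext_algebra V\<^esub> \<in> carrier (ext_power V i)"
  "e \<in> carrier (ext_power V i) \<Longrightarrow> e' \<in> carrier (ext_power V i) \<Longrightarrow> e \<oplus>\<^bsub>ext_algebra V\<^esub> e' \<in> carrier (ext_power V i)"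
  "e \<in> carrier (ext_power V i) \<Longrightarrow> c \<odot>\<^bsub>ext_power V i\<^esub> e \<in> carrier (ext_power V i)"
  "e \<in> carrier (ext_power V i) \<Longrightarrow> e' \<in> carrier (ext_power V j) \<Longrightarrow> e \<otimes>\<^bsub>ext_algebra V\<^esub> e' \<in> carrier (ext_power V (i + j))"
  "\<one>\<^bsub>ext_algebra V\<^esub> \<in> carrier (ext_power V 0)"
proof -
  have FA: "f \<in> FA" if "f \<in> homogeneous i" for f i using that by (simp add: homogeneous_def)
  show "\<zero>\<^bsub>ext_algebra V\<^esub> \<in> carrier (ext_power V i)"
    unfolding ext_power_homogeneous ext_class_zero by (rule imageI) (simp add: homogeneous_def)
  have "word [] \<in> homogeneous 0"
    unfolding homogeneous_def using FA_word[of "[]"] by (simp add: word_def)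
  then show "\<one>\<^bsub>ext_algebra V\<^esub> \<in> carrier (ext_power V 0)"
    unfolding ext_power_homogeneous ext_algebra_simps by (rule imageI)
  show "e \<oplus>\<^bsub>ext_algebra V\<^esub> e' \<in> carrier (ext_power V i)"
    if "e \<in> carrier (ext_power V i)" "e' \<in> carrier (ext_power V i)"
    using that unfolding ext_power_homogeneous by (auto simp: ext_class_add FA homogeneous_add)
  show "c \<odot>\<^bsub>ext_power V i\<^esub> e \<in> carrier (ext_power V i)" if e: "e \<in> carrier (ext_power V i)"
  proof -
    obtain f where f: "f \<in> homogeneous i" "e = ext_class V f" using e unfolding ext_power_homogeneous by blast
    then have "(\<lambda>w. c * f w) \<in> homogeneous i" using FA_scale[OF FA[OF f(1)]] by (auto simp: homogeneous_def)
    then show ?thesis unfolding ext_power_homogeneous f(2) ext_power_smult[OF FA[OF f(1)]] by (rule imageI)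
  qed
  show "e \<otimes>\<^bsub>ext_algebra V\<^esub> e' \<in> carrier (ext_power V (i + j))"
    if "e \<in> carrier (ext_power V i)" "e' \<in> carrier (ext_power V j)"
    using that unfolding ext_power_homogeneous by (auto simp: ext_class_mult FA homogeneous_conv)
qed

lemma A_act_zero_left:
  assumes x: "x \<in> carrier (component A i)"
  shows "act A j i \<zero>\<^bsub>ext_algebra V\<^esub> x = \<zero>\<^bsub>component A (i + j)\<^esub>"
proof -
  have "0 \<odot>\<^bsub>ext_power V j\<^esub> \<zero>\<^bsub>ext_algebra V\<^esub> = \<zero>\<^bsub>ext_algebra V\<^esub>"
    by (simp add: ext_class_zero ext_power_smult)
  then show ?thesis
    using A_rules(3)[OF ext_power_closed(1)[of j] x, of 0] A_act_in[OF ext_power_closed(1)[of j] x] by simp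
qed

lemma A_act_zero_right:
  assumes e: "e \<in> carrier (ext_power V j)"
  shows "act A j i e \<zero>\<^bsub>component A i\<^esub> = \<zero>\<^bsub>component A (i + j)\<^esub>"
proof -
  have "act A j i e (0 \<odot>\<^bsub>component A i\<^esub> \<zero>\<^bsub>component A i\<^esub>) = 0 \<odot>\<^bsub>component A (i + j)\<^esub> act A j i e \<zero>\<^bsub>component A i\<^esub>"
    using A_rules(1)[OF e, of i] A.zero_closed[of i] unfolding linear_maps_def by blast
  then show ?thesis using A_act_in[OF e A.zero_closed[of i]] by simp
qed

text \<open>A cyclic module consists of the multiples of its generator. The generator has to sit in
  degree 0, and the exterior algebra has only scalars there, so degree 0 of \<open>A\<close> is a
  line.\<close>

lemma cyclic_degree_zero:
  assumes cyc: "cyclic V A" and u: "u \<in> carrier (component A 0)" "u \<noteq> \<zero>\<^bsub>component A 0\<^esub>"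
    and z: "z \<in> carrier (component A 0)"
  shows "\<exists>c. z = c \<odot>\<^bsub>component A 0\<^esub> u"
proof -
  obtain i0 x0 where gen: "generates V A {(i0, x0)}" using cyc unfolding cyclic_def by auto
  have x0: "x0 \<in> carrier (component A i0)" using gen by (simp add: generates_def)
  define N where "N i = (\<lambda>e. act A (i - i0) i0 e x0) ` carrier (ext_power V (i - i0))" for i
  have in_N: "y \<in> N i" if "e \<in> carrier (ext_power V (i - i0))" "y = act A (i - i0) i0 e x0" for i e y
    using that by (auto simp: N_def)
  have "graded_submodule V A N"
    unfolding graded_submodule_def submodule_iff[OF A_module]
  proof (intro conjI allI ballI)
    show "N i \<subseteq> carrier (component A i)" for i
      using A_act_in[OF _ x0, of _ "i - i0"] by (auto simp: N_def)
    show "\<zero>\<^bsub>component A i\<^esub> \<in> N i" for i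
      by (rule in_N[OF ext_power_closed(1)]) (use A_act_zero_left[OF x0, of "i - i0"] in simp)
  next
    fix i x y assume "x \<in> N i" "y \<in> N i"
    then obtain e e' where *: "e \<in> carrier (ext_power V (i - i0))" "e' \<in> carrier (ext_power V (i - i0))"
      "x = act A (i - i0) i0 e x0" "y = act A (i - i0) i0 e' x0" by (auto simp: N_def)
    show "x \<oplus>\<^bsub>component A i\<^esub> y \<in> N i"
      by (rule in_N[OF ext_power_closed(2)[OF *(1,2)]]) (use A_rules(2)[OF *(1,2) x0] * in simp)
  next
    fix i c x assume "x \<in> N i"
    then obtain e where *: "e \<in> carrier (ext_power V (i - i0))" "x = act A (i - i0) i0 e x0" by (auto simp: N_def)
    show "c \<odot>\<^bsub>component A i\<^esub> x \<in> N i"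
      by (rule in_N[OF ext_power_closed(3)[OF *(1)]]) (use A_rules(3)[OF *(1) x0] * in simp)
  next
    fix i j e' x assume e': "e' \<in> carrier (ext_power V j)" and "x \<in> N i"
    then obtain e where *: "e \<in> carrier (ext_power V (i - i0))" "x = act A (i - i0) i0 e x0" by (auto simp: N_def)
    have idx: "j + (i - i0) = i + j - i0" by simp
    have "act A j i e' x = act A (i + j - i0) i0 (e' \<otimes>\<^bsub>ext_algebra V\<^esub> e) x0"
      using A_rules(5)[OF e' *(1) x0, unfolded idx] *(2) by simp
    then show "act A j i e' x \<in> N (i + j)"
      by (rule in_N[OF ext_power_closed(4)[OF e' *(1), unfolded idx]])
  qed
  moreover have "x0 \<in> N i0"
    by (rule in_N[of "\<one>\<^bsub>ext_algebra V\<^esub>"]) (simp_all add: ext_power_closed A_rules(4)[OF x0])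
  ultimately have N0: "N 0 = carrier (component A 0)" using gen unfolding generates_def by blast
  \<comment> \<open>A generator of negative degree is 0, and one of positive degree reaches degree 0
    only through a negative exterior power, which is 0. Either way \<open>u\<close> would
    vanish.\<close>
  have "i0 = 0"
  proof (rule ccontr)
    assume "i0 \<noteq> 0"
    obtain e where e: "e \<in> carrier (ext_power V (0 - i0))" "u = act A (0 - i0) i0 e x0"
      using u(1) N0 by (auto simp: N_def)
    show False
    proof (cases "i0 < 0")
      case True
      then have "x0 = \<zero>\<^bsub>component A i0\<^esub>" using A_negative x0 by blast
      then show False using A_act_zero_right[OF e(1), of i0] e(2) u(2) by simp
    next
      case False
      then have "e = \<zero>\<^bsub>ext_algebra V\<^esub>" using carrier_ext_power_negative[of "0 - i0"] e(1) \<open>i0 \<noteq> 0\<close> by auto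
      then show False using A_act_zero_left[OF x0, of "0 - i0"] e(2) u(2) by simp
    qed
  qed
  have mult: "\<exists>c. y = c \<odot>\<^bsub>component A 0\<^esub> x0" if y: "y \<in> carrier (component A 0)" for y
  proof -
    obtain e where e: "e \<in> carrier (ext_power V 0)" "y = act A 0 0 e x0"
      using y N0 \<open>i0 = 0\<close> by (auto simp: N_def)
    obtain f where f: "f \<in> hom_part 0" "e = ext_class V (red f)"
      using e(1) carrier_ext_power[of 0] by (auto simp: \<Lambda>_def)
    obtain c where "red f = (\<lambda>w. c * red (word []) w)" using \<Lambda>_0[of "red f"] f(1) by (auto simp: \<Lambda>_def)
    then have "e = c \<odot>\<^bsub>ext_power V 0\<^esub> \<one>\<^bsub>ext_algebra V\<^esub>"
      by (simp add: f(2) ext_algebra_simps ext_power_smult ext_class_eq_iff red_scale FA_scale[OF red_FA])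
    then show ?thesis
      using e(2) A_rules(3)[OF ext_power_closed(5) x0[unfolded \<open>i0 = 0\<close>], of c] A_rules(4)[OF x0] \<open>i0 = 0\<close> by auto
  qed
  obtain c c' where c: "u = c \<odot>\<^bsub>component A 0\<^esub> x0" "z = c' \<odot>\<^bsub>component A 0\<^esub> x0"
    using mult[OF u(1)] mult[OF z] by blast
  have x0': "x0 \<in> carrier (component A 0)" using x0 \<open>i0 = 0\<close> by simp
  then have "c \<noteq> 0" using c(1) u(2) by auto
  then have "c' * inverse c * c = c'" by simp
  then have "z = (c' * inverse c * c) \<odot>\<^bsub>component A 0\<^esub> x0" by (simp only: c(2))
  also have "\<dots> = (c' * inverse c) \<odot>\<^bsub>component A 0\<^esub> u"
    unfolding c(1) by (rule A.smult_times[OF x0'])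
  finally show ?thesis by blast
qed

end

section \<open>Singular cochains modulo coboundaries\<close>

lemma coboundary_zero: "coboundary Y p (\<lambda>\<sigma>. 0) = (\<lambda>\<sigma>. 0)"
  by (simp add: coboundary_def fun_eq_iff)

lemma zero_in_coboundaries: "(\<lambda>\<sigma>. 0) \<in> coboundaries Y p"
  unfolding coboundaries_def
  by (rule image_eqI[of _ _ "\<lambda>\<sigma>. 0"]) (simp_all add: coboundary_zero cochains_def)

lemma coboundaries_diff:
  fixes \<phi> \<psi> :: "('a, 'k::field) cochain"
  assumes "\<phi> \<in> coboundaries Y p" "\<psi> \<in> coboundaries Y p"
  shows "(\<lambda>\<sigma>. \<phi> \<sigma> - \<psi> \<sigma>) \<in> coboundaries Y p"
proof -
  obtain f g where fg: "f \<in> cochains Y (p - 1)" "g \<in> cochains Y (p - 1)"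
    "\<phi> = coboundary Y (p - 1) f" "\<psi> = coboundary Y (p - 1) g"
    using assms by (auto simp: coboundaries_def)
  have "(\<lambda>\<sigma>. \<phi> \<sigma> - \<psi> \<sigma>) = coboundary Y (p - 1) (\<lambda>\<sigma>. f \<sigma> - g \<sigma>)"
    by (simp add: fg coboundary_def fun_eq_iff right_diff_distrib sum_subtractf)
  moreover have "(\<lambda>\<sigma>. f \<sigma> - g \<sigma>) \<in> cochains Y (p - 1)" using fg by (simp add: cochains_def)
  ultimately show ?thesis by (auto simp: coboundaries_def)
qed

lemma coset_cocycle_space:
  "B +>\<^bsub>cocycle_space Y p\<^esub> \<phi> = (\<lambda>\<beta> \<sigma>. \<beta> \<sigma> + \<phi> \<sigma>) ` B"
  by (auto simp: a_r_coset_def r_coset_def cocycle_space_def)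

lemma coboundaries_coset_eq:
  fixes \<phi> \<psi> :: "('a, 'k::field) cochain"
  assumes "\<phi> \<in> coboundaries Y p +>\<^bsub>cocycle_space Y p\<^esub> \<psi>"
  shows "coboundaries Y p +>\<^bsub>cocycle_space Y p\<^esub> \<phi> = coboundaries Y p +>\<^bsub>cocycle_space Y p\<^esub> \<psi>"
proof -
  obtain \<beta> where \<beta>: "\<beta> \<in> coboundaries Y p" "\<phi> = (\<lambda>\<sigma>. \<beta> \<sigma> + \<psi> \<sigma>)"
    using assms by (auto simp: coset_cocycle_space)
  have neg: "(\<lambda>\<sigma>. - \<beta> \<sigma>) \<in> coboundaries Y p"
    using coboundaries_diff[OF zero_in_coboundaries \<beta>(1)] by simp
  show ?thesis
    unfolding coset_cocycle_space
  proof (rule equalityI; rule image_subsetI)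
    fix \<gamma> :: "('a, 'k) cochain" assume \<gamma>: "\<gamma> \<in> coboundaries Y p"
    show "(\<lambda>\<sigma>. \<gamma> \<sigma> + \<phi> \<sigma>) \<in> (\<lambda>\<beta> \<sigma>. \<beta> \<sigma> + \<psi> \<sigma>) ` coboundaries Y p"
      by (rule image_eqI[OF _ coboundaries_diff[OF \<gamma> neg]]) (simp add: \<beta>(2) add.assoc)
    show "(\<lambda>\<sigma>. \<gamma> \<sigma> + \<psi> \<sigma>) \<in> (\<lambda>\<beta> \<sigma>. \<beta> \<sigma> + \<phi> \<sigma>) ` coboundaries Y p"
      by (rule image_eqI[OF _ coboundaries_diff[OF \<gamma> \<beta>(1)]]) (simp add: \<beta>(2))
  qed
qed

lemma carrier_cohomology:
  "carrier (cohomology Y p) = (\<lambda>\<phi>. coboundaries Y p +>\<^bsub>cocycle_space Y p\<^esub> \<phi>) ` carrier (cocycle_space Y p)"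
  by (auto simp: cohomology_def quotient_space_def A_RCOSETS_def RCOSETS_def a_r_coset_def)

lemma zero_cohomology: "\<zero>\<^bsub>cohomology Y p\<^esub> = coboundaries Y p"
  by (simp add: cohomology_def quotient_space_def)

lemma cochains_negative: "p < 0 \<Longrightarrow> cochains Y p = {\<lambda>\<sigma>. 0}"
  by (auto simp: cochains_def simplices_def)

lemma coboundaries_trivial:
  assumes "p \<le> 0"
  shows "coboundaries Y p = {\<lambda>\<sigma>. 0}"
proof -
  have "p - 1 < 0" using assms by simp
  then show ?thesis by (simp add: coboundaries_def cochains_negative coboundary_zero)
qed

lemma negative_cohomology:
  assumes "p < 0"
  shows "carrier (cohomology Y p :: ('k::field, ('a, 'k) cochain set) module) = {\<zero>\<^bsub>cohomology Y p\<^esub>}"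
proof -
  have "carrier (cocycle_space Y p :: ('k, ('a, 'k) cochain) module) = {\<lambda>\<sigma>. 0}"
    using coboundary_zero[of Y p] by (auto simp: cocycle_space_def cochains_negative[OF assms])
  then show ?thesis
    using assms by (simp add: carrier_cohomology zero_cohomology coboundaries_trivial coset_cocycle_space)
qed

section \<open>The unit class and its cup products\<close>

definition unit_cochain :: "'a topology \<Rightarrow> ('a, 'k::field) cochain" where
  "unit_cochain Y \<sigma> = (if \<sigma> \<in> simplices Y 0 then 1 else 0)"

definition unit_class :: "'a topology \<Rightarrow> ('a, 'k::field) cochain set" where
  "unit_class Y = coboundaries Y 0 +>\<^bsub>cocycle_space Y 0\<^esub> unit_cochain Y"

lemma face_in_simplices: "\<sigma> \<in> simplices Y 1 \<Longrightarrow> i \<le> 1 \<Longrightarrow> singular_face 1 i \<sigma> \<in> simplices Y 0"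
  using singular_simplex_singular_face[of 1 Y \<sigma> i] by (simp add: simplices_def)

lemma unit_class_in: "unit_class Y \<in> carrier (cohomology Y 0)"
proof -
  have "unit_cochain Y \<in> carrier (cocycle_space Y 0)"
    using face_in_simplices[of _ Y]
    by (auto simp: cocycle_space_def cochains_def unit_cochain_def coboundary_def fun_eq_iff)
  then show ?thesis by (auto simp: carrier_cohomology unit_class_def)
qed

lemma unit_class_eq: "unit_class Y = {unit_cochain Y}"
  by (simp add: unit_class_def coset_cocycle_space coboundaries_trivial)

lemma unit_class_nonzero:
  assumes "topspace Y \<noteq> {}"
  shows "(unit_class Y :: ('a, 'k::field) cochain set) \<noteq> \<zero>\<^bsub>cohomology Y 0\<^esub>"
proof -
  obtain y where y: "y \<in> topspace Y" using assms by blast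
  define \<sigma> where "\<sigma> = restrict (\<lambda>_. y) (standard_simplex 0)"
  have "continuous_map (subtopology (powertop_real UNIV) (standard_simplex 0)) Y \<sigma>"
    by (rule continuous_map_eq[of _ _ "\<lambda>_. y"]) (use y in \<open>auto simp: \<sigma>_def\<close>)
  then have "\<sigma> \<in> simplices Y 0" by (simp add: simplices_def singular_simplex_def \<sigma>_def)
  then have "unit_cochain Y \<sigma> \<noteq> (0 :: 'k)" by (simp add: unit_cochain_def)
  then show ?thesis by (auto simp: zero_cohomology unit_class_eq coboundaries_trivial fun_eq_iff)
qed

text \<open>\<open>cup\<close> is a union over representatives. Once it is known to be a single
  coset, one element identifies it, and cupping a cocycle with the unit cochain returns that
  cocycle.\<close>

lemma cup_unit_class:
  assumes a: "a \<in> carrier (cohomology Y 1)" and cup: "cup Y 1 0 a (unit_class Y) \<in> carrier (cohomology Y 1)"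
  shows "cup Y 1 0 a (unit_class Y) = a"
proof -
  obtain \<phi> where \<phi>: "\<phi> \<in> carrier (cocycle_space Y 1)" "a = coboundaries Y 1 +>\<^bsub>cocycle_space Y 1\<^esub> \<phi>"
    using a by (auto simp: carrier_cohomology)
  have self: "\<phi> \<in> coboundaries Y 1 +>\<^bsub>cocycle_space Y 1\<^esub> \<phi>"
    unfolding coset_cocycle_space by (rule image_eqI[OF _ zero_in_coboundaries]) simp
  have "cochain_cup Y 1 0 \<phi> (unit_cochain Y) = \<phi>"
  proof
    fix \<sigma>
    show "cochain_cup Y 1 0 \<phi> (unit_cochain Y) \<sigma> = \<phi> \<sigma>"
    proof (cases "\<sigma> \<in> simplices Y 1")
      case True
      then have "front_face 1 \<sigma> = \<sigma>"
        by (simp add: front_face_def simplices_def singular_simplex_def extensional_restrict)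
      \<comment> \<open>The back face of dimension 0 of an edge is its last vertex, which is also
        the face omitting vertex 0.\<close>
      moreover have "back_face 1 0 \<sigma> = singular_face 1 0 \<sigma>"
        by (simp add: back_face_def singular_face_def simplical_face_def[abs_def] comp_def cong del: if_weak_cong)
      ultimately show ?thesis
        using True face_in_simplices[OF True, of 0] by (simp add: cochain_cup_def unit_cochain_def)
    next
      case False
      then show ?thesis using \<phi>(1) by (simp add: cochain_cup_def cocycle_space_def cochains_def)
    qed
  qed
  then have "\<phi> \<in> cup Y 1 0 a (unit_class Y)"
    using self by (auto simp: cup_def \<phi>(2) unit_class_eq intro!: bexI[OF _ self])
  moreover obtain \<psi> where \<psi>: "cup Y 1 0 a (unit_class Y) = coboundaries Y 1 +>\<^bsub>cocycle_space Y 1\<^esub> \<psi>"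
    using cup by (auto simp: carrier_cohomology)
  ultimately show ?thesis using coboundaries_coset_eq[of \<phi> Y 1 \<psi>] \<phi>(2) by simp
qed

text \<open>A cell of dimension n exists by definition, and the centre of its disc is mapped into
  the space. A point is needed to see that the unit class is nonzero.\<close>

lemma finite_CW_complex_nonempty:
  assumes "finite_CW_complex Y n"
  shows "topspace Y \<noteq> {}"
proof -
  obtain \<E> d \<Phi> e where "cw_structure Y \<E> d \<Phi>" "e \<in> \<E>"
    using assms by (auto simp: finite_CW_complex_def)
  then have h: "homeomorphic_map (subtopology (disc (d e)) (open_disc (d e))) (subtopology Y e) (\<Phi> e)"
    by (auto simp: cw_structure_def)
  have "(\<lambda>_. 0) \<in> open_disc (d e)"
    by (simp add: open_disc_def disc_def topspace_Euclidean_space)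
  then have "(\<lambda>_. 0) \<in> topspace (subtopology (disc (d e)) (open_disc (d e)))"
    by (auto simp: open_disc_def)
  then have "\<Phi> e (\<lambda>_. 0) \<in> topspace (subtopology Y e)"
    using homeomorphic_imp_surjective_map[OF h] by blast
  then show ?thesis by auto
qed

theorem theorem1p2:
  fixes Y :: "'a topology" and n :: nat
  assumes "finite_CW_complex Y n" and "connected_space Y"
    and "EPY_property TYPE('k::field) Y n"
    and "CHAR('k) = 2 \<Longrightarrow>
      (\<forall>x\<in>carrier (homology_group 1 Y).
         x \<otimes>\<^bsub>homology_group 1 Y\<^esub> x = \<one>\<^bsub>homology_group 1 Y\<^esub> \<longrightarrow> x = \<one>\<^bsub>homology_group 1 Y\<^esub>)"
  shows "(\<forall>a \<in> carrier (cohomology Y 1 :: ('k, ('a, 'k) cochain set) module). \<forall>p q.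
            p \<le> q \<longrightarrow> q \<le> n \<longrightarrow> aomoto_nonzero Y a (int p) \<longrightarrow> aomoto_nonzero Y a (int q)) \<and>
         resonance_variety TYPE('k) Y 0 = {\<zero>\<^bsub>cohomology Y 1\<^esub>} \<and>
         (\<forall>p<n. resonance_variety TYPE('k) Y p \<subseteq> resonance_variety TYPE('k) Y (Suc p))"
proof -
  define V where "V = (cohomology Y 1 :: ('k, ('a, 'k) cochain set) module)"
  obtain \<mu> where \<mu>: "graded_ext_module V \<lparr>component = cohomology Y, act = \<mu>\<rparr>"
    "\<forall>i. \<forall>v\<in>carrier V. \<forall>x\<in>carrier (cohomology Y i). \<mu> 1 i (ext_class V (word [v])) x = cup Y 1 i v x"
    "cyclic V \<lparr>component = cohomology Y, act = \<mu>\<rparr>"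
    "koszul_module V (shift (int n) (graded_dual \<lparr>component = cohomology Y, act = \<mu>\<rparr>))"
    using assms(3) unfolding EPY_property_def Let_def V_def by auto
  define A where "A = \<lparr>component = (cohomology Y :: int \<Rightarrow> ('k, ('a, 'k) cochain set) module), act = \<mu>\<rparr>"
  have comp: "component A i = cohomology Y i" for i by (simp add: A_def)
  have "topspace Y \<noteq> {}" by (rule finite_CW_complex_nonempty[OF assms(1)])
  note unit = unit_class_in[of Y] unit_class_nonzero[OF this]
  interpret koszul_dual V A n
  proof (intro koszul_dual.intro koszul_dual_axioms.intro)
    show "exterior V"
      using \<mu>(1) by (simp add: exterior_def scalar_module_def graded_ext_module_def V_def)
    show "graded_ext_module V A" "koszul_module V (shift (int n) (graded_dual A))"
      using \<mu> by (simp_all add: A_def)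
    show "carrier (component A i) = {\<zero>\<^bsub>component A i\<^esub>}" if "i < 0" for i
      unfolding comp using that by (rule negative_cohomology)
    show "carrier (component A 0) \<noteq> {\<zero>\<^bsub>component A 0\<^esub>}"
      unfolding comp using unit by blast
  qed
  have cup: "cup Y 1 i a x = mult_by a i x" if "a \<in> carrier V" "x \<in> carrier (component A i)" for a i x
    using \<mu>(2) that by (simp add: A_def)
  have nonzero_iff: "aomoto_nonzero Y a p \<longleftrightarrow> \<not> exact_at a p" if a: "a \<in> carrier V" for a p
  proof -
    let ?K = "{x \<in> carrier (component A p). mult_by a p x = \<zero>\<^bsub>component A (p + 1)\<^esub>}"
    let ?N = "mult_by a (p - 1) ` carrier (component A (p - 1))"
    have K: "{x \<in> carrier (cohomology Y p). cup Y 1 p a x = \<zero>\<^bsub>cohomology Y (p + 1)\<^esub>} = ?K"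
      using cup[OF a, of _ p] by (auto simp: comp)
    have N: "cup Y 1 (p - 1) a ` carrier (cohomology Y (p - 1)) = ?N"
      using cup[OF a, of _ "p - 1"] by (simp add: comp cong: image_cong_simp)
    have "submodule ?N scalars (component A p)" using image_submodule[OF a, of "p - 1"] by simp
    from quotient_space_nontrivial_iff[OF A_module this kernel_submodule[OF a]]
    have "aomoto_nonzero Y a p \<longleftrightarrow> \<not> ?K \<subseteq> ?N"
      unfolding aomoto_nonzero_def aomoto_cohomology_def K N by (simp add: comp)
    then show ?thesis unfolding exact_at_def by blast
  qed
  \<comment> \<open>Exactness descends by \<open>exact_at_pred\<close>, so its failure
    climbs.\<close>
  have propagate: "aomoto_nonzero Y a (int q)"
    if a: "a \<in> carrier V" and p: "aomoto_nonzero Y a (int p)" and "p \<le> q" "q \<le> n" for a p q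
    using \<open>p \<le> q\<close> \<open>q \<le> n\<close>
  proof (induction q rule: dec_induct)
    case base
    show ?case by (rule p)
  next
    case (step q)
    then show ?case using exact_at_pred[OF a, of "int (Suc q)"] nonzero_iff[OF a] by auto
  qed
  have unit': "unit_class Y \<in> carrier (component A 0)" "unit_class Y \<noteq> \<zero>\<^bsub>component A 0\<^esub>"
    using unit by (simp_all add: comp)
  have image_0: "mult_by a (- 1) ` carrier (component A (- 1)) = {\<zero>\<^bsub>component A 0\<^esub>}" if "a \<in> carrier V" for a
    using A_negative[of "- 1"] mult_by_zero[OF that, of "- 1"] by simp
  have unit_cup: "mult_by a 0 (unit_class Y) = a" if a: "a \<in> carrier V" for a
    using cup_unit_class[of a Y] cup[OF a unit'(1)] mult_by_rules(1)[OF a unit'(1)] a by (simp add: V_def comp)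
  \<comment> \<open>Degree 0 is a line, so the unit is a multiple of any nonzero \<open>z\<close>
    there. If \<open>a\<close> kills such a \<open>z\<close>, it kills the unit, and the product of
    \<open>a\<close> with the unit is \<open>a\<close>.\<close>
  have resonance_0: "aomoto_nonzero Y a 0 \<longleftrightarrow> a = \<zero>\<^bsub>V\<^esub>" if a: "a \<in> carrier V" for a
  proof
    assume "aomoto_nonzero Y a 0"
    then obtain z where z: "z \<in> carrier (component A 0)" "mult_by a 0 z = \<zero>\<^bsub>component A 1\<^esub>"
      "z \<notin> mult_by a (- 1) ` carrier (component A (- 1))"
      unfolding nonzero_iff[OF a] exact_at_def by auto
    then have "z \<noteq> \<zero>\<^bsub>component A 0\<^esub>" using image_0[OF a] by simp
    then obtain c where c: "unit_class Y = c \<odot>\<^bsub>component A 0\<^esub> z"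
      using cyclic_degree_zero[OF _ z(1) _ unit'(1)] \<mu>(3) by (auto simp: A_def)
    have "a = c \<odot>\<^bsub>component A (0 + 1)\<^esub> mult_by a 0 z"
      using unit_cup[OF a] mult_by_rules(3)[OF a z(1)] by (simp add: c)
    then have "a = c \<odot>\<^bsub>component A 1\<^esub> \<zero>\<^bsub>component A 1\<^esub>" using z(2) by simp
    then show "a = \<zero>\<^bsub>V\<^esub>" using A.smult_r_null[of c 1] by (simp add: comp V_def)
  next
    assume "a = \<zero>\<^bsub>V\<^esub>"
    then have "mult_by a 0 (unit_class Y) = \<zero>\<^bsub>component A (0 + 1)\<^esub>"
      using unit_cup[OF a] by (simp add: comp V_def)
    moreover have "unit_class Y \<notin> mult_by a (- 1) ` carrier (component A (- 1))"
      unfolding image_0[OF a] using unit'(2) by simp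
    ultimately show "aomoto_nonzero Y a 0"
      unfolding nonzero_iff[OF a] exact_at_def using unit'(1) by (auto simp del: image_iff)
  qed
  have "resonance_variety TYPE('k) Y 0 = {\<zero>\<^bsub>V\<^esub>}"
    using resonance_0 zero_closed by (auto simp: resonance_variety_def V_def)
  moreover have "resonance_variety TYPE('k) Y p \<subseteq> resonance_variety TYPE('k) Y (Suc p)" if "p < n" for p
    using propagate[of _ p "Suc p"] that by (auto simp: resonance_variety_def V_def)
  ultimately show ?thesis
    using propagate unfolding V_def by simp
qed

end
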